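(* For every $i$ and every monomial ideal $I$ of $S_A$ (an ideal generated by monomials $t^b$, $b\in\mathbb{N}A$), the local cohomology module $H^i_I(S_A)$ is of finite length as a left $D_A$-module.
   Context: $\mathbb{K}$ is an algebraically closed field of characteristic $0$. $A$ is a $d\times n$ integer matrix with columns $a_1,\dots,a_n$ such that $\mathbb{Z}A=\mathbb{Z}^d$. $\mathbb{N}A$ is the semigroup (monoid, containing $0$) generated by $a_1,\dots,a_n$, and $S_A=\mathbb{K}[\mathbb{N}A]=\mathbb{K}[t^{a_1},\dots,t^{a_n}]\subseteq\mathbb{K}[t_1^{\pm1},\dots,t_d^{\pm1}]$ is the associated toric algebra (not assumed normal). For a commutative $\mathbb{K}$-algebra $R$, put $D_0(R;\mathbb{K})=R$ and, for $i>0$, $D_i(R;\mathbb{K})=\{f\in\mathrm{Hom}_{\mathbb{K}}(R,R)\mid [f,r]\in D_{i-1}(R;\mathbb{K})\text{ for all }r\in R\}$; the ring of differential operators is $D(R;\mathbb{K})=\bigcup_j D_j(R;\mathbb{K})$. Write $D_A=D(S_A;\mathbb{K})$. If $M$ is a left $D(R;\mathbb{K})$-module and $f\in R$, the localization $M_f$ carries a unique left $D(R;\mathbb{K})$-module structure extending its $R$-module structure such that $M\to M_f$ is $D(R;\mathbb{K})$-linear. For an ideal $I=(f_1,\dots,f_t)$ of a Noetherian ring $R$, $H^i_I(R)$ is the $i$-th local cohomology module, i.e. the $i$-th cohomology of the Čech complex $0\to R\to\bigoplus_i R_{f_i}\to\bigoplus_{i<j}R_{f_if_j}\to\cdots\to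 R_{f_1\cdots f_t}\to0$; this is a complex of left $D(R;\mathbb{K})$-modules, which gives $H^i_I(R)$ its left $D(R;\mathbb{K})$-module structure. *)

theory Defs
  imports
    "HOL-Analysis.Finite_Cartesian_Product"
    "HOL-Library.Poly_Mapping"
    "HOL-Algebra.Ideal"
    "HOL-Algebra.Module"
    "HOL-Algebra.Algebraic_Closure_Type"
begin

section \<open>Modules over a not necessarily commutative ring\<close>

text \<open>The locale \<^locale>\<open>module\<close> requires a commutative ring of scalars; the axioms below are the
  same ones over an arbitrary ring. The fields \<^const>\<open>mult\<close> and \<^const>\<open>one\<close> of the record \<open>M\<close>
  play no role.\<close>

locale left_module = R?: ring R + M?: abelian_group M
  for R :: "('a, 'm) ring_scheme" (structure) and M :: "('a, 'b, 'n) module_scheme" (structure) +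
  assumes smult_closed:
      "\<lbrakk>a \<in> carrier R; x \<in> carrier M\<rbrakk> \<Longrightarrow> a \<odot>\<^bsub>M\<^esub> x \<in> carrier M"
    and smult_l_distr:
      "\<lbrakk>a \<in> carrier R; b \<in> carrier R; x \<in> carrier M\<rbrakk> \<Longrightarrow>
        (a \<oplus>\<^bsub>R\<^esub> b) \<odot>\<^bsub>M\<^esub> x = a \<odot>\<^bsub>M\<^esub> x \<oplus>\<^bsub>M\<^esub> b \<odot>\<^bsub>M\<^esub> x"
    and smult_r_distr:
      "\<lbrakk>a \<in> carrier R; x \<in> carrier M; y \<in> carrier M\<rbrakk> \<Longrightarrow>
        a \<odot>\<^bsub>M\<^esub> (x \<oplus>\<^bsub>M\<^esub> y) = a \<odot>\<^bsub>M\<^esub> x \<oplus>\<^bsub>M\<^esub> a \<odot>\<^bsub>M\<^esub> y"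
    and smult_assoc1:
      "\<lbrakk>a \<in> carrier R; b \<in> carrier R; x \<in> carrier M\<rbrakk> \<Longrightarrow>
        (a \<otimes>\<^bsub>R\<^esub> b) \<odot>\<^bsub>M\<^esub> x = a \<odot>\<^bsub>M\<^esub> (b \<odot>\<^bsub>M\<^esub> x)"
    and smult_one:
      "x \<in> carrier M \<Longrightarrow> \<one>\<^bsub>R\<^esub> \<odot>\<^bsub>M\<^esub> x = x"

text \<open>A module has finite length if it has a composition series, i.e. a finite strictly increasing
  chain of submodules from \<open>0\<close> to the whole module into which no further submodule can be inserted.\<close>

locale finite_length_module = left_module +
  assumes composition_series:
    "\<exists>(n::nat) N. N 0 = {\<zero>\<^bsub>M\<^esub>} \<and> N n = carrier M
       \<and> (\<forall>k\<le>n. submodule (N k) R M)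
       \<and> (\<forall>k<n. N k \<subset> N (Suc k) \<and> \<not> (\<exists>L. submodule L R M \<and> N k \<subset> L \<and> L \<subset> N (Suc k)))"

definition quot_module :: "('r, 'b, 'n) module_scheme \<Rightarrow> 'b set \<Rightarrow> ('r, 'b set) module" where
  "quot_module M N =
    \<lparr>carrier = a_rcosets\<^bsub>M\<^esub> N, monoid.mult = undefined, one = undefined,
     zero = N, add = set_add M,
     module.smult = (\<lambda>a U. \<Union>x\<in>U. N +>\<^bsub>M\<^esub> (a \<odot>\<^bsub>M\<^esub> x))\<rparr>"


section \<open>Differential operators\<close>

text \<open>\<open>R\<close> is a commutative \<open>K\<close>-algebra. Maps from \<open>R\<close> to \<open>R\<close> are represented by functions that are
  \<^const>\<open>undefined\<close> outside \<open>carrier R\<close>, so that equality of operators is equality of functions.\<close>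

definition linear_endos :: "('k, 'l) ring_scheme \<Rightarrow> ('k, 'a, 'm) module_scheme \<Rightarrow> ('a \<Rightarrow> 'a) set" where
  "linear_endos K R = {P \<in> carrier R \<rightarrow>\<^sub>E carrier R.
     (\<forall>x\<in>carrier R. \<forall>y\<in>carrier R. P (x \<oplus>\<^bsub>R\<^esub> y) = P x \<oplus>\<^bsub>R\<^esub> P y) \<and>
     (\<forall>c\<in>carrier K. \<forall>x\<in>carrier R. P (c \<odot>\<^bsub>R\<^esub> x) = c \<odot>\<^bsub>R\<^esub> P x)}"

definition mult_op :: "('a, 'm) ring_scheme \<Rightarrow> 'a \<Rightarrow> 'a \<Rightarrow> 'a" where
  "mult_op R r = (\<lambda>x\<in>carrier R. r \<otimes>\<^bsub>R\<^esub> x)"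

definition commutator_op :: "('a, 'm) ring_scheme \<Rightarrow> ('a \<Rightarrow> 'a) \<Rightarrow> 'a \<Rightarrow> 'a \<Rightarrow> 'a" where
  "commutator_op R P r = (\<lambda>x\<in>carrier R. P (r \<otimes>\<^bsub>R\<^esub> x) \<ominus>\<^bsub>R\<^esub> r \<otimes>\<^bsub>R\<^esub> P x)"

primrec diff_ops :: "('k, 'l) ring_scheme \<Rightarrow> ('k, 'a, 'm) module_scheme \<Rightarrow> nat \<Rightarrow> ('a \<Rightarrow> 'a) set" where
  "diff_ops K R 0 = mult_op R ` carrier R"
| "diff_ops K R (Suc i) =
     {P \<in> linear_endos K R. \<forall>r\<in>carrier R. commutator_op R P r \<in> diff_ops K R i}"

definition diff_ring :: "('k, 'l) ring_scheme \<Rightarrow> ('k, 'a, 'm) module_scheme \<Rightarrow> ('a \<Rightarrow> 'a) ring" where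
  "diff_ring K R =
    \<lparr>carrier = (\<Union>i. diff_ops K R i),
     monoid.mult = (\<lambda>P Q. compose (carrier R) P Q),
     one = (\<lambda>x\<in>carrier R. x),
     zero = (\<lambda>x\<in>carrier R. \<zero>\<^bsub>R\<^esub>),
     add = (\<lambda>P Q. \<lambda>x\<in>carrier R. P x \<oplus>\<^bsub>R\<^esub> Q x)\<rparr>"


section \<open>The localization at a single element\<close>

text \<open>\<open>(r, n)\<close> stands for the fraction \<open>r / f\<^sup>n\<close>; \<open>f\<close> may be a zero divisor or \<open>0\<close>.\<close>

definition loc_rel :: "('a, 'm) ring_scheme \<Rightarrow> 'a \<Rightarrow> (('a \<times> nat) \<times> ('a \<times> nat)) set" where
  "loc_rel R f = {((r, m), (s, n)). r \<in> carrier R \<and> s \<in> carrier R \<and>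
     (\<exists>k::nat. f [^]\<^bsub>R\<^esub> k \<otimes>\<^bsub>R\<^esub> (f [^]\<^bsub>R\<^esub> n \<otimes>\<^bsub>R\<^esub> r) = f [^]\<^bsub>R\<^esub> k \<otimes>\<^bsub>R\<^esub> (f [^]\<^bsub>R\<^esub> m \<otimes>\<^bsub>R\<^esub> s))}"

definition loc_frac :: "('a, 'm) ring_scheme \<Rightarrow> 'a \<Rightarrow> 'a \<Rightarrow> nat \<Rightarrow> ('a \<times> nat) set" where
  "loc_frac R f r n = loc_rel R f `` {(r, n)}"

definition loc :: "('a, 'm) ring_scheme \<Rightarrow> 'a \<Rightarrow> ('a \<times> nat) set ring" where
  "loc R f =
    \<lparr>carrier = (carrier R \<times> UNIV) // loc_rel R f,
     monoid.mult = (\<lambda>U V. \<Union>(r, m)\<in>U. \<Union>(s, n)\<in>V. loc_frac R f (r \<otimes>\<^bsub>R\<^esub> s) (m + n)),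
     one = loc_frac R f \<one>\<^bsub>R\<^esub> 0,
     zero = loc_frac R f \<zero>\<^bsub>R\<^esub> 0,
     add = (\<lambda>U V. \<Union>(r, m)\<in>U. \<Union>(s, n)\<in>V.
       loc_frac R f (f [^]\<^bsub>R\<^esub> n \<otimes>\<^bsub>R\<^esub> r \<oplus>\<^bsub>R\<^esub> f [^]\<^bsub>R\<^esub> m \<otimes>\<^bsub>R\<^esub> s) (m + n))\<rparr>"

text \<open>The canonical map from \<open>R\<^sub>f\<close> to \<open>R\<^sub>h\<close> for \<open>h = f g\<close>: it sends \<open>r / f\<^sup>n\<close> to \<open>r g\<^sup>n / h\<^sup>n\<close>.\<close>

definition loc_map :: "('a, 'm) ring_scheme \<Rightarrow> 'a \<Rightarrow> 'a \<Rightarrow> ('a \<times> nat) set \<Rightarrow> ('a \<times> nat) set" where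
  "loc_map R g h U = (\<Union>(r, n)\<in>U. loc_frac R h (r \<otimes>\<^bsub>R\<^esub> g [^]\<^bsub>R\<^esub> n) n)"

definition with_action :: "('b, 'n) ring_scheme \<Rightarrow> ('r \<Rightarrow> 'b \<Rightarrow> 'b) \<Rightarrow> ('r, 'b) module" where
  "with_action M act =
    \<lparr>carrier = carrier M, monoid.mult = monoid.mult M, one = one M, zero = zero M, add = add M,
     module.smult = act\<rparr>"

text \<open>The unique left module structure over the ring of differential operators on \<open>R\<^sub>f\<close> that extends
  the \<open>R\<close>-module structure and makes the map from \<open>R\<close> to \<open>R\<^sub>f\<close> linear. The first clause also
  fixes the values of \<open>act\<close> outside the carriers, so that the description is unique.\<close>

definition is_loc_action ::
  "('k, 'l) ring_scheme \<Rightarrow> ('k, 'a, 'm) module_scheme \<Rightarrow> 'a \<Rightarrow>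
    (('a \<Rightarrow> 'a) \<Rightarrow> ('a \<times> nat) set \<Rightarrow> ('a \<times> nat) set) \<Rightarrow> bool" where
  "is_loc_action K R f act \<longleftrightarrow>
     act \<in> carrier (diff_ring K R) \<rightarrow>\<^sub>E (carrier (loc R f) \<rightarrow>\<^sub>E carrier (loc R f)) \<and>
     left_module (diff_ring K R) (with_action (loc R f) act) \<and>
     (\<forall>r\<in>carrier R. \<forall>s\<in>carrier R. \<forall>n.
        act (mult_op R r) (loc_frac R f s n) = loc_frac R f (r \<otimes>\<^bsub>R\<^esub> s) n) \<and>
     (\<forall>P\<in>carrier (diff_ring K R). \<forall>r\<in>carrier R.
        act P (loc_frac R f r 0) = loc_frac R f (P r) 0)"

definition loc_action ::
  "('k, 'l) ring_scheme \<Rightarrow> ('k, 'a, 'm) module_scheme \<Rightarrow> 'a \<Rightarrow>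
    ('a \<Rightarrow> 'a) \<Rightarrow> ('a \<times> nat) set \<Rightarrow> ('a \<times> nat) set" where
  "loc_action K R f = (THE act. is_loc_action K R f act)"


section \<open>The Cech complex and local cohomology\<close>

text \<open>A \<open>k\<close>-cochain for \<open>fs = [f\<^sub>0, \<dots>]\<close> assigns to every \<open>k\<close>-element set \<open>J\<close> of indices an element of
  the localization at the product of the \<open>f\<^sub>j\<close>, \<open>j \<in> J\<close>. In degree \<open>0\<close> this is the localization
  of \<open>R\<close> at \<open>1\<close>, i.e. \<open>R\<close> itself.\<close>

definition cech_index :: "'a list \<Rightarrow> nat \<Rightarrow> nat set set" where
  "cech_index fs k = {J. J \<subseteq> {..<length fs} \<and> card J = k}"

definition cech_prod :: "('a, 'm) ring_scheme \<Rightarrow> 'a list \<Rightarrow> nat set \<Rightarrow> 'a" where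
  "cech_prod R fs J = (\<Otimes>\<^bsub>R\<^esub>j\<in>J. fs ! j)"

definition cech_module ::
  "('k, 'l) ring_scheme \<Rightarrow> ('k, 'a, 'm) module_scheme \<Rightarrow> 'a list \<Rightarrow> nat \<Rightarrow>
    ('a \<Rightarrow> 'a, nat set \<Rightarrow> ('a \<times> nat) set) module" where
  "cech_module K R fs k =
    \<lparr>carrier = (\<Pi>\<^sub>E J\<in>cech_index fs k. carrier (loc R (cech_prod R fs J))),
     monoid.mult = undefined, one = undefined,
     zero = (\<lambda>J\<in>cech_index fs k. \<zero>\<^bsub>loc R (cech_prod R fs J)\<^esub>),
     add = (\<lambda>c c'. \<lambda>J\<in>cech_index fs k. c J \<oplus>\<^bsub>loc R (cech_prod R fs J)\<^esub> c' J),
     module.smult = (\<lambda>P c. \<lambda>J\<in>cech_index fs k. loc_action K R (cech_prod R fs J) P (c J))\<rparr>"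

definition cech_diff ::
  "('a, 'm) ring_scheme \<Rightarrow> 'a list \<Rightarrow> nat \<Rightarrow>
    (nat set \<Rightarrow> ('a \<times> nat) set) \<Rightarrow> nat set \<Rightarrow> ('a \<times> nat) set" where
  "cech_diff R fs k c = (\<lambda>J\<in>cech_index fs (Suc k).
     \<Oplus>\<^bsub>loc R (cech_prod R fs J)\<^esub>j\<in>J.
       (let x = loc_map R (fs ! j) (cech_prod R fs J) (c (J - {j}))
        in if even (card {i\<in>J. i < j}) then x else \<ominus>\<^bsub>loc R (cech_prod R fs J)\<^esub> x))"

definition cech_cocycles ::
  "('k, 'l) ring_scheme \<Rightarrow> ('k, 'a, 'm) module_scheme \<Rightarrow> 'a list \<Rightarrow> nat \<Rightarrow>
    (nat set \<Rightarrow> ('a \<times> nat) set) set" where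
  "cech_cocycles K R fs i =
     {c \<in> carrier (cech_module K R fs i). cech_diff R fs i c = \<zero>\<^bsub>cech_module K R fs (Suc i)\<^esub>}"

definition cech_coboundaries ::
  "('k, 'l) ring_scheme \<Rightarrow> ('k, 'a, 'm) module_scheme \<Rightarrow> 'a list \<Rightarrow> nat \<Rightarrow>
    (nat set \<Rightarrow> ('a \<times> nat) set) set" where
  "cech_coboundaries K R fs i =
     (case i of 0 \<Rightarrow> {\<zero>\<^bsub>cech_module K R fs 0\<^esub>}
      | Suc j \<Rightarrow> cech_diff R fs j ` carrier (cech_module K R fs j))"

text \<open>\<open>H\<^sup>i\<^sub>I(R)\<close> for the ideal \<open>I\<close> generated by the list \<open>fs\<close>.\<close>

definition local_cohomology ::
  "('k, 'l) ring_scheme \<Rightarrow> ('k, 'a, 'm) module_scheme \<Rightarrow> 'a list \<Rightarrow> nat \<Rightarrow>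
    ('a \<Rightarrow> 'a, (nat set \<Rightarrow> ('a \<times> nat) set) set) module" where
  "local_cohomology K R fs i =
     quot_module ((cech_module K R fs i)\<lparr>carrier := cech_cocycles K R fs i\<rparr>)
       (cech_coboundaries K R fs i)"


section \<open>Toric algebras\<close>

definition lattice_of :: "int ^ 'n ^ 'd \<Rightarrow> (int ^ 'd) set" where
  "lattice_of A = {(\<Sum>j\<in>UNIV. c j *s column j A) | c :: 'n \<Rightarrow> int. True}"

definition monoid_of :: "int ^ 'n ^ 'd \<Rightarrow> (int ^ 'd) set" where
  "monoid_of A = {(\<Sum>j\<in>UNIV. int (c j) *s column j A) | c :: 'n \<Rightarrow> nat. True}"

text \<open>The type \<open>int ^ 'd \<Rightarrow>\<^sub>0 'k\<close> with its convolution product is the Laurent polynomial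
  ring over \<open>'k\<close>: the coefficient of \<open>t\<^sup>b\<close> in \<open>p\<close> is \<open>lookup p b\<close>.\<close>

definition toric_algebra :: "int ^ 'n ^ 'd \<Rightarrow> ('k::field, (int ^ 'd) \<Rightarrow>\<^sub>0 'k) module" where
  "toric_algebra A =
    \<lparr>carrier = {p. Poly_Mapping.keys p \<subseteq> monoid_of A},
     monoid.mult = (*), one = 1, zero = 0, add = (+),
     module.smult = (\<lambda>c p. Poly_Mapping.single 0 c * p)\<rparr>"

definition monomial_ideal :: "int ^ 'n ^ 'd \<Rightarrow> ((int ^ 'd) \<Rightarrow>\<^sub>0 'k::field) set \<Rightarrow> bool" where
  "monomial_ideal A I \<longleftrightarrow>
     (\<exists>B \<subseteq> monoid_of A. I = Idl\<^bsub>toric_algebra A\<^esub> ((\<lambda>b. Poly_Mapping.single b 1) ` B))"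

end

theory Submission
  imports Defs "HOL-Library.Function_Algebras" "HOL-Analysis.Cartesian_Space"
    "HOL-Computational_Algebra.Polynomial_Factorial"
begin

text \<open>
  All localizations of the toric algebra \<open>S\<^sub>A\<close> embed into one field \<open>F\<close>, and every differential
  operator extends uniquely to the fractions by the recursion \<open>P(r/s) = (P(r) - [P,s](r/s)) / s\<close> on
  its order (\<open>extends_exists\<close>). So the Cech complex becomes a complex of functions with values in \<open>F\<close>
  on which a single action is defined, and the maps between localizations become inclusions.

  Finite length is detected by a rank: it suffices that the submodules carry a bounded natural number
  which grows strictly along strict inclusions. Such ranks pass to subquotients and finite products,
  so for monomials \<open>t\<^sup>b\<close> as generators only the localization of \<open>S\<^sub>A\<close> at one monomial is needed. There,
  the Euler operators separate the exponents, hence a \<open>D\<close>-submodule is spanned by the Laurent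
  monomials \<open>t\<^sup>u\<close> it contains (\<open>stable_graded\<close>). If a polynomial function \<open>p\<close> vanishes on the set
  \<open>\<Omega>(w)\<close> of all \<open>a\<close> in the semigroup with \<open>a + w\<close> outside of it, then \<open>t\<^sup>u \<mapsto> p(u) t\<^sup>u\<^sup>+\<^sup>w\<close> is a
  differential operator of \<open>S\<^sub>A\<close>. The set \<open>\<Omega>(w)\<close> is a finite union of translates \<open>c + \<nat>\<tau>\<close> of
  semigroups generated by sets \<open>\<tau>\<close> of columns (\<open>down_closed_slabs\<close>); thus a suitable product \<open>p\<close> of
  affine functions has \<open>p(u) \<noteq> 0\<close> as soon as \<open>u\<close> avoids the finitely many spaces \<open>c + \<rat>\<tau>\<close>. Attach to
  \<open>u\<close> its signature: for every \<open>\<tau>\<close>, those \<open>v\<close> in a box of \<open>\<rat>\<tau>\<close> for which \<open>u + v\<close> lies in the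
  semigroup enlarged by \<open>\<int>\<tau>\<close>. If \<open>u\<close> and \<open>v\<close> have the same signature, then \<open>u\<close> avoids those spaces for
  \<open>w = v - u\<close> (\<open>signature_eq_polyfun\<close>), so a submodule contains \<open>t\<^sup>u\<close> iff it contains \<open>t\<^sup>v\<close>. There are
  finitely many signatures, and counting those that occur is a rank (\<open>bounded_rank_Loc_monomial\<close>).

  The given generators of the ideal need not be monomials, and the localizations at them are not
  accessible to this argument. But the cohomology does not change if an element \<open>x\<close> of the ideal is
  added to a list of generators: the kernel of the restriction map between the two Cech complexes is
  the Cech complex of the old list localized at \<open>x\<close>, where the old generators generate the unit ideal,
  so it is exact (\<open>relative_exact\<close>). Appending finitely many monomial generators to the given ones,
  and then removing the given ones, compares both lists (\<open>bounded_cohomology_generators\<close>).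
\<close>


section \<open>Rank functions\<close>

text \<open>A bound on the length of the chains in \<open>\<L>\<close>, in a form that is easy to
  transport: for submodules of a fixed module it holds iff the module has finite length.\<close>

definition bounded_rank :: "'b set set \<Rightarrow> bool" where
  "bounded_rank \<L> \<longleftrightarrow> (\<exists>(h :: 'b set \<Rightarrow> nat) n.
     (\<forall>U\<in>\<L>. h U \<le> n) \<and> (\<forall>U\<in>\<L>. \<forall>W\<in>\<L>. U \<subset> W \<longrightarrow> h U < h W))"

lemma bounded_rank_pullback:
  assumes "bounded_rank \<M>"
    and "\<And>U. U \<in> \<L> \<Longrightarrow> \<Phi> U \<in> \<M>"
    and "\<And>U W. U \<in> \<L> \<Longrightarrow> W \<in> \<L> \<Longrightarrow> U \<subset> W \<Longrightarrow> \<Phi> U \<subset> \<Phi> W"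
  shows "bounded_rank \<L>"
proof -
  obtain h n where h: "\<forall>U\<in>\<M>. h U \<le> (n::nat)" "\<forall>U\<in>\<M>. \<forall>W\<in>\<M>. U \<subset> W \<longrightarrow> h U < h W"
    using assms(1) unfolding bounded_rank_def by (elim exE conjE)
  show ?thesis unfolding bounded_rank_def
    by (rule exI[of _ "\<lambda>U. h (\<Phi> U)"], rule exI[of _ n]) (use h assms(2,3) in simp)
qed

lemma bounded_rank_subset:
  assumes "bounded_rank \<M>" and "\<L> \<subseteq> \<M>"
  shows "bounded_rank \<L>"
  by (rule bounded_rank_pullback[OF assms(1), where \<Phi> = "\<lambda>U. U"]) (use assms(2) in blast)+

text \<open>Climb from \<open>U\<close>, choosing at each step a member of minimal rank above the
  current one. The rank strictly increases and is bounded, so this stops at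
  \<open>T\<close>.\<close>

lemma bounded_rank_saturated_chain:
  assumes "bounded_rank \<L>" and "U \<in> \<L>" and "T \<in> \<L>" and "U \<subseteq> T"
  shows "\<exists>(n::nat) N. N 0 = U \<and> N n = T \<and> (\<forall>k\<le>n. N k \<in> \<L>)
       \<and> (\<forall>k<n. N k \<subset> N (Suc k) \<and> \<not> (\<exists>L\<in>\<L>. N k \<subset> L \<and> L \<subset> N (Suc k)))"
proof -
  obtain h b where hb: "\<forall>U\<in>\<L>. h U \<le> (b::nat)"
    and hm: "\<forall>U\<in>\<L>. \<forall>W\<in>\<L>. U \<subset> W \<longrightarrow> h U < h W"
    using assms(1) unfolding bounded_rank_def by (elim exE conjE)
  show ?thesis
    using assms(2,4)
  proof (induction "b - h U" arbitrary: U rule: less_induct)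
    case less
    show ?case
    proof (cases "U = T")
      case True
      then show ?thesis using less.prems(1) by (intro exI[of _ 0] exI[of _ "\<lambda>_. U"]) simp
    next
      case False
      let ?P = "\<lambda>W. W \<in> \<L> \<and> U \<subset> W \<and> W \<subseteq> T"
      have "?P T" using False less.prems assms(3) by auto
      \<comment> \<open>nothing fits strictly between \<open>U\<close> and a member of minimal rank above it\<close>
      from ex_has_least_nat[of ?P T h, OF this]
      obtain W where "?P W \<and> (\<forall>Z. ?P Z \<longrightarrow> h W \<le> h Z)" ..
      then have W: "?P W" and Wmin: "\<And>Z. ?P Z \<Longrightarrow> h W \<le> h Z" by simp_all
      have "h U < h W" "h W \<le> b" using hm hb W less.prems by auto
      then have "b - h W < b - h U" by linarith
      from less.hyps[OF this] W obtain n :: nat and N where N: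
        "N 0 = W" "N n = T" "\<And>k. k \<le> n \<Longrightarrow> N k \<in> \<L>"
        "\<And>k. k < n \<Longrightarrow> N k \<subset> N (Suc k) \<and> \<not> (\<exists>L\<in>\<L>. N k \<subset> L \<and> L \<subset> N (Suc k))"
        by auto
      have UW: "\<not> (\<exists>L\<in>\<L>. U \<subset> L \<and> L \<subset> W)"
        using Wmin hm W by (metis leD order.trans psubset_imp_subset)
      let ?N = "case_nat U N"
      have "\<forall>k\<le>Suc n. ?N k \<in> \<L>" using N(3) less.prems(1) by (auto split: nat.splits)
      moreover have "?N k \<subset> ?N (Suc k) \<and> \<not> (\<exists>L\<in>\<L>. ?N k \<subset> L \<and> L \<subset> ?N (Suc k))"
        if "k < Suc n" for k
      proof (cases k)
        case 0
        then show ?thesis using N(1) W UW by simp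
      next
        case (Suc j)
        then show ?thesis using N(4)[of j] that by simp
      qed
      ultimately show ?thesis using N(2) by (intro exI[of _ "Suc n"] exI[of _ ?N]) simp
    qed
  qed
qed


section \<open>Modules of finite length and quotient modules\<close>

lemma submodule_carrier:
  assumes "left_module R M" shows "submodule (carrier M) R M"
proof -
  interpret left_module R M by fact
  show ?thesis
    by (intro submodule.intro subgroup.intro submodule_axioms.intro)
      (auto simp: smult_closed intro: a_inv_closed[unfolded a_inv_def])
qed

lemma left_module_smult_zero:
  assumes "left_module R M" "a \<in> carrier R" shows "a \<odot>\<^bsub>M\<^esub> \<zero>\<^bsub>M\<^esub> = \<zero>\<^bsub>M\<^esub>"
proof -
  interpret left_module R M by fact
  have "a \<odot>\<^bsub>M\<^esub> \<zero>\<^bsub>M\<^esub> \<oplus>\<^bsub>M\<^esub> a \<odot>\<^bsub>M\<^esub> \<zero>\<^bsub>M\<^esub> = a \<odot>\<^bsub>M\<^esub> \<zero>\<^bsub>M\<^esub> \<oplus>\<^bsub>M\<^esub> \<zero>\<^bsub>M\<^esub>"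
    using smult_r_distr[of a "\<zero>\<^bsub>M\<^esub>" "\<zero>\<^bsub>M\<^esub>"] assms(2) smult_closed[of a "\<zero>\<^bsub>M\<^esub>"] by simp
  then show ?thesis using assms(2) smult_closed[of a "\<zero>\<^bsub>M\<^esub>"] by (metis M.add.l_cancel M.zero_closed)
qed

lemma submodule_zero:
  assumes "left_module R M" shows "submodule {\<zero>\<^bsub>M\<^esub>} R M"
proof -
  interpret left_module R M by fact
  show ?thesis
    by (intro submodule.intro subgroup.intro submodule_axioms.intro)
      (auto simp: left_module_smult_zero[OF assms] a_inv_def[symmetric])
qed

lemma finite_length_moduleI:
  assumes "left_module R M" and "bounded_rank {L. submodule L R M}"
  shows "finite_length_module R M"
proof -
  interpret left_module R M by fact
  have "\<exists>(n::nat) N. N 0 = {\<zero>\<^bsub>M\<^esub>} \<and> N n = carrier M \<and> (\<forall>k\<le>n. N k \<in> {L. submodule L R M})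
       \<and> (\<forall>k<n. N k \<subset> N (Suc k) \<and> \<not> (\<exists>L\<in>{L. submodule L R M}. N k \<subset> L \<and> L \<subset> N (Suc k)))"
    by (rule bounded_rank_saturated_chain[OF assms(2)])
      (auto simp: submodule_zero[OF assms(1)] submodule_carrier[OF assms(1)])
  then show ?thesis by unfold_locales auto
qed

text \<open>The records for localizations and cochains are built from equivalence classes. Their
  axioms are checked on values \<open>\<phi> x\<close> in a type class group, where they hold
  automatically.\<close>

lemma abelian_group_transport:
  fixes \<phi> :: "'b \<Rightarrow> 'v::ab_group_add"
  assumes inj: "inj_on \<phi> (carrier M)"
    and cl: "\<And>x y. x \<in> carrier M \<Longrightarrow> y \<in> carrier M \<Longrightarrow> x \<oplus>\<^bsub>M\<^esub> y \<in> carrier M"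
    and z: "\<zero>\<^bsub>M\<^esub> \<in> carrier M" "\<phi> \<zero>\<^bsub>M\<^esub> = 0"
    and hom: "\<And>x y. x \<in> carrier M \<Longrightarrow> y \<in> carrier M \<Longrightarrow> \<phi> (x \<oplus>\<^bsub>M\<^esub> y) = \<phi> x + \<phi> y"
    and neg: "\<And>x. x \<in> carrier M \<Longrightarrow> - \<phi> x \<in> \<phi> ` carrier M"
  shows "abelian_group M"
proof -
  note eq = inj_onD[OF inj]
  show "abelian_group M"
  proof (rule abelian_groupI)
    fix x assume x: "x \<in> carrier M"
    then obtain y where y: "y \<in> carrier M" "\<phi> y = - \<phi> x" using neg by force
    show "\<exists>y\<in>carrier M. y \<oplus>\<^bsub>M\<^esub> x = \<zero>\<^bsub>M\<^esub>"
      by (rule bexI[of _ y], rule eq) (use x y z cl hom in auto)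
  qed (use cl z hom in \<open>auto intro!: eq simp: algebra_simps\<close>)
qed

lemma left_module_transport:
  fixes \<phi> :: "'b \<Rightarrow> 'v::ab_group_add"
  assumes "ring R" and inj: "inj_on \<phi> (carrier M)"
    and cl: "\<And>x y. x \<in> carrier M \<Longrightarrow> y \<in> carrier M \<Longrightarrow> x \<oplus>\<^bsub>M\<^esub> y \<in> carrier M"
    and z: "\<zero>\<^bsub>M\<^esub> \<in> carrier M" "\<phi> \<zero>\<^bsub>M\<^esub> = 0"
    and hom: "\<And>x y. x \<in> carrier M \<Longrightarrow> y \<in> carrier M \<Longrightarrow> \<phi> (x \<oplus>\<^bsub>M\<^esub> y) = \<phi> x + \<phi> y"
    and neg: "\<And>x. x \<in> carrier M \<Longrightarrow> - \<phi> x \<in> \<phi> ` carrier M"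
    and scl: "\<And>a x. a \<in> carrier R \<Longrightarrow> x \<in> carrier M \<Longrightarrow> a \<odot>\<^bsub>M\<^esub> x \<in> carrier M"
    and sm: "\<And>a x. a \<in> carrier R \<Longrightarrow> x \<in> carrier M \<Longrightarrow> \<phi> (a \<odot>\<^bsub>M\<^esub> x) = T a (\<phi> x)"
    and Tadd: "\<And>a x y. a \<in> carrier R \<Longrightarrow> x \<in> carrier M \<Longrightarrow> y \<in> carrier M \<Longrightarrow>
        T a (\<phi> x + \<phi> y) = T a (\<phi> x) + T a (\<phi> y)"
    and Tsum: "\<And>a b x. a \<in> carrier R \<Longrightarrow> b \<in> carrier R \<Longrightarrow> x \<in> carrier M \<Longrightarrow>
        T (a \<oplus>\<^bsub>R\<^esub> b) (\<phi> x) = T a (\<phi> x) + T b (\<phi> x)"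
    and Tmult: "\<And>a b x. a \<in> carrier R \<Longrightarrow> b \<in> carrier R \<Longrightarrow> x \<in> carrier M \<Longrightarrow>
        T (a \<otimes>\<^bsub>R\<^esub> b) (\<phi> x) = T a (T b (\<phi> x))"
    and Tone: "\<And>x. x \<in> carrier M \<Longrightarrow> T \<one>\<^bsub>R\<^esub> (\<phi> x) = \<phi> x"
  shows "left_module R M"
proof -
  interpret R: ring R by fact
  interpret M: abelian_group M
    by (rule abelian_group_transport[OF inj cl z hom neg])
  note eq = inj_onD[OF inj]
  show ?thesis
    by unfold_locales (auto intro!: eq simp: cl hom scl sm Tadd Tsum Tmult Tone)
qed

lemma abelian_subgroup_submodule:
  assumes "left_module R M" "submodule N R M" shows "abelian_subgroup N M"
proof -
  interpret left_module R M by fact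
  show ?thesis using assms(2) unfolding submodule_def
    by (intro abelian_subgroupI3 additive_subgroup.intro M.abelian_group_axioms) auto
qed

context
  fixes R M N
  assumes M: "left_module R M" and N: "submodule N R M"
begin

interpretation left_module R M by (rule M)
interpretation N: abelian_subgroup N M by (rule abelian_subgroup_submodule[OF M N])

lemma quot_module_carrier: "carrier (quot_module M N) = (\<lambda>x. N +>\<^bsub>M\<^esub> x) ` carrier M"
  by (auto simp: quot_module_def A_RCOSETS_def' a_r_coset_def)

lemma quot_module_add:
  "x \<in> carrier M \<Longrightarrow> y \<in> carrier M \<Longrightarrow>
    (N +>\<^bsub>M\<^esub> x) \<oplus>\<^bsub>quot_module M N\<^esub> (N +>\<^bsub>M\<^esub> y) = N +>\<^bsub>M\<^esub> (x \<oplus>\<^bsub>M\<^esub> y)"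
  by (simp add: quot_module_def N.a_rcos_sum)

lemma quot_module_zero: "\<zero>\<^bsub>quot_module M N\<^esub> = N +>\<^bsub>M\<^esub> \<zero>\<^bsub>M\<^esub>"
  by (simp add: quot_module_def N.a_subset)

text \<open>The union in the definition of the scalar multiplication is constant, because
  \<open>N\<close> is a submodule.\<close>

lemma quot_module_smult:
  assumes "a \<in> carrier R" "x \<in> carrier M"
  shows "a \<odot>\<^bsub>quot_module M N\<^esub> (N +>\<^bsub>M\<^esub> x) = N +>\<^bsub>M\<^esub> (a \<odot>\<^bsub>M\<^esub> x)"
proof -
  have eq: "N +>\<^bsub>M\<^esub> (a \<odot>\<^bsub>M\<^esub> y) = N +>\<^bsub>M\<^esub> (a \<odot>\<^bsub>M\<^esub> x)" if y: "y \<in> N +>\<^bsub>M\<^esub> x" for y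
  proof -
    obtain n where n: "n \<in> N" "y = n \<oplus>\<^bsub>M\<^esub> x" using y by (auto simp: a_r_coset_def')
    then have nc: "n \<in> carrier M" using N.a_subset by auto
    have "a \<odot>\<^bsub>M\<^esub> y = a \<odot>\<^bsub>M\<^esub> n \<oplus>\<^bsub>M\<^esub> a \<odot>\<^bsub>M\<^esub> x" using n nc assms by (simp add: smult_r_distr)
    moreover have "a \<odot>\<^bsub>M\<^esub> n \<in> N" using submodule.smult_closed[OF N] n assms by auto
    ultimately have "a \<odot>\<^bsub>M\<^esub> y \<in> N +>\<^bsub>M\<^esub> (a \<odot>\<^bsub>M\<^esub> x)" by (auto simp: a_r_coset_def')
    then show ?thesis by (rule N.a_repr_independence'[OF _ smult_closed[OF assms], symmetric])
  qed
  have "N +>\<^bsub>M\<^esub> x \<noteq> {}" using N.a_rcos_self[OF assms(2)] by blast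
  then have "(\<Union>y\<in>N +>\<^bsub>M\<^esub> x. N +>\<^bsub>M\<^esub> (a \<odot>\<^bsub>M\<^esub> y)) = N +>\<^bsub>M\<^esub> (a \<odot>\<^bsub>M\<^esub> x)"
    by (rule SUP_eq_const) (rule eq)
  then show ?thesis by (simp add: quot_module_def)
qed

lemma left_module_quot: "left_module R (quot_module M N)"
proof -
  note [simp] = quot_module_carrier quot_module_add quot_module_zero quot_module_smult smult_closed
  have "\<exists>y\<in>carrier M. N +>\<^bsub>M\<^esub> (y \<oplus>\<^bsub>M\<^esub> x) = N +>\<^bsub>M\<^esub> \<zero>\<^bsub>M\<^esub>" if "x \<in> carrier M" for x
    using that by (intro bexI[of _ "\<ominus>\<^bsub>M\<^esub> x"]) (auto simp: M.l_neg)
  then have "abelian_group (quot_module M N)"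
    by (intro abelian_groupI) (auto simp: M.a_ac)
  then interpret Q: abelian_group "quot_module M N" .
  show ?thesis
    by unfold_locales (auto simp: smult_l_distr smult_r_distr smult_assoc1 smult_one)
qed

text \<open>Submodules of the quotient correspond to submodules above \<open>N\<close>; the third
  claim gives injectivity.\<close>

lemma submodule_quot_preimage:
  assumes L: "submodule L R (quot_module M N)"
  defines "P \<equiv> {x \<in> carrier M. N +>\<^bsub>M\<^esub> x \<in> L}"
  shows "submodule P R M" "N \<subseteq> P" "(\<lambda>x. N +>\<^bsub>M\<^esub> x) ` P = L"
proof -
  interpret Q: left_module R "quot_module M N" by (rule left_module_quot)
  interpret L: submodule L R "quot_module M N" by (rule L)
  have Lz: "N +>\<^bsub>M\<^esub> \<zero>\<^bsub>M\<^esub> \<in> L" using L.one_closed by (simp add: quot_module_zero)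
  have La: "\<And>x y. x \<in> carrier M \<Longrightarrow> y \<in> carrier M \<Longrightarrow> N +>\<^bsub>M\<^esub> x \<in> L \<Longrightarrow> N +>\<^bsub>M\<^esub> y \<in> L \<Longrightarrow> N +>\<^bsub>M\<^esub> (x \<oplus>\<^bsub>M\<^esub> y) \<in> L"
    using L.m_closed by (simp add: quot_module_add[symmetric])
  have Ln: "N +>\<^bsub>M\<^esub> (\<ominus>\<^bsub>M\<^esub> x) \<in> L" if x: "x \<in> carrier M" "N +>\<^bsub>M\<^esub> x \<in> L" for x
  proof -
    have "(N +>\<^bsub>M\<^esub> (\<ominus>\<^bsub>M\<^esub> x)) \<oplus>\<^bsub>quot_module M N\<^esub> (N +>\<^bsub>M\<^esub> x) = \<zero>\<^bsub>quot_module M N\<^esub>"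
      using x by (simp add: quot_module_add M.l_neg quot_module_zero)
    then have "\<ominus>\<^bsub>quot_module M N\<^esub> (N +>\<^bsub>M\<^esub> x) = N +>\<^bsub>M\<^esub> (\<ominus>\<^bsub>M\<^esub> x)"
      by (intro Q.M.minus_equality) (use x in \<open>auto simp: quot_module_carrier\<close>)
    then show ?thesis using L.m_inv_closed[OF x(2)] by (simp add: a_inv_def)
  qed
  show "submodule P R M"
  proof (intro submodule.intro subgroup.intro submodule_axioms.intro)
    fix a x assume ax: "a \<in> carrier R" "x \<in> P"
    have "a \<odot>\<^bsub>quot_module M N\<^esub> (N +>\<^bsub>M\<^esub> x) \<in> L"
      using ax by (intro L.smult_closed) (auto simp: P_def)
    then show "a \<odot>\<^bsub>M\<^esub> x \<in> P" using ax by (simp add: P_def smult_closed quot_module_smult)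
  next
    fix x assume "x \<in> P"
    then show "inv\<^bsub>add_monoid M\<^esub> x \<in> P" using Ln[of x] by (simp add: P_def a_inv_def[symmetric])
  qed (auto simp: P_def La Lz)
  show "N \<subseteq> P"
  proof
    fix x assume x: "x \<in> N"
    then have xc: "x \<in> carrier M" using N.a_subset by auto
    then have "N +>\<^bsub>M\<^esub> x = N +>\<^bsub>M\<^esub> \<zero>\<^bsub>M\<^esub>"
      using x N.a_repr_independence'[of x "\<zero>\<^bsub>M\<^esub>"] N.a_subset by simp
    then show "x \<in> P" using xc Lz by (simp add: P_def)
  qed
  have "L \<subseteq> carrier (quot_module M N)" using L.subset by simp
  then show "(\<lambda>x. N +>\<^bsub>M\<^esub> x) ` P = L" by (auto simp: P_def quot_module_carrier)
qed

lemma finite_length_quot_module: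
  assumes "bounded_rank {L. submodule L R M \<and> N \<subseteq> L}"
  shows "finite_length_module R (quot_module M N)"
proof (rule finite_length_moduleI[OF left_module_quot])
  let ?\<Phi> = "\<lambda>L. {x \<in> carrier M. N +>\<^bsub>M\<^esub> x \<in> L}"
  show "bounded_rank {L. submodule L R (quot_module M N)}"
  proof (rule bounded_rank_pullback[OF assms, where \<Phi> = ?\<Phi>])
    fix U assume "U \<in> {L. submodule L R (quot_module M N)}"
    then show "?\<Phi> U \<in> {L. submodule L R M \<and> N \<subseteq> L}"
      using submodule_quot_preimage(1,2)[of U] by simp
  next
    fix U W
    assume *: "U \<in> {L. submodule L R (quot_module M N)}" "W \<in> {L. submodule L R (quot_module M N)}" "U \<subset> W"
    have "?\<Phi> U \<noteq> ?\<Phi> W"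
      using submodule_quot_preimage(3)[of U] submodule_quot_preimage(3)[of W] *
      by (metis mem_Collect_eq order.strict_implies_not_eq)
    moreover have "?\<Phi> U \<subseteq> ?\<Phi> W" using *(3) by blast
    ultimately show "?\<Phi> U \<subset> ?\<Phi> W" by (rule psubsetI[rotated])
  qed
qed

end


section \<open>The ring of differential operators\<close>

text \<open>A commutative algebra that is a domain, with a fixed embedding into a field.
  Identities between operators are verified after applying \<open>\<iota>\<close>, and the
  localizations of \<open>R\<close> become subsets of the field.\<close>

locale embedded_algebra =
  fixes K :: "('k, 'l) ring_scheme" and R :: "('k, 'a, 'm) module_scheme" and \<iota> :: "'a \<Rightarrow> 'f::field"
  assumes algebra: "algebra K R"
    and inj: "inj_on \<iota> (carrier R)"
    and \<iota>_add: "\<lbrakk>x \<in> carrier R; y \<in> carrier R\<rbrakk> \<Longrightarrow> \<iota> (x \<oplus>\<^bsub>R\<^esub> y) = \<iota> x + \<iota> y"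
    and \<iota>_mult: "\<lbrakk>x \<in> carrier R; y \<in> carrier R\<rbrakk> \<Longrightarrow> \<iota> (x \<otimes>\<^bsub>R\<^esub> y) = \<iota> x * \<iota> y"
    and \<iota>_one: "\<iota> \<one>\<^bsub>R\<^esub> = 1"
begin

sublocale R: cring R using algebra by (rule algebra.axioms(2))
sublocale A: algebra K R by (rule algebra)

lemma \<iota>_zero: "\<iota> \<zero>\<^bsub>R\<^esub> = 0"
proof -
  have "\<iota> \<zero>\<^bsub>R\<^esub> = \<iota> \<zero>\<^bsub>R\<^esub> + \<iota> \<zero>\<^bsub>R\<^esub>" using \<iota>_add[of "\<zero>\<^bsub>R\<^esub>" "\<zero>\<^bsub>R\<^esub>"] by simp
  then show ?thesis by (metis add_cancel_right_right)
qed

lemma \<iota>_neg: "x \<in> carrier R \<Longrightarrow> \<iota> (\<ominus>\<^bsub>R\<^esub> x) = - \<iota> x"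
  using \<iota>_add[of "\<ominus>\<^bsub>R\<^esub> x" x] by (simp add: R.l_neg \<iota>_zero eq_neg_iff_add_eq_0)

lemma \<iota>_minus: "\<lbrakk>x \<in> carrier R; y \<in> carrier R\<rbrakk> \<Longrightarrow> \<iota> (x \<ominus>\<^bsub>R\<^esub> y) = \<iota> x - \<iota> y"
  by (simp add: a_minus_def \<iota>_add \<iota>_neg)

lemma \<iota>_pow: "x \<in> carrier R \<Longrightarrow> \<iota> (x [^]\<^bsub>R\<^esub> (n::nat)) = \<iota> x ^ n"
  by (induction n) (simp_all add: \<iota>_one \<iota>_mult)

lemma \<iota>_eq_iff: "\<lbrakk>x \<in> carrier R; y \<in> carrier R\<rbrakk> \<Longrightarrow> \<iota> x = \<iota> y \<longleftrightarrow> x = y"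
  using inj by (auto dest: inj_onD)

lemmas \<iota>_simps = \<iota>_add \<iota>_mult \<iota>_one \<iota>_zero \<iota>_neg \<iota>_minus \<iota>_pow

abbreviation D :: "nat \<Rightarrow> ('a \<Rightarrow> 'a) set" where "D \<equiv> diff_ops K R"

lemma linear_endosD:
  assumes "P \<in> linear_endos K R"
  shows "x \<in> carrier R \<Longrightarrow> P x \<in> carrier R"
    and "\<lbrakk>x \<in> carrier R; y \<in> carrier R\<rbrakk> \<Longrightarrow> P (x \<oplus>\<^bsub>R\<^esub> y) = P x \<oplus>\<^bsub>R\<^esub> P y"
    and "\<lbrakk>c \<in> carrier K; x \<in> carrier R\<rbrakk> \<Longrightarrow> P (c \<odot>\<^bsub>R\<^esub> x) = c \<odot>\<^bsub>R\<^esub> P x"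
    and "P \<in> extensional (carrier R)"
  using assms by (auto simp: linear_endos_def PiE_def)

lemma linear_endosI:
  assumes "P \<in> extensional (carrier R)" and "\<And>x. x \<in> carrier R \<Longrightarrow> P x \<in> carrier R"
    and "\<And>x y. \<lbrakk>x \<in> carrier R; y \<in> carrier R\<rbrakk> \<Longrightarrow> P (x \<oplus>\<^bsub>R\<^esub> y) = P x \<oplus>\<^bsub>R\<^esub> P y"
    and "\<And>c x. \<lbrakk>c \<in> carrier K; x \<in> carrier R\<rbrakk> \<Longrightarrow> P (c \<odot>\<^bsub>R\<^esub> x) = c \<odot>\<^bsub>R\<^esub> P x"
  shows "P \<in> linear_endos K R"
  using assms by (auto simp: linear_endos_def PiE_def)

lemma operator_eqI:
  assumes "P \<in> extensional (carrier R)" "Q \<in> extensional (carrier R)"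
    and "\<And>x. x \<in> carrier R \<Longrightarrow> P x \<in> carrier R" "\<And>x. x \<in> carrier R \<Longrightarrow> Q x \<in> carrier R"
    and "\<And>x. x \<in> carrier R \<Longrightarrow> \<iota> (P x) = \<iota> (Q x)"
  shows "P = Q"
  by (rule extensionalityI[OF assms(1,2)]) (use assms(3-5) \<iota>_eq_iff in blast)

definition op_add :: "('a \<Rightarrow> 'a) \<Rightarrow> ('a \<Rightarrow> 'a) \<Rightarrow> 'a \<Rightarrow> 'a" where
  "op_add P Q = (\<lambda>x\<in>carrier R. P x \<oplus>\<^bsub>R\<^esub> Q x)"

definition op_neg :: "('a \<Rightarrow> 'a) \<Rightarrow> 'a \<Rightarrow> 'a" where
  "op_neg P = (\<lambda>x\<in>carrier R. \<ominus>\<^bsub>R\<^esub> P x)"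

definition op_zero :: "'a \<Rightarrow> 'a" where
  "op_zero = (\<lambda>x\<in>carrier R. \<zero>\<^bsub>R\<^esub>)"

lemma mult_op_linear: "r \<in> carrier R \<Longrightarrow> mult_op R r \<in> linear_endos K R"
  by (rule linear_endosI)
    (auto simp: mult_op_def R.r_distr A.smult_closed A.smult_assoc2 R.m_comm[of r])

lemma mult_op_zero: "mult_op R \<zero>\<^bsub>R\<^esub> = op_zero"
  by (auto simp: mult_op_def op_zero_def)

lemma diff_ops_linear: "P \<in> D i \<Longrightarrow> P \<in> linear_endos K R"
  by (cases i) (auto simp: mult_op_linear)

lemma commutator_closed:
  assumes "P \<in> linear_endos K R" "r \<in> carrier R"
  shows "commutator_op R P r \<in> extensional (carrier R)"
    "x \<in> carrier R \<Longrightarrow> commutator_op R P r x \<in> carrier R"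
    "x \<in> carrier R \<Longrightarrow> \<iota> (commutator_op R P r x) = \<iota> (P (r \<otimes>\<^bsub>R\<^esub> x)) - \<iota> r * \<iota> (P x)"
  using assms linear_endosD(1)[OF assms(1)] by (auto simp: commutator_op_def \<iota>_simps)

lemma op_add_linear:
  assumes "P \<in> linear_endos K R" "Q \<in> linear_endos K R"
  shows "op_add P Q \<in> linear_endos K R"
  by (rule linear_endosI)
    (auto simp: op_add_def linear_endosD[OF assms(1)] linear_endosD[OF assms(2)] R.a_ac
      A.smult_closed A.smult_r_distr)

lemma op_neg_linear:
  assumes "P \<in> linear_endos K R"
  shows "op_neg P \<in> linear_endos K R"
  by (rule linear_endosI)
    (auto simp: op_neg_def linear_endosD[OF assms] R.minus_add A.smult_closed A.smult_r_minus)

lemma compose_linear: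
  assumes "P \<in> linear_endos K R" "Q \<in> linear_endos K R"
  shows "compose (carrier R) P Q \<in> linear_endos K R"
  by (rule linear_endosI)
    (auto simp: compose_def linear_endosD[OF assms(1)] linear_endosD[OF assms(2)] A.smult_closed)

lemma commutator_op_add:
  assumes "P \<in> linear_endos K R" "Q \<in> linear_endos K R" "r \<in> carrier R"
  shows "commutator_op R (op_add P Q) r = op_add (commutator_op R P r) (commutator_op R Q r)"
  by (rule operator_eqI)
    (auto simp: commutator_op_def op_add_def \<iota>_simps linear_endosD[OF assms(1)]
      linear_endosD[OF assms(2)] assms(3) algebra_simps)

lemma commutator_op_neg:
  assumes "P \<in> linear_endos K R" "r \<in> carrier R"
  shows "commutator_op R (op_neg P) r = op_neg (commutator_op R P r)"
  by (rule operator_eqI)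
    (auto simp: commutator_op_def op_neg_def \<iota>_simps linear_endosD[OF assms(1)]
      assms(2) algebra_simps)

text \<open>The Leibniz rule \<open>[PQ, r] = P[Q, r] + [P, r]Q\<close>, by which orders add up
  under composition.\<close>

lemma commutator_compose:
  assumes "P \<in> linear_endos K R" "Q \<in> linear_endos K R" "r \<in> carrier R"
  shows "commutator_op R (compose (carrier R) P Q) r =
    op_add (compose (carrier R) P (commutator_op R Q r)) (compose (carrier R) (commutator_op R P r) Q)"
proof (rule operator_eqI)
  fix x assume x: "x \<in> carrier R"
  have "P (Q (r \<otimes>\<^bsub>R\<^esub> x) \<ominus>\<^bsub>R\<^esub> r \<otimes>\<^bsub>R\<^esub> Q x) \<oplus>\<^bsub>R\<^esub> P (r \<otimes>\<^bsub>R\<^esub> Q x) =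
    P ((Q (r \<otimes>\<^bsub>R\<^esub> x) \<ominus>\<^bsub>R\<^esub> r \<otimes>\<^bsub>R\<^esub> Q x) \<oplus>\<^bsub>R\<^esub> r \<otimes>\<^bsub>R\<^esub> Q x)"
    using x assms(3) by (simp add: linear_endosD[OF assms(1)] linear_endosD[OF assms(2)])
  also have "(Q (r \<otimes>\<^bsub>R\<^esub> x) \<ominus>\<^bsub>R\<^esub> r \<otimes>\<^bsub>R\<^esub> Q x) \<oplus>\<^bsub>R\<^esub> r \<otimes>\<^bsub>R\<^esub> Q x = Q (r \<otimes>\<^bsub>R\<^esub> x)"
    using x assms(3)
    by (simp add: linear_endosD[OF assms(2)] a_minus_def R.a_assoc R.l_neg)
  finally have "\<iota> (P (Q (r \<otimes>\<^bsub>R\<^esub> x) \<ominus>\<^bsub>R\<^esub> r \<otimes>\<^bsub>R\<^esub> Q x)) + \<iota> (P (r \<otimes>\<^bsub>R\<^esub> Q x)) = \<iota> (P (Q (r \<otimes>\<^bsub>R\<^esub> x)))"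
    using x assms(3)
    by (metis R.m_closed R.minus_closed \<iota>_add linear_endosD(1)[OF assms(1)] linear_endosD(1)[OF assms(2)])
  then show "\<iota> (commutator_op R (compose (carrier R) P Q) r x) =
    \<iota> (op_add (compose (carrier R) P (commutator_op R Q r)) (compose (carrier R) (commutator_op R P r) Q) x)"
    using x assms(3)
    by (simp add: commutator_op_def op_add_def compose_def \<iota>_simps linear_endosD[OF assms(1)]
      linear_endosD[OF assms(2)] algebra_simps)
qed (auto simp: commutator_op_def op_add_def compose_def linear_endosD[OF assms(1)]
      linear_endosD[OF assms(2)] assms(3))

lemma op_zero_diff_op: "op_zero \<in> D i"
proof (induction i)
  case 0
  show ?case by (auto simp: mult_op_zero[symmetric])
next
  case (Suc i)
  have "commutator_op R op_zero r = op_zero" if "r \<in> carrier R" for r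
    by (rule operator_eqI) (use that in \<open>auto simp: op_zero_def commutator_op_def \<iota>_simps\<close>)
  moreover have "op_zero \<in> linear_endos K R"
    using diff_ops_linear[OF Suc] .
  ultimately show ?case using Suc by simp
qed

lemma commutator_mult_op:
  "\<lbrakk>a \<in> carrier R; r \<in> carrier R\<rbrakk> \<Longrightarrow> commutator_op R (mult_op R a) r = op_zero"
  by (rule operator_eqI) (auto simp: op_zero_def mult_op_def commutator_op_def \<iota>_simps)

lemma diff_ops_Suc_mono: "D i \<subseteq> D (Suc i)"
proof (induction i)
  case 0
  show ?case using op_zero_diff_op[of 0] by (auto simp: mult_op_linear commutator_mult_op)
next
  case (Suc i)
  then show ?case by auto
qed

lemma diff_ops_mono: "i \<le> j \<Longrightarrow> D i \<subseteq> D j"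
  by (rule lift_Suc_mono_le[of D, OF diff_ops_Suc_mono])

lemma diff_ops_add: "\<lbrakk>P \<in> D i; Q \<in> D i\<rbrakk> \<Longrightarrow> op_add P Q \<in> D i"
proof (induction i arbitrary: P Q)
  case 0
  then obtain r s where "r \<in> carrier R" "s \<in> carrier R" "P = mult_op R r" "Q = mult_op R s" by auto
  moreover from this have "op_add P Q = mult_op R (r \<oplus>\<^bsub>R\<^esub> s)"
    by (intro operator_eqI) (auto simp: op_add_def mult_op_def \<iota>_simps algebra_simps)
  ultimately show ?case by simp
next
  case (Suc i)
  then show ?case by (auto simp: commutator_op_add op_add_linear)
qed

lemma diff_ops_neg: "P \<in> D i \<Longrightarrow> op_neg P \<in> D i"
proof (induction i arbitrary: P)
  case 0
  then obtain r where "r \<in> carrier R" "P = mult_op R r" by auto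
  moreover from this have "op_neg P = mult_op R (\<ominus>\<^bsub>R\<^esub> r)"
    by (intro operator_eqI) (auto simp: op_neg_def mult_op_def \<iota>_simps algebra_simps)
  ultimately show ?case by simp
next
  case (Suc i)
  then show ?case by (auto simp: commutator_op_neg op_neg_linear)
qed

lemma commutator_diff_op:
  assumes "P \<in> D i" "r \<in> carrier R"
  shows "commutator_op R P r = op_zero \<or> (\<exists>i'. i = Suc i' \<and> commutator_op R P r \<in> D i')"
  using assms by (cases i) (auto simp: commutator_mult_op)

lemma linear_zero:
  assumes "P \<in> linear_endos K R" shows "P \<zero>\<^bsub>R\<^esub> = \<zero>\<^bsub>R\<^esub>"
proof -
  have "P \<zero>\<^bsub>R\<^esub> \<oplus>\<^bsub>R\<^esub> P \<zero>\<^bsub>R\<^esub> = P \<zero>\<^bsub>R\<^esub>"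
    using linear_endosD(2)[OF assms, of "\<zero>\<^bsub>R\<^esub>" "\<zero>\<^bsub>R\<^esub>"] by simp
  then show ?thesis
    using linear_endosD(1)[OF assms, of "\<zero>\<^bsub>R\<^esub>"] by (metis R.add.r_cancel_one' R.zero_closed)
qed

lemma compose_op_zero:
  assumes "P \<in> linear_endos K R"
  shows "compose (carrier R) P op_zero = op_zero" "compose (carrier R) op_zero P = op_zero"
proof -
  have "P \<zero>\<^bsub>R\<^esub> = \<zero>\<^bsub>R\<^esub>" by (rule linear_zero[OF assms])
  then show "compose (carrier R) P op_zero = op_zero" "compose (carrier R) op_zero P = op_zero"
    using linear_endosD(1)[OF assms] by (auto simp: compose_def op_zero_def fun_eq_iff)
qed

lemma diff_ops_compose: "\<lbrakk>P \<in> D i; Q \<in> D j\<rbrakk> \<Longrightarrow> compose (carrier R) P Q \<in> D (i + j)"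
proof (induction "i + j" arbitrary: i j P Q)
  case 0
  then obtain r s where "r \<in> carrier R" "s \<in> carrier R" "P = mult_op R r" "Q = mult_op R s" by auto
  moreover from this have "compose (carrier R) P Q = mult_op R (r \<otimes>\<^bsub>R\<^esub> s)"
    by (intro operator_eqI) (auto simp: compose_def mult_op_def \<iota>_simps)
  ultimately show ?case using 0 by auto
next
  case (Suc n)
  have lin: "P \<in> linear_endos K R" "Q \<in> linear_endos K R"
    using Suc.prems by (simp_all add: diff_ops_linear)
  have "commutator_op R (compose (carrier R) P Q) r \<in> D n" if r: "r \<in> carrier R" for r
    unfolding commutator_compose[OF lin r]
  proof (rule diff_ops_add)
    from commutator_diff_op[OF Suc.prems(2) r]
    show "compose (carrier R) P (commutator_op R Q r) \<in> D n"
    proof (elim disjE exE conjE)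
      fix j' assume *: "j = Suc j'" "commutator_op R Q r \<in> D j'"
      have "n = i + j'" using Suc.hyps(2) * by simp
      from Suc.hyps(1)[OF this Suc.prems(1) *(2)] this show ?thesis by simp
    qed (simp add: compose_op_zero[OF lin(1)] op_zero_diff_op)
    from commutator_diff_op[OF Suc.prems(1) r]
    show "compose (carrier R) (commutator_op R P r) Q \<in> D n"
    proof (elim disjE exE conjE)
      fix i' assume *: "i = Suc i'" "commutator_op R P r \<in> D i'"
      have "n = i' + j" using Suc.hyps(2) * by simp
      from Suc.hyps(1)[OF this *(2) Suc.prems(2)] this show ?thesis by simp
    qed (simp add: compose_op_zero[OF lin(2)] op_zero_diff_op)
  qed
  then have "compose (carrier R) P Q \<in> D (Suc n)" using compose_linear[OF lin] by simp
  then show ?case using Suc.hyps(2) by simp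
qed

lemma diff_ring_carrier: "carrier (diff_ring K R) = (\<Union>i. D i)"
  by (simp add: diff_ring_def)

lemma diff_ring_common_order:
  assumes "P \<in> carrier (diff_ring K R)" "Q \<in> carrier (diff_ring K R)"
  obtains i where "P \<in> D i" "Q \<in> D i"
proof -
  obtain i j where "P \<in> D i" "Q \<in> D j" using assms by (auto simp: diff_ring_carrier)
  then show thesis using that[of "max i j"] diff_ops_mono[of i "max i j"] diff_ops_mono[of j "max i j"]
    by auto
qed

lemma diff_ring_linear: "P \<in> carrier (diff_ring K R) \<Longrightarrow> P \<in> linear_endos K R"
  using diff_ops_linear by (auto simp: diff_ring_carrier)

lemmas diff_ringD = linear_endosD[OF diff_ring_linear]

lemma mult_op_diff_ring: "r \<in> carrier R \<Longrightarrow> mult_op R r \<in> carrier (diff_ring K R)"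
  unfolding diff_ring_carrier by (rule UN_I[of 0]) auto

lemma diff_ring_simps:
  "add (diff_ring K R) = op_add" "monoid.mult (diff_ring K R) = compose (carrier R)"
  "\<zero>\<^bsub>diff_ring K R\<^esub> = op_zero" "\<one>\<^bsub>diff_ring K R\<^esub> = mult_op R \<one>\<^bsub>R\<^esub>"
  by (auto simp: diff_ring_def op_add_def op_zero_def mult_op_def fun_eq_iff)

lemma diff_ring_closed:
  assumes "P \<in> carrier (diff_ring K R)"
  shows "Q \<in> carrier (diff_ring K R) \<Longrightarrow> op_add P Q \<in> carrier (diff_ring K R)"
    and "Q \<in> carrier (diff_ring K R) \<Longrightarrow> compose (carrier R) P Q \<in> carrier (diff_ring K R)"
    and "op_neg P \<in> carrier (diff_ring K R)"
    and "r \<in> carrier R \<Longrightarrow> commutator_op R P r \<in> carrier (diff_ring K R)"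
proof -
  show "op_add P Q \<in> carrier (diff_ring K R)" if Q: "Q \<in> carrier (diff_ring K R)"
  proof -
    obtain i where "P \<in> D i" "Q \<in> D i" using diff_ring_common_order[OF assms Q] .
    from diff_ops_add[OF this] show ?thesis unfolding diff_ring_carrier by blast
  qed
  show "compose (carrier R) P Q \<in> carrier (diff_ring K R)" if Q: "Q \<in> carrier (diff_ring K R)"
  proof -
    obtain i where "P \<in> D i" "Q \<in> D i" using diff_ring_common_order[OF assms Q] .
    from diff_ops_compose[OF this] show ?thesis unfolding diff_ring_carrier by blast
  qed
  show "op_neg P \<in> carrier (diff_ring K R)"
    using assms diff_ops_neg by (auto simp: diff_ring_carrier)
  obtain i where "P \<in> D i" using assms unfolding diff_ring_carrier by (rule UN_E)
  then have "P \<in> D (Suc i)" by (rule subsetD[OF diff_ops_Suc_mono])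
  then show "commutator_op R P r \<in> carrier (diff_ring K R)" if "r \<in> carrier R"
    unfolding diff_ring_carrier by (intro UN_I[of i]) (use that in simp_all)
qed

lemma ring_diff_ring: "ring (diff_ring K R)"
proof (rule ringI)
  have op_zero: "op_zero \<in> carrier (diff_ring K R)"
    using op_zero_diff_op by (auto simp: diff_ring_carrier)
  show "abelian_group (diff_ring K R)"
  proof (rule abelian_groupI, goal_cases)
    case (6 x)
    have "op_add (op_neg x) x = op_zero"
      by (rule operator_eqI) (use 6 in \<open>auto simp: op_add_def op_neg_def op_zero_def \<iota>_simps diff_ringD\<close>)
    then show ?case using diff_ring_closed(3)[OF 6] by (auto simp: diff_ring_simps)
  next
    case (3 x y z)
    then show ?case unfolding diff_ring_simps
      by (intro operator_eqI) (auto simp: op_add_def diff_ringD \<iota>_simps)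
  next
    case (4 x y)
    then show ?case unfolding diff_ring_simps
      by (intro operator_eqI) (auto simp: op_add_def diff_ringD \<iota>_simps)
  next
    case (5 x)
    then show ?case unfolding diff_ring_simps
      by (intro operator_eqI) (auto simp: op_add_def op_zero_def diff_ringD \<iota>_simps)
  qed (simp_all add: diff_ring_simps diff_ring_closed op_zero)
  show "monoid (diff_ring K R)"
  proof (rule monoidI, goal_cases)
    case (3 x y z)
    then show ?case unfolding diff_ring_simps
      by (intro operator_eqI) (auto simp: compose_def diff_ringD)
  next
    case (4 x)
    then show ?case unfolding diff_ring_simps
      by (intro operator_eqI) (auto simp: compose_def mult_op_def diff_ringD)
  next
    case (5 x)
    then show ?case unfolding diff_ring_simps
      by (intro operator_eqI) (auto simp: compose_def mult_op_def diff_ringD)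
  qed (simp_all add: diff_ring_simps diff_ring_closed mult_op_diff_ring)
  fix x y z
  assume "x \<in> carrier (diff_ring K R)" "y \<in> carrier (diff_ring K R)" "z \<in> carrier (diff_ring K R)"
  then show "(x \<oplus>\<^bsub>diff_ring K R\<^esub> y) \<otimes>\<^bsub>diff_ring K R\<^esub> z =
      x \<otimes>\<^bsub>diff_ring K R\<^esub> z \<oplus>\<^bsub>diff_ring K R\<^esub> y \<otimes>\<^bsub>diff_ring K R\<^esub> z"
    "z \<otimes>\<^bsub>diff_ring K R\<^esub> (x \<oplus>\<^bsub>diff_ring K R\<^esub> y) =
      z \<otimes>\<^bsub>diff_ring K R\<^esub> x \<oplus>\<^bsub>diff_ring K R\<^esub> z \<otimes>\<^bsub>diff_ring K R\<^esub> y"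
    unfolding diff_ring_simps
    by (intro operator_eqI; auto simp: compose_def op_add_def diff_ringD)+
qed

end


section \<open>Extension of differential operators to fractions\<close>

lemma add_self_cancel_zero: "(a::'b::ab_group_add) + a = a \<Longrightarrow> a = 0"
  by (metis add_cancel_right_right)

context embedded_algebra begin

definition Frac :: "'f set" where
  "Frac = {\<iota> r / \<iota> s | r s. r \<in> carrier R \<and> s \<in> carrier R \<and> \<iota> s \<noteq> 0}"

lemma FracE:
  assumes "x \<in> Frac"
  obtains r s where "r \<in> carrier R" "s \<in> carrier R" "\<iota> s \<noteq> 0" "x = \<iota> r / \<iota> s"
  using assms by (auto simp: Frac_def)

lemma FracI: "\<lbrakk>r \<in> carrier R; s \<in> carrier R; \<iota> s \<noteq> 0\<rbrakk> \<Longrightarrow> \<iota> r / \<iota> s \<in> Frac"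
  by (auto simp: Frac_def)

lemma \<iota>_Frac: "r \<in> carrier R \<Longrightarrow> \<iota> r \<in> Frac"
  using FracI[of r "\<one>\<^bsub>R\<^esub>"] by (simp add: \<iota>_one)

lemma Frac_common:
  assumes "x \<in> Frac" "y \<in> Frac"
  obtains r r' s where "r \<in> carrier R" "r' \<in> carrier R" "s \<in> carrier R" "\<iota> s \<noteq> 0"
    "x = \<iota> r / \<iota> s" "y = \<iota> r' / \<iota> s"
proof -
  obtain r s where x: "r \<in> carrier R" "s \<in> carrier R" "\<iota> s \<noteq> 0" "x = \<iota> r / \<iota> s"
    using assms(1) by (rule FracE)
  obtain r' s' where y: "r' \<in> carrier R" "s' \<in> carrier R" "\<iota> s' \<noteq> 0" "y = \<iota> r' / \<iota> s'"
    using assms(2) by (rule FracE)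
  show thesis
    by (rule that[of "r \<otimes>\<^bsub>R\<^esub> s'" "r' \<otimes>\<^bsub>R\<^esub> s" "s \<otimes>\<^bsub>R\<^esub> s'"]) (use x y in \<open>auto simp: \<iota>_simps\<close>)
qed

lemma Frac_add: "\<lbrakk>x \<in> Frac; y \<in> Frac\<rbrakk> \<Longrightarrow> x + y \<in> Frac"
  by (erule Frac_common, assumption) (use FracI in \<open>auto simp: add_divide_distrib[symmetric] \<iota>_add[symmetric]\<close>)

lemma Frac_mult: "\<lbrakk>x \<in> Frac; y \<in> Frac\<rbrakk> \<Longrightarrow> x * y \<in> Frac"
  by (erule FracE, erule FracE) (use FracI[OF R.m_closed R.m_closed] in \<open>auto simp: \<iota>_mult\<close>)

lemma Frac_inverse: "\<lbrakk>s \<in> carrier R; \<iota> s \<noteq> 0; x \<in> Frac\<rbrakk> \<Longrightarrow> x / \<iota> s \<in> Frac"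
  using Frac_mult[of x "1 / \<iota> s"] FracI[of "\<one>\<^bsub>R\<^esub>" s] by (simp add: \<iota>_one)

lemma Frac_neg: "x \<in> Frac \<Longrightarrow> - x \<in> Frac"
  using Frac_mult[of "\<iota> (\<ominus>\<^bsub>R\<^esub> \<one>\<^bsub>R\<^esub>)" x] \<iota>_Frac[of "\<ominus>\<^bsub>R\<^esub> \<one>\<^bsub>R\<^esub>"] by (simp add: \<iota>_simps)

lemma Frac_diff: "\<lbrakk>x \<in> Frac; y \<in> Frac\<rbrakk> \<Longrightarrow> x - y \<in> Frac"
  using Frac_add[of x "- y"] Frac_neg by simp

lemma Frac_scale: "\<lbrakk>s \<in> carrier R; x \<in> Frac\<rbrakk> \<Longrightarrow> \<iota> s * x \<in> Frac"
  by (simp add: Frac_mult \<iota>_Frac)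

text \<open>Differential operators of order at most \<open>p\<close> from the fractions to
  \<open>'f\<close>, without any linearity: iterated commutators with \<open>R\<close>
  vanish.\<close>

primrec ad_nilpotent :: "nat \<Rightarrow> ('f \<Rightarrow> 'f) \<Rightarrow> bool" where
  "ad_nilpotent 0 T \<longleftrightarrow> (\<forall>s\<in>carrier R. \<forall>x\<in>Frac. T (\<iota> s * x) = \<iota> s * T x)"
| "ad_nilpotent (Suc p) T \<longleftrightarrow> (\<forall>s\<in>carrier R. ad_nilpotent p (\<lambda>x. T (\<iota> s * x) - \<iota> s * T x))"

lemma ad_nilpotent_cong: "(\<And>x. x \<in> Frac \<Longrightarrow> S x = T x) \<Longrightarrow> ad_nilpotent p S = ad_nilpotent p T"
proof (induction p arbitrary: S T)
  case (Suc p)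
  have "ad_nilpotent p (\<lambda>x. S (\<iota> s * x) - \<iota> s * S x) = ad_nilpotent p (\<lambda>x. T (\<iota> s * x) - \<iota> s * T x)"
    if "s \<in> carrier R" for s
    by (rule Suc.IH) (simp add: Suc.prems Frac_scale that)
  then show ?case by simp
qed (simp add: Frac_scale)

lemma ad_nilpotent_zero: "(\<And>x. x \<in> Frac \<Longrightarrow> T x = 0) \<Longrightarrow> ad_nilpotent p T"
proof (induction p arbitrary: T)
  case (Suc p)
  have "ad_nilpotent p (\<lambda>x. T (\<iota> s * x) - \<iota> s * T x)" if "s \<in> carrier R" for s
    by (rule Suc.IH) (simp add: Suc.prems Frac_scale that)
  then show ?case by simp
qed (simp add: Frac_scale)

lemma ad_nilpotent_Suc: "ad_nilpotent p T \<Longrightarrow> ad_nilpotent (Suc p) T"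
proof (induction p arbitrary: T)
  case 0
  have "ad_nilpotent 0 (\<lambda>x. T (\<iota> s * x) - \<iota> s * T x)" if "s \<in> carrier R" for s
    by (rule ad_nilpotent_zero) (use 0 that in simp)
  then show ?case by simp
next
  case (Suc p)
  then show ?case by (metis ad_nilpotent.simps(2))
qed

lemma ad_nilpotent_mono: "\<lbrakk>ad_nilpotent p T; p \<le> q\<rbrakk> \<Longrightarrow> ad_nilpotent q T"
  by (induction q) (auto simp: le_Suc_eq intro: ad_nilpotent_Suc simp del: ad_nilpotent.simps)

lemma ad_nilpotent_lincomb: "\<lbrakk>ad_nilpotent p S; ad_nilpotent p T\<rbrakk> \<Longrightarrow> ad_nilpotent p (\<lambda>x. a * S x + b * T x)"
proof (induction p arbitrary: S T)
  case (Suc p)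
  have "ad_nilpotent p (\<lambda>x. a * (S (\<iota> s * x) - \<iota> s * S x) + b * (T (\<iota> s * x) - \<iota> s * T x))"
    if "s \<in> carrier R" for s
    using Suc that by simp
  then show ?case by (simp add: algebra_simps)
qed (simp add: algebra_simps)

lemma ad_nilpotent_precomp: "\<lbrakk>ad_nilpotent p T; a \<in> carrier R\<rbrakk> \<Longrightarrow> ad_nilpotent p (\<lambda>x. T (\<iota> a * x))"
proof (induction p arbitrary: T)
  case 0
  have "T (\<iota> a * (\<iota> s * x)) = \<iota> s * T (\<iota> a * x)" if "s \<in> carrier R" "x \<in> Frac" for s x
  proof -
    have "T (\<iota> a * (\<iota> s * x)) = \<iota> a * (\<iota> s * T x)" using 0 that by (simp add: Frac_scale)
    also have "\<dots> = \<iota> s * T (\<iota> a * x)" using 0 that by (simp add: mult.left_commute)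
    finally show ?thesis .
  qed
  then show ?case by simp
next
  case (Suc p)
  have "ad_nilpotent p (\<lambda>x. T (\<iota> s * (\<iota> a * x)) - \<iota> s * T (\<iota> a * x))" if "s \<in> carrier R" for s
    by (rule Suc.IH[of "\<lambda>x. T (\<iota> s * x) - \<iota> s * T x"]) (use Suc.prems that in simp_all)
  then show ?case by (simp add: mult.left_commute)
qed

lemma ad_nilpotent_comp:
  "\<lbrakk>ad_nilpotent p S; ad_nilpotent q T; \<And>x y. \<lbrakk>x \<in> Frac; y \<in> Frac\<rbrakk> \<Longrightarrow> S (x + y) = S x + S y;
    \<And>x. x \<in> Frac \<Longrightarrow> T x \<in> Frac\<rbrakk> \<Longrightarrow> ad_nilpotent (p + q) (\<lambda>x. S (T x))"
proof (induction "p + q" arbitrary: p q S T)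
  case 0
  then show ?case by simp
next
  case (Suc n)
  have "ad_nilpotent n (\<lambda>x. S (T (\<iota> s * x)) - \<iota> s * S (T x))" if s: "s \<in> carrier R" for s
  proof -
    let ?S = "\<lambda>x. S (\<iota> s * x) - \<iota> s * S x" and ?T = "\<lambda>x. T (\<iota> s * x) - \<iota> s * T x"
    have TF: "?T x \<in> Frac" if "x \<in> Frac" for x
      using that s by (intro Frac_diff Frac_scale Suc.prems(4))
    have SA: "?S (x + y) = ?S x + ?S y" if "x \<in> Frac" "y \<in> Frac" for x y
      using that s by (simp add: distrib_left Suc.prems(3) Frac_scale)
    have 1: "ad_nilpotent n (\<lambda>x. S (?T x))"
    proof (cases q)
      case 0
      have "S (0 + 0) = S 0 + S 0" using \<iota>_Frac[of "\<zero>\<^bsub>R\<^esub>"] by (intro Suc.prems(3)) (simp_all add: \<iota>_zero)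
      then have "S 0 = 0" using add_self_cancel_zero[of "S 0"] by (simp del: add_cancel_right_right)
      then show ?thesis using 0 Suc.prems(2) s by (intro ad_nilpotent_zero) simp
    next
      case (Suc q')
      have "ad_nilpotent (p + q') (\<lambda>x. S (?T x))"
        by (rule Suc.hyps(1)[of p q' S ?T]) (use Suc Suc.hyps(2) Suc.prems(1,2,3) s TF in simp_all)
      then show ?thesis using Suc Suc.hyps(2) by simp
    qed
    have 2: "ad_nilpotent n (\<lambda>x. ?S (T x))"
    proof (cases p)
      case 0
      then show ?thesis using 0 Suc.prems(1,4) s by (intro ad_nilpotent_zero) simp
    next
      case (Suc p')
      have "ad_nilpotent (p' + q) (\<lambda>x. ?S (T x))"
        by (rule Suc.hyps(1)[of p' q ?S T]) (use Suc Suc.hyps(2) Suc.prems(1,2,4) s SA in simp_all)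
      then show ?thesis using Suc Suc.hyps(2) by simp
    qed
    have "S (T (\<iota> s * x)) - \<iota> s * S (T x) = 1 * S (?T x) + 1 * ?S (T x)" if x: "x \<in> Frac" for x
      using Suc.prems(3)[of "?T x" "\<iota> s * T x"] Suc.prems(4) x s
      by (simp add: Frac_diff Frac_scale)
    then have "ad_nilpotent n (\<lambda>x. S (T (\<iota> s * x)) - \<iota> s * S (T x)) = ad_nilpotent n (\<lambda>x. 1 * S (?T x) + 1 * ?S (T x))"
      by (rule ad_nilpotent_cong)
    then show ?thesis using ad_nilpotent_lincomb[OF 1 2] by (simp only:)
  qed
  then have "ad_nilpotent (Suc n) (\<lambda>x. S (T x))" by simp
  then show ?case using Suc.hyps(2) by simp
qed

lemma ad_nilpotent_determined_aux:
  "\<lbrakk>ad_nilpotent p T; \<And>r. r \<in> carrier R \<Longrightarrow> T (\<iota> r) = 0; x \<in> Frac\<rbrakk> \<Longrightarrow> T x = 0"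
proof (induction p arbitrary: T x)
  case 0
  from 0(3) obtain r s where x: "r \<in> carrier R" "s \<in> carrier R" "\<iota> s \<noteq> 0" "x = \<iota> r / \<iota> s" by (rule FracE)
  then have "\<iota> s * T x = T (\<iota> r)" using 0(1,3) by (metis ad_nilpotent.simps(1) nonzero_eq_divide_eq mult.commute)
  then show ?case using 0(2) x by simp
next
  case (Suc p)
  have comm: "T (\<iota> s * y) = \<iota> s * T y" if "s \<in> carrier R" "y \<in> Frac" for s y
    using Suc.IH[of "\<lambda>x. T (\<iota> s * x) - \<iota> s * T x" y] Suc.prems(1,2) that
    by (simp add: \<iota>_mult[symmetric])
  from Suc.prems(3) obtain r s where x: "r \<in> carrier R" "s \<in> carrier R" "\<iota> s \<noteq> 0" "x = \<iota> r / \<iota> s" by (rule FracE)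
  then have "\<iota> s * T x = T (\<iota> r)" using comm[of s x] Suc.prems(3) by simp
  then show ?case using Suc.prems(2) x by simp
qed

text \<open>The uniqueness principle behind the extension: the commutators of the difference
  vanish by induction on the order, so the difference commutes with \<open>R\<close> and vanishes
  on \<open>r/s\<close> because \<open>s\<close> times the value is its value at
  \<open>r\<close>.\<close>

lemma ad_nilpotent_determined:
  assumes "ad_nilpotent p S" "ad_nilpotent q T" "\<And>r. r \<in> carrier R \<Longrightarrow> S (\<iota> r) = T (\<iota> r)" "x \<in> Frac"
  shows "S x = T x"
proof -
  have "ad_nilpotent (max p q) (\<lambda>x. 1 * S x + (- 1) * T x)"
    using assms(1,2) by (intro ad_nilpotent_lincomb) (auto intro: ad_nilpotent_mono)
  from ad_nilpotent_determined_aux[OF this _ assms(4)] assms(3) show ?thesis by simp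
qed

text \<open>The value \<open>0\<close> outside the fractions makes the extension unique as a
  function.\<close>

definition extends :: "('a \<Rightarrow> 'a) \<Rightarrow> ('f \<Rightarrow> 'f) \<Rightarrow> bool" where
  "extends P T \<longleftrightarrow> (\<forall>x\<in>Frac. T x \<in> Frac) \<and> (\<forall>x\<in>Frac. \<forall>y\<in>Frac. T (x + y) = T x + T y) \<and>
     (\<forall>r\<in>carrier R. T (\<iota> r) = \<iota> (P r)) \<and> (\<forall>x. x \<notin> Frac \<longrightarrow> T x = 0) \<and> (\<exists>p. ad_nilpotent p T)"

lemma extends_unique:
  assumes "extends P S" "extends P T" shows "S = T"
proof
  fix x
  obtain p q where "ad_nilpotent p S" "ad_nilpotent q T" using assms by (auto simp: extends_def)
  from ad_nilpotent_determined[OF this] assms show "S x = T x" by (cases "x \<in> Frac") (auto simp: extends_def)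
qed

text \<open>By induction on the order every commutator \<open>[P, s]\<close> has an extension
  \<open>U s\<close>, and \<open>T(r/s) = (P(r) - U s (r/s)) / s\<close> is forced. It is well
  defined because \<open>U\<close> obeys the Leibniz rule in \<open>s\<close>, which holds by
  uniqueness; for the same reason \<open>[T, s] = U s\<close>.\<close>

lemma extends_exists: "P \<in> D p \<Longrightarrow> \<exists>T. extends P T \<and> ad_nilpotent p T"
proof (induction p arbitrary: P)
  case 0
  then obtain a where a: "a \<in> carrier R" "P = mult_op R a" by auto
  let ?T = "\<lambda>x. if x \<in> Frac then \<iota> a * x else 0"
  have ad_nilpotent: "ad_nilpotent 0 ?T"
    by (simp add: Frac_scale mult.left_commute)
  have "extends P ?T"
    unfolding extends_def
  proof (intro conjI)
    show "\<exists>p. ad_nilpotent p ?T" using ad_nilpotent by (rule exI)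
  qed (simp_all add: a Frac_scale Frac_add \<iota>_Frac mult_op_def \<iota>_mult distrib_left)
  with ad_nilpotent have "extends P ?T \<and> ad_nilpotent 0 ?T" by (rule conjI[rotated])
  then show ?case by (rule exI[of _ ?T])
next
  case (Suc p)
  have Plin: "P \<in> linear_endos K R" using diff_ops_linear[OF Suc.prems] .
  have "\<exists>T. s \<in> carrier R \<longrightarrow> extends (commutator_op R P s) T \<and> ad_nilpotent p T" for s
    using Suc.IH[of "commutator_op R P s"] Suc.prems by auto
  then obtain U where U: "\<And>s. s \<in> carrier R \<Longrightarrow> extends (commutator_op R P s) (U s)"
    and Unil: "\<And>s. s \<in> carrier R \<Longrightarrow> ad_nilpotent p (U s)" by metis
  have UFrac: "U s x \<in> Frac" if "s \<in> carrier R" "x \<in> Frac" for s x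
    using U[OF that(1)] that(2) by (auto simp: extends_def)
  have Uadd: "U s (x + y) = U s x + U s y" if "s \<in> carrier R" "x \<in> Frac" "y \<in> Frac" for s x y
    using U[OF that(1)] that by (auto simp: extends_def)
  have U\<iota>: "U s (\<iota> r) = \<iota> (P (s \<otimes>\<^bsub>R\<^esub> r)) - \<iota> s * \<iota> (P r)" if "s \<in> carrier R" "r \<in> carrier R" for s r
    using U[OF that(1)] that commutator_closed(3)[OF Plin] by (auto simp: extends_def)
  \<comment> \<open>the Leibniz rule for the commutators \<open>[P, s s']\<close>\<close>
  have Umult: "U (s \<otimes>\<^bsub>R\<^esub> s') x = U s (\<iota> s' * x) + \<iota> s * U s' x"
    if s: "s \<in> carrier R" "s' \<in> carrier R" and x: "x \<in> Frac" for s s' x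
  proof -
    have "ad_nilpotent p (\<lambda>x. 1 * U s (\<iota> s' * x) + \<iota> s * U s' x)"
      by (intro ad_nilpotent_lincomb ad_nilpotent_precomp Unil s)
    from ad_nilpotent_determined[OF Unil[OF R.m_closed[OF s]] this _ x]
    show ?thesis using s by (simp add: U\<iota> \<iota>_mult[symmetric] R.m_assoc) (simp add: \<iota>_mult algebra_simps)
  qed
  have Uswap: "U s (\<iota> t * x) - \<iota> t * U s x = U t (\<iota> s * x) - \<iota> s * U t x"
    if "s \<in> carrier R" "t \<in> carrier R" "x \<in> Frac" for s t x
    using Umult[of s t x] Umult[of t s x] that by (simp add: R.m_comm algebra_simps)
  have wd: "(\<iota> (P r) - U s x) / \<iota> s = (\<iota> (P r') - U s' x) / \<iota> s'"
    if x: "r \<in> carrier R" "s \<in> carrier R" "\<iota> s \<noteq> 0" "x = \<iota> r / \<iota> s"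
    and x': "r' \<in> carrier R" "s' \<in> carrier R" "\<iota> s' \<noteq> 0" "x = \<iota> r' / \<iota> s'" for r s r' s' x
  proof -
    have xF: "x \<in> Frac" using x FracI by simp
    have e: "\<iota> s * x = \<iota> r" using x(3,4) by simp
    have e': "\<iota> s' * x = \<iota> r'" using x'(3,4) by simp
    have "\<iota> s * \<iota> r' = \<iota> s' * \<iota> r" unfolding e[symmetric] e'[symmetric] by simp
    then have "s \<otimes>\<^bsub>R\<^esub> r' = s' \<otimes>\<^bsub>R\<^esub> r" 
      using \<iota>_eq_iff[of "s \<otimes>\<^bsub>R\<^esub> r'" "s' \<otimes>\<^bsub>R\<^esub> r"] x(1,2) x'(1,2) by (simp add: \<iota>_mult)
    then have "\<iota> (P (s \<otimes>\<^bsub>R\<^esub> r')) = \<iota> (P (s' \<otimes>\<^bsub>R\<^esub> r))" by simp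
    then have "\<iota> s' * \<iota> (P r) - \<iota> s' * U s x = \<iota> s * \<iota> (P r') - \<iota> s * U s' x"
      using Uswap[OF x(2) x'(2) xF] x(1,2) x'(1,2) unfolding e e' by (simp add: U\<iota> algebra_simps)
    then show ?thesis using x(3) x'(3) by (simp add: field_simps)
  qed
  \<comment> \<open>by \<open>wd\<close> the value does not depend on the fraction that is chosen to represent \<open>x\<close>\<close>
  define T where "T x = (if x \<in> Frac then
      (let (r, s) = (SOME (r, s). r \<in> carrier R \<and> s \<in> carrier R \<and> \<iota> s \<noteq> 0 \<and> x = \<iota> r / \<iota> s)
       in (\<iota> (P r) - U s x) / \<iota> s) else 0)" for x
  have T: "T x = (\<iota> (P r) - U s x) / \<iota> s"
    if x: "r \<in> carrier R" "s \<in> carrier R" "\<iota> s \<noteq> 0" "x = \<iota> r / \<iota> s" for r s x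
  proof -
    let ?Q = "\<lambda>(r, s). r \<in> carrier R \<and> s \<in> carrier R \<and> \<iota> s \<noteq> 0 \<and> x = \<iota> r / \<iota> s"
    obtain r' s' where rs: "(SOME p. ?Q p) = (r', s')" by fastforce
    have "?Q (SOME p. ?Q p)" by (rule someI[of ?Q "(r, s)"]) (use x in simp)
    then have "r' \<in> carrier R \<and> s' \<in> carrier R \<and> \<iota> s' \<noteq> 0 \<and> x = \<iota> r' / \<iota> s'" by (simp add: rs)
    then have "(\<iota> (P r) - U s x) / \<iota> s = (\<iota> (P r') - U s' x) / \<iota> s'"
      using wd[OF x] by blast
    moreover have "x \<in> Frac" using x FracI by simp
    ultimately show ?thesis unfolding T_def rs by simp
  qed
  have TFrac: "T x \<in> Frac" if "x \<in> Frac" for x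
    using that
  proof (rule FracE)
    fix r s assume x: "r \<in> carrier R" "s \<in> carrier R" "\<iota> s \<noteq> 0" "x = \<iota> r / \<iota> s"
    then show ?thesis unfolding T[OF x] using that
      by (intro Frac_inverse Frac_diff UFrac \<iota>_Frac) (simp_all add: linear_endosD[OF Plin])
  qed
  have Tadd: "T (x + y) = T x + T y" if xy: "x \<in> Frac" "y \<in> Frac" for x y
    using xy
  proof (rule Frac_common)
    fix r r' s assume x: "r \<in> carrier R" "r' \<in> carrier R" "s \<in> carrier R" "\<iota> s \<noteq> 0"
      "x = \<iota> r / \<iota> s" "y = \<iota> r' / \<iota> s"
    have "x + y = \<iota> (r \<oplus>\<^bsub>R\<^esub> r') / \<iota> s" using x by (simp add: \<iota>_add add_divide_distrib)
    from T[OF _ x(3,4) this] T[OF x(1,3,4,5)] T[OF x(2,3,4,6)] x(1-4) xy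
    show ?thesis by (simp add: linear_endosD[OF Plin] \<iota>_add Uadd add_divide_distrib diff_divide_distrib)
  qed
  have T\<iota>: "T (\<iota> r) = \<iota> (P r)" if r: "r \<in> carrier R" for r
    using T[of r "\<one>\<^bsub>R\<^esub>" "\<iota> r"] U\<iota>[of "\<one>\<^bsub>R\<^esub>" r] r by (simp add: \<iota>_one)
  have Tcomm: "T (\<iota> s * x) - \<iota> s * T x = U s x" if s: "s \<in> carrier R" and xF: "x \<in> Frac" for s x
    using xF
  proof (rule FracE)
    fix r u assume x: "r \<in> carrier R" "u \<in> carrier R" "\<iota> u \<noteq> 0" "x = \<iota> r / \<iota> u"
    have e: "\<iota> u * x = \<iota> r" using x by simp
    have "T (\<iota> s * x) = (\<iota> (P (s \<otimes>\<^bsub>R\<^esub> r)) - U u (\<iota> s * x)) / \<iota> u"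
      by (rule T) (use x s in \<open>simp_all add: \<iota>_mult\<close>)
    moreover have "\<iota> (P (s \<otimes>\<^bsub>R\<^esub> r)) - U u (\<iota> s * x) = \<iota> s * (\<iota> (P r) - U u x) + \<iota> u * U s x"
      using Uswap[OF s x(2) xF] U\<iota>[OF s x(1)] unfolding e by (simp add: algebra_simps)
    ultimately show ?thesis using T[OF x] x(3) by (simp add: add_divide_distrib)
  qed
  have "ad_nilpotent (Suc p) T"
    using Unil ad_nilpotent_cong[OF Tcomm] by simp
  moreover from this have "extends P T"
    unfolding extends_def using TFrac Tadd T\<iota> by (auto simp: T_def simp del: ad_nilpotent.simps)
  ultimately show ?case by (intro exI[of _ T] conjI)
qed

definition ext :: "('a \<Rightarrow> 'a) \<Rightarrow> 'f \<Rightarrow> 'f" where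
  "ext P = (THE T. extends P T)"

lemma ext_extends:
  assumes "P \<in> carrier (diff_ring K R)" shows "extends P (ext P)"
proof -
  obtain T where T: "extends P T" using assms extends_exists by (auto simp: diff_ring_carrier)
  show ?thesis unfolding ext_def by (rule theI[of "extends P", OF T]) (rule extends_unique[OF _ T])
qed

lemma extD:
  assumes "P \<in> carrier (diff_ring K R)"
  shows ext_Frac: "x \<in> Frac \<Longrightarrow> ext P x \<in> Frac"
    and ext_add: "\<lbrakk>x \<in> Frac; y \<in> Frac\<rbrakk> \<Longrightarrow> ext P (x + y) = ext P x + ext P y"
    and ext_\<iota>: "r \<in> carrier R \<Longrightarrow> ext P (\<iota> r) = \<iota> (P r)"
    and ext_ad_nilpotent: "\<exists>p. ad_nilpotent p (ext P)"
  using ext_extends[OF assms] by (auto simp: extends_def)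

lemma ext_zero: "P \<in> carrier (diff_ring K R) \<Longrightarrow> ext P 0 = 0"
  using ext_\<iota>[of P "\<zero>\<^bsub>R\<^esub>"] linear_zero[OF diff_ring_linear[of P]] by (simp add: \<iota>_zero)

lemma ext_neg: "\<lbrakk>P \<in> carrier (diff_ring K R); x \<in> Frac\<rbrakk> \<Longrightarrow> ext P (- x) = - ext P x"
  using ext_add[of P "- x" x] Frac_neg[of x] by (simp add: ext_zero eq_neg_iff_add_eq_0)

lemma ext_mult_op:
  assumes "a \<in> carrier R" "x \<in> Frac" shows "ext (mult_op R a) x = \<iota> a * x"
proof -
  obtain p where "ad_nilpotent p (ext (mult_op R a))" using ext_ad_nilpotent[OF mult_op_diff_ring[OF assms(1)]] by blast
  moreover have "ad_nilpotent 0 (\<lambda>x. \<iota> a * x)" by simp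
  ultimately show ?thesis
    by (rule ad_nilpotent_determined[OF _ _ _ assms(2)])
      (simp add: ext_\<iota> mult_op_diff_ring assms, simp add: mult_op_def assms \<iota>_mult)
qed

lemma ext_op_add:
  assumes P: "P \<in> carrier (diff_ring K R)" and Q: "Q \<in> carrier (diff_ring K R)" and x: "x \<in> Frac"
  shows "ext (op_add P Q) x = ext P x + ext Q x"
proof -
  obtain p q s where "ad_nilpotent p (ext P)" "ad_nilpotent q (ext Q)" and s: "ad_nilpotent s (ext (op_add P Q))"
    using ext_ad_nilpotent P Q diff_ring_closed(1)[OF P Q] by metis
  then have "ad_nilpotent (max p q) (\<lambda>x. 1 * ext P x + 1 * ext Q x)"
    by (intro ad_nilpotent_lincomb) (auto intro: ad_nilpotent_mono)
  from ad_nilpotent_determined[OF s this _ x] show ?thesis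
    by (simp add: ext_\<iota> P Q diff_ring_closed) (simp add: op_add_def \<iota>_add diff_ringD P Q)
qed

lemma ext_compose:
  assumes P: "P \<in> carrier (diff_ring K R)" and Q: "Q \<in> carrier (diff_ring K R)" and x: "x \<in> Frac"
  shows "ext (compose (carrier R) P Q) x = ext P (ext Q x)"
proof -
  obtain p q s where "ad_nilpotent p (ext P)" "ad_nilpotent q (ext Q)" and s: "ad_nilpotent s (ext (compose (carrier R) P Q))"
    using ext_ad_nilpotent P Q diff_ring_closed(2)[OF P Q] by metis
  then have "ad_nilpotent (p + q) (\<lambda>x. ext P (ext Q x))"
    by (intro ad_nilpotent_comp) (simp_all add: ext_add ext_Frac P Q)
  from ad_nilpotent_determined[OF s this _ x] show ?thesis
    by (simp add: ext_\<iota> P Q diff_ring_closed diff_ringD) (simp add: compose_def)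
qed

lemma ext_commutator:
  assumes P: "P \<in> carrier (diff_ring K R)" and s: "s \<in> carrier R" and x: "x \<in> Frac"
  shows "ext P (\<iota> s * x) = \<iota> s * ext P x + ext (commutator_op R P s) x"
proof -
  obtain p q where p: "ad_nilpotent p (ext P)" and q: "ad_nilpotent q (ext (commutator_op R P s))"
    using ext_ad_nilpotent P diff_ring_closed(4)[OF P s] by metis
  have "ad_nilpotent p (\<lambda>x. 1 * ext P (\<iota> s * x) + (- \<iota> s) * ext P x)"
    by (intro ad_nilpotent_lincomb ad_nilpotent_precomp p s)
  from ad_nilpotent_determined[OF q this _ x] show ?thesis
    by (simp add: ext_\<iota> P s diff_ring_closed commutator_closed[OF diff_ring_linear] \<iota>_mult[symmetric])
qed

text \<open>The localization of \<open>R\<close> at \<open>h\<close>, which is the zero ring for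
  \<open>h = 0\<close>.\<close>

definition Loc :: "'f \<Rightarrow> 'f set" where
  "Loc h = {x. if h = 0 then x = 0 else (\<exists>n. x * h ^ n \<in> \<iota> ` carrier R)}"

lemma LocE:
  assumes "x \<in> Loc h" "h \<noteq> 0"
  obtains r n where "r \<in> carrier R" "x = \<iota> r / h ^ n"
proof -
  obtain r n where "r \<in> carrier R" "x * h ^ n = \<iota> r" using assms by (auto simp: Loc_def)
  then show thesis using that[of r n] assms(2) by (simp add: field_simps)
qed

lemma LocI: "\<lbrakk>h \<noteq> 0; r \<in> carrier R\<rbrakk> \<Longrightarrow> \<iota> r / h ^ n \<in> Loc h"
  by (auto simp: Loc_def intro!: exI[of _ n])

lemma Loc_Frac:
  assumes "h \<in> \<iota> ` carrier R" shows "Loc h \<subseteq> Frac"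
proof
  fix x assume x: "x \<in> Loc h"
  show "x \<in> Frac"
  proof (cases "h = 0")
    case True
    then show ?thesis using x \<iota>_Frac[of "\<zero>\<^bsub>R\<^esub>"] by (simp add: Loc_def \<iota>_zero)
  next
    case False
    obtain f where f: "f \<in> carrier R" "h = \<iota> f" using assms by auto
    obtain r n where "r \<in> carrier R" "x = \<iota> r / h ^ n" using x False by (rule LocE)
    then show ?thesis using FracI[of r "f [^]\<^bsub>R\<^esub> n"] f False by (simp add: \<iota>_pow)
  qed
qed

lemma Loc_zero: "0 \<in> Loc h"
  using \<iota>_zero by (auto simp: Loc_def image_iff intro!: exI[of _ 0] bexI[of _ "\<zero>\<^bsub>R\<^esub>"])

lemma Loc_add:
  assumes "h \<in> \<iota> ` carrier R" "x \<in> Loc h" "y \<in> Loc h" shows "x + y \<in> Loc h"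
proof (cases "h = 0")
  case True
  then show ?thesis using assms by (simp add: Loc_def)
next
  case False
  obtain f where f: "f \<in> carrier R" "h = \<iota> f" using assms by auto
  obtain r n where x: "r \<in> carrier R" "x = \<iota> r / h ^ n" using assms(2) False by (rule LocE)
  obtain r' n' where y: "r' \<in> carrier R" "y = \<iota> r' / h ^ n'" using assms(3) False by (rule LocE)
  have "x + y = \<iota> (r \<otimes>\<^bsub>R\<^esub> f [^]\<^bsub>R\<^esub> n' \<oplus>\<^bsub>R\<^esub> r' \<otimes>\<^bsub>R\<^esub> f [^]\<^bsub>R\<^esub> n) / h ^ (n + n')"
    unfolding x(2) y(2) using x(1) y(1) f False by (simp add: \<iota>_simps power_add add_frac_eq)
  then show ?thesis using LocI[OF False] x y f by simp
qed

lemma Loc_mult: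
  assumes "x \<in> Loc h" "y \<in> Loc h" shows "x * y \<in> Loc h"
proof (cases "h = 0")
  case True
  then show ?thesis using assms by (simp add: Loc_def)
next
  case False
  obtain r n where x: "r \<in> carrier R" "x = \<iota> r / h ^ n" using assms(1) False by (rule LocE)
  obtain r' n' where y: "r' \<in> carrier R" "y = \<iota> r' / h ^ n'" using assms(2) False by (rule LocE)
  have "x * y = \<iota> (r \<otimes>\<^bsub>R\<^esub> r') / h ^ (n + n')"
    using x y by (simp add: \<iota>_simps power_add)
  then show ?thesis using LocI[OF False] x y by simp
qed

lemma Loc_\<iota>: "\<lbrakk>h \<noteq> 0; r \<in> carrier R\<rbrakk> \<Longrightarrow> \<iota> r \<in> Loc h"
  using LocI[of h r 0] by simp

lemma Loc_neg:
  assumes "x \<in> Loc h" shows "- x \<in> Loc h"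
proof (cases "h = 0")
  case True
  then show ?thesis using assms by (simp add: Loc_def)
next
  case False
  then have "\<iota> (\<ominus>\<^bsub>R\<^esub> \<one>\<^bsub>R\<^esub>) \<in> Loc h" by (rule Loc_\<iota>) simp
  from Loc_mult[OF this assms] show ?thesis by (simp add: \<iota>_simps)
qed

lemma Loc_diff: "\<lbrakk>h \<in> \<iota> ` carrier R; x \<in> Loc h; y \<in> Loc h\<rbrakk> \<Longrightarrow> x - y \<in> Loc h"
  using Loc_add[of h x "- y"] Loc_neg by simp

lemma Loc_divide_power:
  assumes "x \<in> Loc h" "h \<noteq> 0" shows "x / h ^ n \<in> Loc h"
  using Loc_mult[OF assms(1) LocI[OF assms(2) R.one_closed, of n]] by (simp add: \<iota>_one)

lemma ext_divide:
  assumes P: "P \<in> carrier (diff_ring K R)" and r: "r \<in> carrier R" and s: "s \<in> carrier R" "\<iota> s \<noteq> 0"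
  shows "ext P (\<iota> r / \<iota> s) = (\<iota> (P r) - ext (commutator_op R P s) (\<iota> r / \<iota> s)) / \<iota> s"
proof -
  have "ext P (\<iota> s * (\<iota> r / \<iota> s)) = \<iota> s * ext P (\<iota> r / \<iota> s) + ext (commutator_op R P s) (\<iota> r / \<iota> s)"
    by (rule ext_commutator[OF P s(1) FracI[OF r s]])
  then have "\<iota> (P r) = \<iota> s * ext P (\<iota> r / \<iota> s) + ext (commutator_op R P s) (\<iota> r / \<iota> s)"
    using s by (simp add: ext_\<iota> P r)
  then show ?thesis using s by (simp add: field_simps)
qed

text \<open>The denominators in \<open>P(r/s) = (P(r) - [P,s](r/s)) / s\<close> are powers of
  \<open>f\<close> if \<open>s\<close> is one.\<close>

lemma ext_Loc_aux: "\<lbrakk>P \<in> D p; f \<in> carrier R; x \<in> Loc (\<iota> f)\<rbrakk> \<Longrightarrow> ext P x \<in> Loc (\<iota> f)"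
proof (induction p arbitrary: P)
  case 0
  then obtain a where a: "a \<in> carrier R" "P = mult_op R a" by auto
  have "x \<in> Frac" using 0 Loc_Frac by blast
  then have "ext P x = \<iota> a * x" using a by (simp add: ext_mult_op)
  moreover have "\<iota> a * x \<in> Loc (\<iota> f)"
  proof (cases "\<iota> f = 0")
    case True
    then show ?thesis using 0 by (simp add: Loc_def)
  next
    case False
    then show ?thesis using Loc_mult[OF Loc_\<iota>[OF False a(1)]] 0 by simp
  qed
  ultimately show ?case by simp
next
  case (Suc p)
  have P: "P \<in> carrier (diff_ring K R)" using Suc.prems(1) unfolding diff_ring_carrier by blast
  show ?case
  proof (cases "\<iota> f = 0")
    case True
    then show ?thesis using Suc.prems(3) ext_zero[OF P] by (simp add: Loc_def)
  next
    case False
    obtain r n where x: "r \<in> carrier R" "x = \<iota> r / \<iota> f ^ n" using Suc.prems(3) False by (rule LocE)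
    let ?s = "f [^]\<^bsub>R\<^esub> n"
    have s: "?s \<in> carrier R" "\<iota> ?s = \<iota> f ^ n" "\<iota> ?s \<noteq> 0" using Suc.prems(2) False by (simp_all add: \<iota>_pow)
    have "commutator_op R P ?s \<in> D p" using Suc.prems(1) s by simp
    from Suc.IH[OF this Suc.prems(2,3)]
    have "ext (commutator_op R P ?s) x \<in> Loc (\<iota> f)" .
    then have "(\<iota> (P r) - ext (commutator_op R P ?s) x) / \<iota> f ^ n \<in> Loc (\<iota> f)"
      using Suc.prems(2) x(1) diff_ringD(1)[OF P] False by (intro Loc_divide_power Loc_diff Loc_\<iota>) auto
    then show ?thesis using ext_divide[OF P x(1) s(1,3)] x(2) s(2) by simp
  qed
qed

lemma ext_Loc:
  "\<lbrakk>P \<in> carrier (diff_ring K R); h \<in> \<iota> ` carrier R; x \<in> Loc h\<rbrakk> \<Longrightarrow> ext P x \<in> Loc h"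
  using ext_Loc_aux by (auto simp: diff_ring_carrier)

end


section \<open>The Cech differential and its contractions\<close>

text \<open>The vanishing diagonal is a hypothesis of its own, so that characteristic two is
  covered.\<close>

lemma antisymmetric_double_sum:
  fixes G :: "'i \<Rightarrow> 'i \<Rightarrow> 'f::ab_group_add"
  assumes "finite J" "\<And>i. i \<in> J \<Longrightarrow> G i i = 0" "\<And>i j. i \<in> J \<Longrightarrow> j \<in> J \<Longrightarrow> G i j = - G j i"
  shows "(\<Sum>i\<in>J. \<Sum>j\<in>J. G i j) = 0"
  using assms
proof (induction J rule: finite_induct)
  case (insert a J)
  have 1: "(\<Sum>i\<in>J. G i a) = - (\<Sum>j\<in>J. G a j)"
    unfolding sum_negf[symmetric] by (intro sum.cong refl insert.prems(2)) simp_all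
  have 2: "(\<Sum>i\<in>J. \<Sum>j\<in>J. G i j) = 0"
    by (intro insert.IH insert.prems insertI2)
  have 3: "G a a = 0" by (intro insert.prems(1) insertI1)
  have "(\<Sum>i\<in>insert a J. \<Sum>j\<in>insert a J. G i j) =
      (G a a + (\<Sum>j\<in>J. G a j)) + ((\<Sum>i\<in>J. G i a) + (\<Sum>i\<in>J. \<Sum>j\<in>J. G i j))"
    unfolding sum.insert[OF insert.hyps] sum.distrib by (simp only: ac_simps)
  also have "\<dots> = 0" unfolding 1 2 3 add_0_left add_0_right by (rule right_minus)
  finally show ?case .
next
  case empty
  show ?case by (rule sum.empty)
qed

definition csign :: "nat \<Rightarrow> nat set \<Rightarrow> 'f::field" where
  "csign j J = (- 1) ^ card {i \<in> J. i < j}"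

lemma csign_square [simp]: "csign j J * csign j J = 1"
  by (simp add: csign_def power_add[symmetric])

lemma csign_square_mult [simp]: "csign j J * (csign j J * z) = z"
  unfolding mult.assoc[symmetric] csign_square by simp

text \<open>Deleting \<open>i\<close> from \<open>J\<close> changes the position of
  \<open>j\<close> by one iff \<open>i < j\<close>. All sign rules of the Cech complex follow from
  this, since exactly one of \<open>i < j\<close> and \<open>j < i\<close> holds.\<close>

lemma csign_remove:
  assumes "finite J" "i \<in> J" "i \<noteq> j"
  shows "csign j J = (if i < j then - csign j (J - {i}) else csign j (J - {i}))"
proof (cases "i < j")
  case True
  then have "{t \<in> J. t < j} = insert i {t \<in> J - {i}. t < j}" using assms by auto
  then have "card {t \<in> J. t < j} = Suc (card {t \<in> J - {i}. t < j})" using assms by simp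
  then show ?thesis using True by (simp add: csign_def)
next
  case False
  then have "{t \<in> J. t < j} = {t \<in> J - {i}. t < j}" using assms by auto
  then show ?thesis using False by (simp add: csign_def)
qed

lemma csign_insert:
  assumes "finite J" "i \<notin> J" "i \<noteq> j"
  shows "csign j (insert i J) = (if i < j then - csign j J else csign j J)"
proof -
  have e: "insert i J - {i} = J" using assms by auto
  show ?thesis using csign_remove[of "insert i J" i j] assms unfolding e by simp
qed

text \<open>The Cech differential on all functions of subsets of \<open>V\<close>; the degree of a
  cochain is the size of the sets on which it lives, and the maps between the localizations are
  inclusions.\<close>

definition delta :: "nat set \<Rightarrow> (nat set \<Rightarrow> 'f::field) \<Rightarrow> nat set \<Rightarrow> 'f" where
  "delta V c J = (if J \<subseteq> V then \<Sum>j\<in>J. csign j J * c (J - {j}) else 0)"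

text \<open>The homotopy that contracts the Cech complex when \<open>h j\<close> is
  invertible.\<close>

definition contraction :: "nat \<Rightarrow> (nat set \<Rightarrow> 'f::field) \<Rightarrow> nat set \<Rightarrow> 'f" where
  "contraction j c J = (if j \<in> J then 0 else csign j (insert j J) * c (insert j J))"

lemma delta_delta:
  assumes "finite V" shows "delta V (delta V c) = 0"
proof
  fix J
  show "delta V (delta V c) J = 0 J"
  proof (cases "J \<subseteq> V")
    case True
    then have fin: "finite J" using assms finite_subset by blast
    define G where "G i j = (if i = j then 0 else csign i J * (csign j (J - {i}) * c (J - {i} - {j})))" for i j
    have "csign i J * delta V c (J - {i}) = (\<Sum>j\<in>J. G i j)" if i: "i \<in> J" for i
    proof -
      have "csign i J * delta V c (J - {i}) = (\<Sum>j\<in>J - {i}. G i j)"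
        using True by (auto simp: delta_def sum_distrib_left G_def intro!: sum.cong)
      also have "\<dots> = (\<Sum>j\<in>J. G i j)"
        using fin by (intro sum.mono_neutral_left) (auto simp: G_def)
      finally show ?thesis .
    qed
    then have "delta V (delta V c) J = (\<Sum>i\<in>J. \<Sum>j\<in>J. G i j)"
      using True by (simp add: delta_def[of V "delta V c"])
    also have "\<dots> = 0"
    proof (rule antisymmetric_double_sum[OF fin])
      show "G i i = 0" for i by (simp add: G_def)
      fix i j assume ij: "i \<in> J" "j \<in> J"
      show "G i j = - G j i"
      proof (cases "i = j")
        case False
        have e: "J - {i} - {j} = J - {j} - {i}" by auto
        show ?thesis
          using csign_remove[OF fin ij(1) False, where 'a='a] csign_remove[OF fin ij(2), of i, where 'a='a] False
          unfolding G_def e by (cases "i < j") simp_all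
      qed (simp add: G_def)
    qed
    finally show ?thesis by simp
  qed (simp add: delta_def)
qed

lemma delta_contraction:
  assumes "finite V" "j \<in> V" and c: "\<And>J. \<not> J \<subseteq> V \<Longrightarrow> c J = 0"
  shows "delta V (contraction j c) J + contraction j (delta V c) J = c J"
proof (cases "J \<subseteq> V")
  case False
  then show ?thesis by (auto simp: delta_def contraction_def c)
next
  case JV: True
  then have fin: "finite J" using assms(1) finite_subset by blast
  show ?thesis
  proof (cases "j \<in> J")
    case True
    have "delta V (contraction j c) J = (\<Sum>i\<in>J. if i = j then c J else 0)"
      unfolding delta_def using JV True by (auto simp: contraction_def insert_absorb intro!: sum.cong)
    then show ?thesis using fin True by (simp add: contraction_def)
  next
    case False
    have jJ: "insert j J \<subseteq> V" using JV assms(2) by simp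
    have "contraction j (delta V c) J = csign j (insert j J) *
        (csign j (insert j J) * c J + (\<Sum>i\<in>J. csign i (insert j J) * c (insert j J - {i})))"
      using False jJ fin by (simp add: contraction_def delta_def)
    also have "\<dots> = c J + (\<Sum>i\<in>J. csign j (insert j J) * (csign i (insert j J) * c (insert j J - {i})))"
      by (simp add: distrib_left sum_distrib_left)
    also have "(\<Sum>i\<in>J. csign j (insert j J) * (csign i (insert j J) * c (insert j J - {i}))) =
        - (\<Sum>i\<in>J. csign i J * contraction j c (J - {i}))"
      unfolding sum_negf[symmetric]
    proof (rule sum.cong)
      fix i assume i: "i \<in> J"
      then have ij: "i \<noteq> j" using False by auto
      have e: "insert j J - {i} = insert j (J - {i})" using ij by auto
      have 1: "csign i (insert j J) = (if j < i then - csign i J else csign i J :: 'a)"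
        by (rule csign_insert) (use fin False ij in auto)
      have 2: "csign j (insert j J) = (if i < j then - csign j (insert j (J - {i})) else csign j (insert j (J - {i})) :: 'a)"
        unfolding e[symmetric] by (rule csign_remove) (use fin i ij in auto)
      have "j \<notin> J - {i}" using False by simp
      then have 3: "contraction j c (J - {i}) = csign j (insert j (J - {i})) * c (insert j (J - {i}))"
        unfolding contraction_def by (rule if_not_P)
      show "csign j (insert j J) * (csign i (insert j J) * c (insert j J - {i})) = - (csign i J * contraction j c (J - {i}))"
        unfolding 3 1 2 e using ij by (cases "i < j") auto
    qed simp
    finally show ?thesis using JV by (simp add: delta_def[of V "contraction j c"])
  qed
qed

lemma delta_add: "delta V (c + c') = delta V c + delta V c'"
  by (auto simp: delta_def fun_eq_iff distrib_left sum.distrib)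

lemma delta_diff: "delta V (c - c') = delta V c - delta V c'"
  by (auto simp: delta_def fun_eq_iff right_diff_distrib sum_subtractf)

lemma delta_zero: "delta V 0 = 0"
  by (auto simp: delta_def fun_eq_iff)

lemma delta_sum_scaled:
  "delta V (\<lambda>J. \<Sum>j\<in>W. a j * c j J) J = (\<Sum>j\<in>W. a j * delta V (c j) J)"
proof (cases "J \<subseteq> V")
  case True
  then show ?thesis unfolding delta_def
    by (simp add: sum_distrib_left) (subst sum.swap, simp add: mult.left_commute)
qed (simp add: delta_def)

text \<open>Elements that generate the unit ideal have powers that generate the unit ideal. The
  generators are replaced by their powers one at a time.\<close>

lemma unit_ideal_powers:
  fixes h :: "'i \<Rightarrow> 'f::comm_ring_1"
  assumes T: "1 \<in> T" "\<And>x y. x \<in> T \<Longrightarrow> y \<in> T \<Longrightarrow> x + y \<in> T" "\<And>x y. x \<in> T \<Longrightarrow> y \<in> T \<Longrightarrow> x * y \<in> T"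
    and "\<And>j. j \<in> V \<Longrightarrow> h j \<in> T" and "finite V"
    and "\<And>j. j \<in> V \<Longrightarrow> a j \<in> T" and "(\<Sum>j\<in>V. a j * h j) = 1"
  shows "\<exists>b. (\<forall>j\<in>V. b j \<in> T) \<and> (\<Sum>j\<in>V. b j * h j ^ Suc n) = 1"
proof -
  have pow: "x ^ k \<in> T" if "x \<in> T" for x k
    using that by (induction k) (auto intro: T)
  have "\<exists>b. (\<forall>j\<in>V. b j \<in> T) \<and> (\<Sum>j\<in>V. b j * (if j \<in> W then h j ^ Suc n else h j)) = 1"
    if "W \<subseteq> V" for W
    using finite_subset[OF that assms(5)] that
  proof (induction W rule: finite_induct)
    case empty
    then show ?case using assms(6,7) by (intro exI[of _ a]) simp
  next
    case (insert w W)
    let ?h = "\<lambda>j. if j \<in> W then h j ^ Suc n else h j" and ?h' = "\<lambda>j. if j \<in> insert w W then h j ^ Suc n else h j"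
    obtain b where b: "\<forall>j\<in>V. b j \<in> T" "(\<Sum>j\<in>V. b j * ?h j) = 1" using insert by auto
    have w: "w \<in> V" "w \<notin> W" using insert by auto
    \<comment> \<open>replace \<open>z\<close> by its power: \<open>1 - z ^ Suc n\<close> is the multiple \<open>g * (1 - z)\<close> of the other summands\<close>
    define z where "z = b w * h w"
    define g where "g = (\<Sum>i<Suc n. z ^ i)"
    have split: "z + (\<Sum>j\<in>V - {w}. b j * ?h j) = 1"
      using b(2) w assms(5) unfolding z_def by (subst (asm) sum.remove[of V w]) auto
    have zT: "z \<in> T" using b w assms(4) by (auto simp: z_def intro: T)
    have "(\<Sum>i<Suc m. z ^ i) \<in> T" for m
      using zT by (induction m) (auto intro: T pow)
    then have gT: "g \<in> T" by (simp only: g_def)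
    define b' where "b' j = (if j = w then b w ^ Suc n else g * b j)" for j
    have "(\<Sum>j\<in>V. b' j * ?h' j) = b w ^ Suc n * h w ^ Suc n + (\<Sum>j\<in>V - {w}. b' j * ?h' j)"
      using w assms(5) by (subst sum.remove[of V w]) (auto simp: b'_def)
    also have "(\<Sum>j\<in>V - {w}. b' j * ?h' j) = g * (\<Sum>j\<in>V - {w}. b j * ?h j)"
      unfolding sum_distrib_left by (rule sum.cong) (auto simp: b'_def mult.assoc)
    also have "(\<Sum>j\<in>V - {w}. b j * ?h j) = 1 - z" using split by (simp add: algebra_simps)
    also have "g * (1 - z) = 1 - z ^ Suc n"
      unfolding g_def using one_diff_power_eq[of z "Suc n"] by (simp add: mult.commute)
    also have "b w ^ Suc n * h w ^ Suc n = z ^ Suc n" by (simp add: z_def power_mult_distrib)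
    finally have "(\<Sum>j\<in>V. b' j * ?h' j) = 1" by simp
    moreover have "\<forall>j\<in>V. b' j \<in> T" using b w gT by (auto simp: b'_def intro: T pow)
    ultimately show ?case by blast
  qed
  from this[of V] obtain b where "\<forall>j\<in>V. b j \<in> T" "(\<Sum>j\<in>V. b j * (if j \<in> V then h j ^ Suc n else h j)) = 1"
    by auto
  moreover have "(\<Sum>j\<in>V. b j * (if j \<in> V then h j ^ Suc n else h j)) = (\<Sum>j\<in>V. b j * h j ^ Suc n)"
    by (rule sum.cong) auto
  ultimately show ?thesis by auto
qed


section \<open>Stable subgroups of fractions\<close>

context embedded_algebra begin

abbreviation Dop :: "('a \<Rightarrow> 'a) set" where "Dop \<equiv> carrier (diff_ring K R)"

lemma Frac_zero: "0 \<in> Frac"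
  using \<iota>_Frac[of "\<zero>\<^bsub>R\<^esub>"] by (simp add: \<iota>_zero)

lemma Frac_sum: "(\<And>j. j \<in> W \<Longrightarrow> x j \<in> Frac) \<Longrightarrow> (\<Sum>j\<in>W. x j) \<in> Frac"
  by (induction W rule: infinite_finite_induct) (simp_all add: Frac_zero Frac_add)

lemma ext_sum:
  assumes "P \<in> Dop" "\<And>j. j \<in> W \<Longrightarrow> x j \<in> Frac"
  shows "ext P (\<Sum>j\<in>W. x j) = (\<Sum>j\<in>W. ext P (x j))"
  using assms(2)
  by (induction W rule: infinite_finite_induct)
    (simp_all add: ext_zero[OF assms(1)] ext_add[OF assms(1)] Frac_sum)

lemma csign_cases: "csign j J = (1 :: 'f) \<or> csign j J = (- 1 :: 'f)"
  by (simp add: csign_def minus_one_power_iff)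

lemma Loc_sum: "h \<in> \<iota> ` carrier R \<Longrightarrow> (\<And>j. j \<in> W \<Longrightarrow> x j \<in> Loc h) \<Longrightarrow> (\<Sum>j\<in>W. x j) \<in> Loc h"
  by (induction W rule: infinite_finite_induct) (simp_all add: Loc_zero Loc_add)

lemma Loc_csign: "x \<in> Loc h \<Longrightarrow> csign j J * x \<in> Loc h"
  using csign_cases[of j J] Loc_neg by auto

lemma ext_csign: "\<lbrakk>P \<in> Dop; x \<in> Frac\<rbrakk> \<Longrightarrow> ext P (csign j J * x) = csign j J * ext P x"
  using csign_cases[of j J] ext_neg by auto

lemma Frac_csign: "x \<in> Frac \<Longrightarrow> csign j J * x \<in> Frac"
  using csign_cases[of j J] Frac_neg by auto

lemma Loc_mono_mult:
  assumes "g \<in> \<iota> ` carrier R" "x \<in> Loc h" "h \<noteq> 0" "g \<noteq> 0" shows "x \<in> Loc (g * h)"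
proof -
  obtain a where a: "a \<in> carrier R" "g = \<iota> a" using assms(1) by auto
  obtain r n where r: "r \<in> carrier R" "x = \<iota> r / h ^ n" using assms(2,3) by (rule LocE)
  have "x = \<iota> (r \<otimes>\<^bsub>R\<^esub> a [^]\<^bsub>R\<^esub> n) / (g * h) ^ n"
    using a r assms(3,4) by (simp add: \<iota>_simps power_mult_distrib)
  then show ?thesis using LocI[of "g * h" "r \<otimes>\<^bsub>R\<^esub> a [^]\<^bsub>R\<^esub> n" n] a r assms(3,4) by simp
qed

text \<open>The \<open>D\<close>-submodules of the fractions.\<close>

definition stable :: "'f set \<Rightarrow> bool" where
  "stable L \<longleftrightarrow> 0 \<in> L \<and> (\<forall>x\<in>L. \<forall>y\<in>L. x - y \<in> L) \<and> (\<forall>P\<in>Dop. \<forall>x\<in>L. ext P x \<in> L)"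

definition act :: "('a \<Rightarrow> 'a) \<Rightarrow> (nat set \<Rightarrow> 'f) \<Rightarrow> nat set \<Rightarrow> 'f" where
  "act P c = (\<lambda>J. ext P (c J))"

definition stable_fun :: "(nat set \<Rightarrow> 'f) set \<Rightarrow> bool" where
  "stable_fun L \<longleftrightarrow> 0 \<in> L \<and> (\<forall>x\<in>L. \<forall>y\<in>L. x - y \<in> L) \<and> (\<forall>P\<in>Dop. \<forall>x\<in>L. act P x \<in> L)"

lemma stable_funD:
  assumes "stable_fun L"
  shows "0 \<in> L" "\<lbrakk>x \<in> L; y \<in> L\<rbrakk> \<Longrightarrow> x - y \<in> L" "\<lbrakk>P \<in> Dop; x \<in> L\<rbrakk> \<Longrightarrow> act P x \<in> L"
    "\<lbrakk>x \<in> L; y \<in> L\<rbrakk> \<Longrightarrow> x + y \<in> L"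
proof -
  show z: "0 \<in> L" and d: "\<And>x y. \<lbrakk>x \<in> L; y \<in> L\<rbrakk> \<Longrightarrow> x - y \<in> L"
    and "\<lbrakk>P \<in> Dop; x \<in> L\<rbrakk> \<Longrightarrow> act P x \<in> L"
    using assms by (auto simp: stable_fun_def)
  show "x + y \<in> L" if "x \<in> L" "y \<in> L"
    using d[OF that(1) d[OF z that(2)]] by simp
qed

text \<open>A finite product of localizations, with values \<open>0\<close> outside the index
  set.\<close>

definition families :: "nat set set \<Rightarrow> (nat set \<Rightarrow> 'f) \<Rightarrow> (nat set \<Rightarrow> 'f) set" where
  "families S h = {c. \<forall>J. if J \<in> S then c J \<in> Loc (h J) else c J = 0}"

text \<open>Split off one factor: a submodule is determined, among those that contain it, by its
  projection to the factor and its intersection with the kernel of the projection, so the ranks of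
  the two add up to a rank.\<close>

lemma bounded_rank_families:
  assumes "finite S" and "\<And>J. J \<in> S \<Longrightarrow> h J \<in> \<iota> ` carrier R"
    and "\<And>J. J \<in> S \<Longrightarrow> bounded_rank {L. stable L \<and> L \<subseteq> Loc (h J)}"
  shows "bounded_rank {L. stable_fun L \<and> L \<subseteq> families S h}"
  using assms
proof (induction S rule: finite_induct)
  case empty
  have "L = {0}" if "stable_fun L" "L \<subseteq> families {} h" for L
    using that stable_funD(1)[OF that(1)] by (auto simp: families_def fun_eq_iff)
  then have "\<not> U \<subset> W" if "stable_fun U" "U \<subseteq> families {} h" "stable_fun W" "W \<subseteq> families {} h" for U W
    using that by blast
  then show ?case unfolding bounded_rank_def
    by (intro exI[of _ "\<lambda>_. 0"] exI[of _ 0]) simp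
next
  case (insert J S)
  let ?F = "{L. stable_fun L \<and> L \<subseteq> families (insert J S) h}"
  let ?FS = "{L. stable_fun L \<and> L \<subseteq> families S h}" and ?FJ = "{L. stable L \<and> L \<subseteq> Loc (h J)}"
  define pr where "pr L = (\<lambda>c. c J) ` L" for L :: "(nat set \<Rightarrow> 'f) set"
  define ker where "ker L = {c \<in> L. c J = 0}" for L :: "(nat set \<Rightarrow> 'f) set"
  have pr: "pr L \<in> ?FJ" if L: "L \<in> ?F" for L
  proof -
    have "stable (pr L)"
      unfolding stable_def
    proof (intro conjI ballI)
      show "0 \<in> pr L" unfolding pr_def by (rule image_eqI[of _ _ 0]) (use L stable_funD(1) in auto)
    next
      fix x y assume "x \<in> pr L" "y \<in> pr L"
      then obtain c c' where "c \<in> L" "c' \<in> L" "x = c J" "y = c' J" by (auto simp: pr_def)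
      then show "x - y \<in> pr L"
        unfolding pr_def using L by (intro image_eqI[of _ _ "c - c'"]) (auto intro: stable_funD)
    next
      fix P x assume P: "P \<in> Dop" and "x \<in> pr L"
      then obtain c where c: "c \<in> L" "x = c J" by (auto simp: pr_def)
      have "ext P x = act P c J" by (simp add: act_def c)
      moreover have "act P c \<in> L" using L P c(1) by (intro stable_funD(3)) simp_all
      ultimately show "ext P x \<in> pr L" unfolding pr_def by (rule image_eqI)
    qed
    moreover have "pr L \<subseteq> Loc (h J)"
      using L by (auto simp: pr_def families_def)
    ultimately show ?thesis by simp
  qed
  have ker: "ker L \<in> ?FS" if L: "L \<in> ?F" for L
  proof -
    have "stable_fun (ker L)"
      using L by (auto simp: stable_fun_def ker_def act_def ext_zero)
    moreover have "ker L \<subseteq> families S h"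
    proof
      fix c assume "c \<in> ker L"
      then have c: "c J = 0" "c \<in> families (insert J S) h" using L by (auto simp: ker_def)
      have "if Ja \<in> S then c Ja \<in> Loc (h Ja) else c Ja = 0" for Ja
        using c insert.hyps(2) unfolding families_def by (cases "Ja = J") (auto dest!: spec[of _ Ja])
      then show "c \<in> families S h" by (simp add: families_def)
    qed
    ultimately show ?thesis by simp
  qed
  obtain hJ bJ where J: "\<forall>U\<in>?FJ. hJ U \<le> (bJ::nat)" "\<forall>U\<in>?FJ. \<forall>W\<in>?FJ. U \<subset> W \<longrightarrow> hJ U < hJ W"
    using insert.prems(2)[OF insertI1] unfolding bounded_rank_def by (elim exE conjE)
  have "bounded_rank ?FS" by (intro insert.IH insert.prems insertI2)
  then obtain hS bS where S: "\<forall>U\<in>?FS. hS U \<le> (bS::nat)" "\<forall>U\<in>?FS. \<forall>W\<in>?FS. U \<subset> W \<longrightarrow> hS U < hS W"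
    unfolding bounded_rank_def by (elim exE conjE)
  have "hJ (pr U) + hS (ker U) < hJ (pr W) + hS (ker W)" if U: "U \<in> ?F" and W: "W \<in> ?F" and UW: "U \<subset> W" for U W
  proof -
    have sub: "pr U \<subseteq> pr W" "ker U \<subseteq> ker W" using UW by (auto simp: pr_def ker_def)
    have "pr U \<noteq> pr W \<or> ker U \<noteq> ker W"
    proof (rule ccontr)
      assume "\<not> ?thesis"
      then have eq: "pr U = pr W" "ker U = ker W" by auto
      obtain c where c: "c \<in> W" "c \<notin> U" using UW by auto
      then have "c J \<in> pr U" unfolding eq by (auto simp: pr_def)
      then obtain c' where c': "c' \<in> U" "c' J = c J" by (auto simp: pr_def)
      have "c - c' \<in> ker W" using c c' UW W by (auto simp: ker_def intro: stable_funD)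
      then have "c - c' \<in> U" unfolding eq[symmetric] by (simp add: ker_def)
      then have "(c - c') + c' \<in> U" using c' U by (intro stable_funD(4)) auto
      then show False using c by simp
    qed
    moreover have sJ: "pr U \<noteq> pr W \<Longrightarrow> hJ (pr U) < hJ (pr W)"
      by (rule J(2)[rule_format, OF pr[OF U] pr[OF W]]) (rule psubsetI[OF sub(1)])
    moreover have sS: "ker U \<noteq> ker W \<Longrightarrow> hS (ker U) < hS (ker W)"
      by (rule S(2)[rule_format, OF ker[OF U] ker[OF W]]) (rule psubsetI[OF sub(2)])
    moreover have "hJ (pr U) \<le> hJ (pr W)" using sJ by (cases "pr U = pr W") simp_all
    moreover have "hS (ker U) \<le> hS (ker W)" using sS by (cases "ker U = ker W") simp_all
    ultimately show ?thesis by linarith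
  qed
  moreover have "hJ (pr U) + hS (ker U) \<le> bJ + bS" if "U \<in> ?F" for U
    using J(1) S(1) pr[OF that] ker[OF that] by (simp add: add_mono)
  ultimately show ?case unfolding bounded_rank_def
    by (intro exI[of _ "\<lambda>U. hJ (pr U) + hS (ker U)"] exI[of _ "bJ + bS"] conjI ballI impI)
qed

end


section \<open>The Cech complex inside the field\<close>

text \<open>All generators are nonzero. For a list of generators this is no restriction: a
  vanishing generator contributes only zero rings to the Cech complex and can be left out of the
  index set.\<close>

locale cech_complex = embedded_algebra K R \<iota>
  for K :: "('k, 'l) ring_scheme" and R :: "('k, 'a, 'm) module_scheme" and \<iota> :: "'a \<Rightarrow> 'f::field" +
  fixes h :: "nat \<Rightarrow> 'f"
  assumes h_R: "h j \<in> \<iota> ` carrier R" and h_nz: "h j \<noteq> 0"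
begin

definition hprod :: "nat set \<Rightarrow> 'f" where "hprod J = (\<Prod>j\<in>J. h j)"

lemma hprod_R: "hprod J \<in> \<iota> ` carrier R"
  unfolding hprod_def
proof (induction J rule: infinite_finite_induct)
  case (insert j J)
  obtain a b where "a \<in> carrier R" "b \<in> carrier R" "h j = \<iota> a" "(\<Prod>j\<in>J. h j) = \<iota> b"
    using h_R[of j] insert.IH by auto
  then show ?case using insert.hyps by (intro image_eqI[of _ _ "a \<otimes>\<^bsub>R\<^esub> b"]) (simp_all add: \<iota>_mult)
qed (auto intro!: image_eqI[of _ _ "\<one>\<^bsub>R\<^esub>"] simp: \<iota>_one)

lemma hprod_nz: "hprod J \<noteq> 0"
  unfolding hprod_def by (induction J rule: infinite_finite_induct) (simp_all add: h_nz)

lemma hprod_insert: "\<lbrakk>finite J; j \<notin> J\<rbrakk> \<Longrightarrow> hprod (insert j J) = h j * hprod J"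
  by (simp add: hprod_def)

lemma Loc_hprod_insert: "\<lbrakk>finite J; j \<notin> J; x \<in> Loc (hprod J)\<rbrakk> \<Longrightarrow> x \<in> Loc (hprod (insert j J))"
  by (simp add: hprod_insert Loc_mono_mult h_R h_nz hprod_nz)

lemma Loc_h_hprod:
  assumes "finite J" "j \<in> J" "x \<in> Loc (h j)" shows "x \<in> Loc (hprod J)"
proof -
  have "hprod J = hprod (J - {j}) * h j" using assms by (simp add: hprod_def prod.remove mult.commute)
  then show ?thesis using Loc_mono_mult[OF hprod_R assms(3) h_nz hprod_nz] by simp
qed

definition Cech :: "nat set \<Rightarrow> nat \<Rightarrow> (nat set \<Rightarrow> 'f) set" where
  "Cech V k = families {J. J \<subseteq> V \<and> card J = k} hprod"

lemma CechD: "c \<in> Cech V k \<Longrightarrow> J \<subseteq> V \<Longrightarrow> card J = k \<Longrightarrow> c J \<in> Loc (hprod J)"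
    "c \<in> Cech V k \<Longrightarrow> \<not> J \<subseteq> V \<or> card J \<noteq> k \<Longrightarrow> c J = 0"
  by (auto simp: Cech_def families_def split: if_splits)

lemma CechI:
  assumes "\<And>J. J \<subseteq> V \<Longrightarrow> card J = k \<Longrightarrow> c J \<in> Loc (hprod J)"
    and "\<And>J. \<not> J \<subseteq> V \<or> card J \<noteq> k \<Longrightarrow> c J = 0"
  shows "c \<in> Cech V k"
  using assms by (auto simp: Cech_def families_def)

lemma Cech_Loc: "c \<in> Cech V k \<Longrightarrow> c J \<in> Loc (hprod J)"
  using CechD[of c V k J] Loc_zero by metis

lemma Cech_Frac: "c \<in> Cech V k \<Longrightarrow> c J \<in> Frac"
  using Cech_Loc Loc_Frac[OF hprod_R] by blast

lemma stable_Cech: "stable_fun (Cech V k)"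
  unfolding stable_fun_def
  by (auto simp: Cech_def families_def act_def Loc_zero Loc_diff hprod_R ext_Loc ext_zero split: if_splits)

lemmas CechC = stable_funD[OF stable_Cech]

lemma delta_Cech:
  assumes "finite V" "c \<in> Cech V k" shows "delta V c \<in> Cech V (Suc k)"
proof (rule CechI)
  fix J assume J: "J \<subseteq> V" "card J = Suc k"
  then have fin: "finite J" using assms(1) finite_subset by blast
  have "csign j J * c (J - {j}) \<in> Loc (hprod J)" if j: "j \<in> J" for j
  proof -
    have "c (J - {j}) \<in> Loc (hprod (insert j (J - {j})))"
      by (rule Loc_hprod_insert) (use fin Cech_Loc[OF assms(2)] in auto)
    moreover have "insert j (J - {j}) = J" using j by auto
    ultimately show ?thesis by (simp add: Loc_csign)
  qed
  then show "delta V c J \<in> Loc (hprod J)" using J by (simp add: delta_def Loc_sum hprod_R)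
next
  fix J assume J: "\<not> J \<subseteq> V \<or> card J \<noteq> Suc k"
  show "delta V c J = 0"
  proof (cases "J \<subseteq> V")
    case True
    then have fin: "finite J" using assms(1) finite_subset by blast
    have "c (J - {j}) = 0" if j: "j \<in> J" for j
      by (rule CechD(2)[OF assms(2)]) (use fin j True J card_Suc_Diff1[of J j] in auto)
    then show ?thesis by (simp add: delta_def)
  qed (simp add: delta_def)
qed

lemma act_delta:
  assumes "P \<in> Dop" "c \<in> Cech V k" shows "delta V (act P c) = act P (delta V c)"
proof
  fix J
  show "delta V (act P c) J = act P (delta V c) J"
    using assms by (simp add: delta_def act_def ext_sum ext_csign Frac_csign Cech_Frac ext_zero)
qed

lemma act_add:
  "\<lbrakk>P \<in> Dop; c \<in> Cech V k; c' \<in> Cech V k\<rbrakk> \<Longrightarrow> act P (c + c') = act P c + act P c'"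
  by (auto simp: act_def ext_add Cech_Frac fun_eq_iff)

lemma act_zero: "P \<in> Dop \<Longrightarrow> act P 0 = 0"
  by (auto simp: act_def ext_zero fun_eq_iff)

definition cocycles :: "nat set \<Rightarrow> nat \<Rightarrow> (nat set \<Rightarrow> 'f) set" where
  "cocycles V k = {c \<in> Cech V k. delta V c = 0}"

definition coboundaries :: "nat set \<Rightarrow> nat \<Rightarrow> (nat set \<Rightarrow> 'f) set" where
  "coboundaries V k = (case k of 0 \<Rightarrow> {0} | Suc m \<Rightarrow> delta V ` Cech V m)"

lemma cocycles_Cech: "c \<in> cocycles V k \<Longrightarrow> c \<in> Cech V k"
  by (simp add: cocycles_def)

lemma stable_cocycles: "stable_fun (cocycles V k)"
  unfolding stable_fun_def cocycles_def
  by (auto simp: CechC delta_zero delta_diff act_delta act_zero)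

lemma stable_coboundaries: "stable_fun (coboundaries V k)"
proof (cases k)
  case 0
  then show ?thesis by (simp add: stable_fun_def coboundaries_def act_zero)
next
  case (Suc m)
  show ?thesis
    unfolding stable_fun_def
  proof (intro conjI ballI)
    show "0 \<in> coboundaries V k" unfolding coboundaries_def Suc nat.case
      by (rule image_eqI[of _ _ 0]) (simp_all add: delta_zero CechC(1))
  next
    fix x y assume "x \<in> coboundaries V k" "y \<in> coboundaries V k"
    then obtain c c' where "c \<in> Cech V m" "c' \<in> Cech V m" "x = delta V c" "y = delta V c'"
      by (auto simp: coboundaries_def Suc)
    then show "x - y \<in> coboundaries V k" unfolding coboundaries_def Suc nat.case
      by (intro image_eqI[of _ _ "c - c'"]) (simp_all add: delta_diff CechC(2))
  next
    fix P x assume P: "P \<in> Dop" and "x \<in> coboundaries V k"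
    then obtain c where "c \<in> Cech V m" "x = delta V c"
      by (auto simp: coboundaries_def Suc)
    then show "act P x \<in> coboundaries V k" unfolding coboundaries_def Suc nat.case using P
      by (intro image_eqI[of _ _ "act P c"]) (simp_all add: act_delta CechC(3))
  qed
qed

lemma coboundaries_cocycles: "finite V \<Longrightarrow> coboundaries V k \<subseteq> cocycles V k"
  by (auto simp: coboundaries_def cocycles_def CechC(1) delta_zero delta_Cech delta_delta split: nat.splits)

text \<open>Finite length of the cohomology in degree \<open>k\<close>, phrased with submodules
  between coboundaries and cocycles.\<close>

definition bounded_cohomology :: "nat set \<Rightarrow> nat \<Rightarrow> bool" where
  "bounded_cohomology V k \<longleftrightarrow> bounded_rank {L. stable_fun L \<and> coboundaries V k \<subseteq> L \<and> L \<subseteq> cocycles V k}"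

definition restr :: "nat set \<Rightarrow> (nat set \<Rightarrow> 'f) \<Rightarrow> nat set \<Rightarrow> 'f" where
  "restr W c J = (if J \<subseteq> W then c J else 0)"

lemma restr_simps:
  "restr W (c - c') = restr W c - restr W c'" "restr W (c + c') = restr W c + restr W c'" "restr W 0 = 0"
  "P \<in> Dop \<Longrightarrow> restr W (act P c) = act P (restr W c)"
  by (auto simp: restr_def act_def ext_zero fun_eq_iff)

lemma restr_delta:
  assumes "W \<subseteq> V" shows "restr W (delta V c) = delta W (restr W c)"
proof
  fix J show "restr W (delta V c) J = delta W (restr W c) J"
    using assms by (auto simp: restr_def delta_def intro!: sum.cong)
qed

lemma restr_Cech: "W \<subseteq> V \<Longrightarrow> c \<in> Cech V k \<Longrightarrow> restr W c \<in> Cech W k"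
  by (rule CechI) (auto simp: restr_def CechD)

lemma Cech_mono: "W \<subseteq> V \<Longrightarrow> c \<in> Cech W k \<Longrightarrow> c \<in> Cech V k"
  using CechD(1)[of c W k] CechD(2)[of c W k] Cech_Loc[of c W k]
  by (intro CechI) blast+

lemma restr_id: "c \<in> Cech W k \<Longrightarrow> restr W c = c"
  by (auto simp: restr_def CechD fun_eq_iff)

context
  fixes V W :: "nat set" and x :: nat and a :: "nat \<Rightarrow> 'f"
  assumes finW: "finite W" and xW: "x \<notin> W" and V: "V = insert x W"
    and a: "\<And>j. j \<in> W \<Longrightarrow> a j \<in> \<iota> ` carrier R"
    and hx: "h x = (\<Sum>j\<in>W. a j * h j)"
begin

lemma finV: "finite V" using finW V by simp

lemma WV: "W \<subseteq> V" using V by auto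

text \<open>A power of \<open>h j\<close> clears the part of the denominator that comes from
  \<open>h j\<close>.\<close>

lemma Loc_h_power:
  assumes "finite J" "j \<notin> J" "y \<in> Loc (hprod (insert j J))"
  shows "\<exists>n. \<forall>m\<ge>n. h j ^ m * y \<in> Loc (hprod J)"
proof -
  have "hprod (insert j J) = h j * hprod J" using assms by (simp add: hprod_insert)
  then obtain r n where r: "r \<in> carrier R" "y = \<iota> r / (h j * hprod J) ^ n"
    using LocE[OF assms(3) hprod_nz] by metis
  obtain b where b: "b \<in> carrier R" "h j = \<iota> b" using h_R[of j] by auto
  have "h j ^ m * y \<in> Loc (hprod J)" if m: "m \<ge> n" for m
  proof -
    have "h j ^ m = h j ^ (m - n) * h j ^ n" using m by (simp add: power_add[symmetric])
    then have "h j ^ m * y = \<iota> (b [^]\<^bsub>R\<^esub> (m - n) \<otimes>\<^bsub>R\<^esub> r) / hprod J ^ n"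
      using r(1) b h_nz[of j] hprod_nz[of J] unfolding r(2)
      by (simp add: \<iota>_simps power_mult_distrib)
    then show ?thesis using LocI[OF hprod_nz] r b by simp
  qed
  then show ?thesis by blast
qed

text \<open>The kernel of the restriction to \<open>W\<close> is the Cech complex of
  \<open>W\<close> localized at \<open>h x\<close>. There the powers of the \<open>h j\<close>
  generate the unit ideal. For a cocycle \<open>c\<close>, the contraction at \<open>j\<close>
  gives a primitive of \<open>h j ^ N * c\<close> once \<open>N\<close> is large enough for its
  values to lie in the right localizations; a partition of unity glues these primitives.\<close>

lemma relative_exact:
  assumes c: "c \<in> Cech V (Suc k)" "restr W c = 0" "delta V c = 0"
  shows "\<exists>l\<in>Cech V k. restr W l = 0 \<and> delta V l = c"
proof -
  have c0: "c J = 0" if "J \<subseteq> W" for J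
    using fun_cong[OF c(2), of J] that by (simp add: restr_def)
  have "\<exists>n. \<forall>m\<ge>n. h j ^ m * c (insert j J) \<in> Loc (hprod J)" if "J \<in> Pow V" "j \<in> W" for J j
  proof (cases "j \<in> J")
    case True
    have "h j ^ m * c (insert j J) \<in> Loc (hprod J)" for m
    proof -
      obtain b where b: "b \<in> carrier R" "h j = \<iota> b" using h_R[of j] by auto
      have "h j ^ m \<in> Loc (hprod J)" using Loc_\<iota>[OF hprod_nz, of "b [^]\<^bsub>R\<^esub> m"] b by (simp add: \<iota>_pow)
      then show ?thesis using Cech_Loc[OF c(1), of J] True by (simp add: insert_absorb Loc_mult)
    qed
    then show ?thesis by blast
  next
    case False
    then show ?thesis using that finV Cech_Loc[OF c(1)] by (intro Loc_h_power) (auto dest: finite_subset)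
  qed
  then obtain n where n: "\<And>J j m. J \<in> Pow V \<Longrightarrow> j \<in> W \<Longrightarrow> m \<ge> n J j \<Longrightarrow> h j ^ m * c (insert j J) \<in> Loc (hprod J)"
    by metis
  \<comment> \<open>a common exponent that clears the denominators of all contractions \<open>contraction j c\<close>\<close>
  define N where "N = (\<Sum>J\<in>Pow V. \<Sum>j\<in>W. n J j)"
  have nN: "n J j \<le> N" if "J \<in> Pow V" "j \<in> W" for J j
  proof -
    have "n J j \<le> (\<Sum>j\<in>W. n J j)" using that finW by (intro member_le_sum) auto
    also have "\<dots> \<le> N" unfolding N_def using that finV by (intro member_le_sum) auto
    finally show ?thesis .
  qed
  have "\<exists>b. (\<forall>j\<in>W. b j \<in> Loc (h x)) \<and> (\<Sum>j\<in>W. b j * h j ^ Suc N) = 1"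
  proof (rule unit_ideal_powers[where a = "\<lambda>j. a j / h x"])
    show "1 \<in> Loc (h x)" using Loc_\<iota>[OF h_nz R.one_closed, of x] by (simp add: \<iota>_one)
    show "h j \<in> Loc (h x)" for j using h_R[of j] Loc_\<iota>[OF h_nz[of x]] by auto
    show "a j / h x \<in> Loc (h x)" if "j \<in> W" for j
      using Loc_divide_power[OF _ h_nz, of "a j" x 1] a[OF that] Loc_\<iota>[OF h_nz[of x]] by auto
    show "(\<Sum>j\<in>W. a j / h x * h j) = 1"
      using hx h_nz[of x] by (simp add: sum_divide_distrib[symmetric])
  qed (use finW Loc_add[OF h_R] Loc_mult in auto)
  then obtain b where b: "\<And>j. j \<in> W \<Longrightarrow> b j \<in> Loc (h x)" "(\<Sum>j\<in>W. b j * h j ^ Suc N) = 1" by blast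
  \<comment> \<open>a contracting homotopy, glued from those of the localizations at the single \<open>h j\<close>\<close>
  define l where "l = (\<lambda>J. \<Sum>j\<in>W. (b j * h j ^ Suc N) * contraction j c J)"
  have "l \<in> Cech V k"
  proof (rule CechI)
    fix J assume J: "J \<subseteq> V" "card J = k"
    then have fin: "finite J" using finV finite_subset by blast
    have "(b j * h j ^ Suc N) * contraction j c J \<in> Loc (hprod J)" if j: "j \<in> W" for j
    proof (cases "j \<in> J \<or> x \<notin> J")
      case True
      then have "contraction j c J = 0" using j J V c0[of "insert j J"] by (auto simp: contraction_def)
      then show ?thesis by (simp add: Loc_zero)
    next
      case False
      have 1: "b j \<in> Loc (hprod J)" using Loc_h_hprod[OF fin _ b(1)[OF j]] False by simp
      have 2: "h j ^ Suc N * c (insert j J) \<in> Loc (hprod J)"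
        using J by (intro n j) (auto intro: le_SucI nN j)
      have "(b j * h j ^ Suc N) * contraction j c J = csign j (insert j J) * (b j * (h j ^ Suc N * c (insert j J)))"
        using False by (simp add: contraction_def[of j c J] ac_simps)
      then show ?thesis using Loc_csign[OF Loc_mult[OF 1 2], of j "insert j J"] by (simp only:)
    qed
    then show "l J \<in> Loc (hprod J)" unfolding l_def by (intro Loc_sum hprod_R)
  next
    fix J assume J: "\<not> J \<subseteq> V \<or> card J \<noteq> k"
    have "contraction j c J = 0" if j: "j \<in> W" for j
    proof (cases "j \<in> J")
      case False
      have "c (insert j J) = 0"
      proof (cases "J \<subseteq> V")
        case True
        then have "finite J" using finV finite_subset by blast
        then show ?thesis using False J True by (intro CechD(2)[OF c(1)]) auto
      qed (auto intro!: CechD(2)[OF c(1)])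
      then show ?thesis by (simp add: contraction_def)
    qed (simp add: contraction_def)
    then show "l J = 0" by (simp add: l_def)
  qed
  moreover have "restr W l = 0"
  proof
    fix J
    have "contraction j c J = 0" if "J \<subseteq> W" "j \<in> W" for j
      using c0[of "insert j J"] that by (auto simp: contraction_def)
    then show "restr W l J = 0 J" by (simp add: restr_def l_def)
  qed
  moreover have "delta V l = c"
  proof
    fix J
    have "delta V l J = (\<Sum>j\<in>W. (b j * h j ^ Suc N) * delta V (contraction j c) J)"
      unfolding l_def by (rule delta_sum_scaled)
    also have "\<dots> = (\<Sum>j\<in>W. (b j * h j ^ Suc N) * c J)"
    proof (rule sum.cong)
      fix j assume j: "j \<in> W"
      have "delta V (contraction j c) J + contraction j (delta V c) J = c J"
        using finV j V CechD(2)[OF c(1)] by (intro delta_contraction) auto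
      then show "(b j * h j ^ Suc N) * delta V (contraction j c) J = (b j * h j ^ Suc N) * c J"
        unfolding c(3) by (cases "j \<in> J") (simp_all add: contraction_def)
    qed simp
    also have "\<dots> = c J" unfolding sum_distrib_right[symmetric] b(2) by simp
    finally show "delta V l J = c J" .
  qed
  ultimately show ?thesis by (intro bexI[of _ l] conjI)
qed

lemma relative_zero: "c \<in> Cech V 0 \<Longrightarrow> restr W c = 0 \<Longrightarrow> c = 0"
proof
  fix J assume c: "c \<in> Cech V 0" "restr W c = 0"
  show "c J = 0 J"
  proof (cases "J = {}")
    case True
    then show ?thesis using fun_cong[OF c(2), of J] by (simp add: restr_def)
  next
    case False
    then have "\<not> J \<subseteq> V \<or> card J \<noteq> 0" using finite_subset[OF _ finV, of J] by auto
    then show ?thesis using CechD(2)[OF c(1)] by simp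
  qed
qed

lemma restr_cocycles: "c \<in> cocycles V k \<Longrightarrow> restr W c \<in> cocycles W k"
  using restr_delta[OF WV, of c] by (auto simp: cocycles_def restr_Cech[OF WV] restr_simps)

lemma restr_coboundaries: "c \<in> coboundaries V k \<Longrightarrow> restr W c \<in> coboundaries W k"
  by (cases k) (auto simp: coboundaries_def restr_simps restr_delta[OF WV] restr_Cech[OF WV])

text \<open>Injectivity of the restriction map on cohomology: the difference of the cocycle and a
  coboundary lies in the kernel complex, which is exact.\<close>

lemma restr_injective:
  assumes "c \<in> cocycles V k" "restr W c \<in> coboundaries W k" shows "c \<in> coboundaries V k"
proof (cases k)
  case 0
  then show ?thesis using assms relative_zero by (auto simp: coboundaries_def cocycles_def)
next
  case (Suc m)
  obtain b where b: "b \<in> Cech W m" "restr W c = delta W b" using assms(2) by (auto simp: coboundaries_def Suc)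
  have bV: "b \<in> Cech V m" using b(1) by (rule Cech_mono[OF WV])
  have "c - delta V b \<in> Cech V (Suc m)"
    using assms(1) delta_Cech[OF finV bV] by (intro CechC(2)) (auto simp: cocycles_def Suc)
  moreover have "restr W (c - delta V b) = 0"
    using b by (simp add: restr_simps restr_delta[OF WV] restr_id)
  moreover have "delta V (c - delta V b) = 0"
    using assms(1) delta_delta[OF finV, of b] by (simp add: delta_diff cocycles_def)
  ultimately obtain l where l: "l \<in> Cech V m" "delta V l = c - delta V b"
    using relative_exact by blast
  have "c = delta V (l + b)" using l(2) by (simp add: delta_add)
  moreover have "l + b \<in> Cech V m" using l(1) bV by (rule CechC(4))
  ultimately show ?thesis by (simp add: coboundaries_def Suc)
qed

text \<open>Surjectivity of the restriction map, already on cocycles: extend by zero and correct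
  by a primitive of the coboundary, which lies in the kernel complex.\<close>

lemma restr_surjective:
  assumes "c \<in> cocycles W k" shows "\<exists>c'\<in>cocycles V k. restr W c' = c"
proof -
  have c: "c \<in> Cech W k" "delta W c = 0" using assms by (auto simp: cocycles_def)
  have cV: "c \<in> Cech V k" using c(1) by (rule Cech_mono[OF WV])
  have "restr W (delta V c) = 0" using c by (simp add: restr_delta[OF WV] restr_id)
  moreover have "delta V (delta V c) = 0" by (rule delta_delta[OF finV])
  ultimately obtain l where l: "l \<in> Cech V k" "restr W l = 0" "delta V l = delta V c"
    using relative_exact delta_Cech[OF finV cV] by blast
  have "c - l \<in> cocycles V k" using cV l by (simp add: cocycles_def CechC(2) delta_diff)
  moreover have "restr W (c - l) = c" using l c by (simp add: restr_simps restr_id)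
  ultimately show ?thesis by blast
qed

text \<open>Preimages under the surjective restriction map.\<close>

lemma bounded_cohomology_remove:
  assumes "bounded_cohomology V k" shows "bounded_cohomology W k"
  unfolding bounded_cohomology_def
proof (rule bounded_rank_pullback[OF assms[unfolded bounded_cohomology_def], where \<Phi> = "\<lambda>L. {c \<in> cocycles V k. restr W c \<in> L}"])
  fix L assume "L \<in> {L. stable_fun L \<and> coboundaries W k \<subseteq> L \<and> L \<subseteq> cocycles W k}"
  then have L: "stable_fun L" "coboundaries W k \<subseteq> L" by auto
  have "stable_fun {c \<in> cocycles V k. restr W c \<in> L}"
    using stable_funD[OF stable_cocycles[of V k]] stable_funD[OF L(1)]
    by (auto simp: stable_fun_def restr_simps)
  then show "{c \<in> cocycles V k. restr W c \<in> L} \<in> {L. stable_fun L \<and> coboundaries V k \<subseteq> L \<and> L \<subseteq> cocycles V k}"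
    using L(2) restr_coboundaries coboundaries_cocycles[OF finV] by blast
next
  fix U L assume *: "U \<in> {L. stable_fun L \<and> coboundaries W k \<subseteq> L \<and> L \<subseteq> cocycles W k}"
    "L \<in> {L. stable_fun L \<and> coboundaries W k \<subseteq> L \<and> L \<subseteq> cocycles W k}" "U \<subset> L"
  then obtain c where c: "c \<in> L" "c \<notin> U" "c \<in> cocycles W k" by blast
  then obtain c' where "c' \<in> cocycles V k" "restr W c' = c" using restr_surjective by blast
  then show "{c \<in> cocycles V k. restr W c \<in> U} \<subset> {c \<in> cocycles V k. restr W c \<in> L}" using * c by blast
qed

text \<open>Images under the restriction map, enlarged by the coboundaries; strictness is
  injectivity on cohomology.\<close>

lemma bounded_cohomology_insert:
  assumes "bounded_cohomology W k" shows "bounded_cohomology V k"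
  unfolding bounded_cohomology_def
proof (rule bounded_rank_pullback[OF assms[unfolded bounded_cohomology_def], where \<Phi> = "\<lambda>L. {restr W c + b | c b. c \<in> L \<and> b \<in> coboundaries W k}"])
  let ?\<Phi> = "\<lambda>L. {restr W c + b | c b. c \<in> L \<and> b \<in> coboundaries W k}"
  note B = stable_funD[OF stable_coboundaries[of W k]] and Z = stable_funD[OF stable_cocycles[of W k]]
  fix L assume "L \<in> {L. stable_fun L \<and> coboundaries V k \<subseteq> L \<and> L \<subseteq> cocycles V k}"
  then have L: "stable_fun L" "L \<subseteq> cocycles V k" by auto
  note L' = stable_funD[OF L(1)]
  have \<Phi>I: "restr W c + b \<in> ?\<Phi> L" if "c \<in> L" "b \<in> coboundaries W k" for c b using that by blast
  have "stable_fun (?\<Phi> L)"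
    unfolding stable_fun_def
  proof (intro conjI ballI)
    show "0 \<in> ?\<Phi> L" using \<Phi>I[OF L'(1) B(1)] by (simp only: restr_simps add_0_left)
  next
    fix y z assume "y \<in> ?\<Phi> L" "z \<in> ?\<Phi> L"
    then obtain c b c' b' where *: "c \<in> L" "b \<in> coboundaries W k" "c' \<in> L" "b' \<in> coboundaries W k"
      "y = restr W c + b" "z = restr W c' + b'" by blast
    then have "y - z = restr W (c - c') + (b - b')" by (simp add: restr_simps)
    then show "y - z \<in> ?\<Phi> L" using \<Phi>I[OF L'(2)[OF *(1,3)] B(2)[OF *(2,4)]] by (simp only:)
  next
    fix P y assume P: "P \<in> Dop" and "y \<in> ?\<Phi> L"
    then obtain c b where *: "c \<in> L" "b \<in> coboundaries W k" "y = restr W c + b" by blast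
    have "restr W c \<in> Cech W k"
      by (rule cocycles_Cech[OF restr_cocycles[OF subsetD[OF L(2) *(1)]]])
    moreover have "b \<in> Cech W k"
      by (rule cocycles_Cech[OF subsetD[OF coboundaries_cocycles[OF finW] *(2)]])
    ultimately have "act P y = restr W (act P c) + act P b" using * P by (simp add: act_add restr_simps)
    then show "act P y \<in> ?\<Phi> L" using \<Phi>I[OF L'(3)[OF P *(1)] B(3)[OF P *(2)]] by (simp only:)
  qed
  moreover have "coboundaries W k \<subseteq> ?\<Phi> L"
  proof
    fix b assume "b \<in> coboundaries W k"
    from \<Phi>I[OF L'(1) this] show "b \<in> ?\<Phi> L" by (simp only: restr_simps add_0_left)
  qed
  moreover have "?\<Phi> L \<subseteq> cocycles W k"
  proof
    fix y assume "y \<in> ?\<Phi> L"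
    then obtain c b where *: "c \<in> L" "b \<in> coboundaries W k" "y = restr W c + b"
      by (elim CollectE exE conjE) (rule that)
    show "y \<in> cocycles W k" unfolding *(3)
      by (rule Z(4)[OF restr_cocycles[OF subsetD[OF L(2) *(1)]] subsetD[OF coboundaries_cocycles[OF finW] *(2)]])
  qed
  ultimately show "?\<Phi> L \<in> {L. stable_fun L \<and> coboundaries W k \<subseteq> L \<and> L \<subseteq> cocycles W k}"
    by (intro CollectI conjI)
next
  let ?\<Phi> = "\<lambda>L. {restr W c + b | c b. c \<in> L \<and> b \<in> coboundaries W k}"
  fix U L assume U: "U \<in> {L. stable_fun L \<and> coboundaries V k \<subseteq> L \<and> L \<subseteq> cocycles V k}"
    and L: "L \<in> {L. stable_fun L \<and> coboundaries V k \<subseteq> L \<and> L \<subseteq> cocycles V k}" and UL: "U \<subset> L"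
  have sub: "?\<Phi> U \<subseteq> ?\<Phi> L" using UL by blast
  obtain c where c: "c \<in> L" "c \<notin> U" using UL by blast
  have "restr W c + 0 \<in> ?\<Phi> L"
    by (intro CollectI exI[of _ c] exI[of _ 0] conjI refl c stable_funD(1)[OF stable_coboundaries])
  moreover have "restr W c + 0 \<notin> ?\<Phi> U"
  proof
    assume "restr W c + 0 \<in> ?\<Phi> U"
    then obtain c' b where *: "c' \<in> U" "b \<in> coboundaries W k" "restr W c + 0 = restr W c' + b" by blast
    have "c - c' \<in> cocycles V k" using c L UL * by (intro stable_funD(2)[OF stable_cocycles]) auto
    moreover have "restr W (c - c') \<in> coboundaries W k" using * by (simp add: restr_simps)
    ultimately have "c - c' \<in> coboundaries V k" by (rule restr_injective)
    then have "(c - c') + c' \<in> U" using U * by (intro stable_funD(4)) auto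
    then show False using c by simp
  qed
  ultimately show "?\<Phi> U \<subset> ?\<Phi> L" using sub by (intro psubsetI) (rule sub, metis)
qed

end

lemma bounded_cohomology_of_Loc:
  assumes "finite V" "\<And>J. J \<subseteq> V \<Longrightarrow> bounded_rank {L. stable L \<and> L \<subseteq> Loc (hprod J)}"
  shows "bounded_cohomology V k"
  unfolding bounded_cohomology_def
proof (rule bounded_rank_subset)
  show "bounded_rank {L. stable_fun L \<and> L \<subseteq> Cech V k}"
    unfolding Cech_def by (rule bounded_rank_families) (use assms hprod_R in auto)
  show "{L. stable_fun L \<and> coboundaries V k \<subseteq> L \<and> L \<subseteq> cocycles V k} \<subseteq> {L. stable_fun L \<and> L \<subseteq> Cech V k}"
    by (auto simp: cocycles_def)
qed

end


section \<open>Localizations inside the field\<close>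

context embedded_algebra begin

text \<open>The value of the fraction \<open>r / f\<^sup>n\<close>, also for \<open>f = 0\<close>,
  where the localization is the zero ring.\<close>

definition frac_val :: "'a \<Rightarrow> 'a \<Rightarrow> nat \<Rightarrow> 'f" where
  "frac_val f r n = (if \<iota> f = 0 then 0 else \<iota> r / \<iota> f ^ n)"

text \<open>An equivalence class of fractions is recovered from its value; all comparisons below
  go through this injective map, whose image is \<open>Loc (\<iota> f)\<close>.\<close>

definition loc_val :: "'a \<Rightarrow> ('a \<times> nat) set \<Rightarrow> 'f" where
  "loc_val f U = (let p = (SOME p. p \<in> U) in frac_val f (fst p) (snd p))"

lemma loc_rel_iff:
  assumes "f \<in> carrier R"
  shows "((r, m), (s, n)) \<in> loc_rel R f \<longleftrightarrow> r \<in> carrier R \<and> s \<in> carrier R \<and> frac_val f r m = frac_val f s n"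
proof (cases "r \<in> carrier R \<and> s \<in> carrier R")
  case True
  have *: "f [^]\<^bsub>R\<^esub> k \<otimes>\<^bsub>R\<^esub> (f [^]\<^bsub>R\<^esub> n \<otimes>\<^bsub>R\<^esub> r) = f [^]\<^bsub>R\<^esub> k \<otimes>\<^bsub>R\<^esub> (f [^]\<^bsub>R\<^esub> m \<otimes>\<^bsub>R\<^esub> s) \<longleftrightarrow>
      \<iota> f ^ k * (\<iota> f ^ n * \<iota> r) = \<iota> f ^ k * (\<iota> f ^ m * \<iota> s)" for k :: nat
    using True assms by (subst \<iota>_eq_iff[symmetric]) (simp_all add: \<iota>_simps)
  show ?thesis
  proof (cases "\<iota> f = 0")
    case True
    then have "\<exists>k. \<iota> f ^ k * (\<iota> f ^ n * \<iota> r) = \<iota> f ^ k * (\<iota> f ^ m * \<iota> s)" by (intro exI[of _ 1]) simp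
    then show ?thesis using True by (simp add: loc_rel_def * frac_val_def)
  next
    case False
    then show ?thesis using True
      by (simp add: loc_rel_def * frac_val_def frac_eq_eq) (auto simp: ac_simps)
  qed
qed (auto simp: loc_rel_def)

lemma loc_frac_eq:
  assumes "f \<in> carrier R" "r \<in> carrier R"
  shows "loc_frac R f r n = {(s, m). s \<in> carrier R \<and> frac_val f s m = frac_val f r n}"
  using assms by (auto simp: loc_frac_def loc_rel_iff)

lemma loc_carrier: 
  assumes "f \<in> carrier R"
  shows "carrier (loc R f) = {loc_frac R f r n | r n. r \<in> carrier R}"
  by (auto simp: loc_def quotient_def loc_frac_def)

lemma loc_val_loc_frac:
  assumes "f \<in> carrier R" "r \<in> carrier R"
  shows "loc_val f (loc_frac R f r n) = frac_val f r n"
proof -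
  have "(SOME p. p \<in> loc_frac R f r n) \<in> loc_frac R f r n"
    by (rule someI[of _ "(r, n)"]) (use assms in \<open>simp add: loc_frac_eq\<close>)
  then show ?thesis using assms by (auto simp: loc_val_def loc_frac_eq Let_def)
qed

lemma loc_frac_eq_iff:
  assumes "f \<in> carrier R" "r \<in> carrier R" "s \<in> carrier R"
  shows "loc_frac R f r n = loc_frac R f s m \<longleftrightarrow> frac_val f r n = frac_val f s m"
proof
  assume "loc_frac R f r n = loc_frac R f s m"
  then have "loc_val f (loc_frac R f r n) = loc_val f (loc_frac R f s m)" by (rule arg_cong)
  then show "frac_val f r n = frac_val f s m" by (simp only: loc_val_loc_frac assms)
next
  assume "frac_val f r n = frac_val f s m"
  then show "loc_frac R f r n = loc_frac R f s m" by (simp only: loc_frac_eq assms)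
qed

lemma loc_val_inj: "f \<in> carrier R \<Longrightarrow> inj_on (loc_val f) (carrier (loc R f))"
proof (rule inj_onI)
  fix U W assume f: "f \<in> carrier R" and U: "U \<in> carrier (loc R f)" and W: "W \<in> carrier (loc R f)"
    and eq: "loc_val f U = loc_val f W"
  obtain r m where U: "r \<in> carrier R" "U = loc_frac R f r m" using U f by (auto simp: loc_carrier)
  obtain s n where W: "s \<in> carrier R" "W = loc_frac R f s n" using W f by (auto simp: loc_carrier)
  show "U = W" using eq unfolding U(2) W(2) by (simp only: loc_frac_eq_iff loc_val_loc_frac U W f)
qed

lemma frac_val_Loc: "f \<in> carrier R \<Longrightarrow> r \<in> carrier R \<Longrightarrow> frac_val f r n \<in> Loc (\<iota> f)"
  by (auto simp: frac_val_def Loc_zero LocI)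

lemma loc_val_image:
  assumes "f \<in> carrier R" shows "loc_val f ` carrier (loc R f) = Loc (\<iota> f)"
proof
  show "loc_val f ` carrier (loc R f) \<subseteq> Loc (\<iota> f)" using assms by (auto simp: loc_carrier loc_val_loc_frac frac_val_Loc)
  show "Loc (\<iota> f) \<subseteq> loc_val f ` carrier (loc R f)"
  proof
    fix x assume x: "x \<in> Loc (\<iota> f)"
    obtain r n where "r \<in> carrier R" "x = frac_val f r n"
    proof (cases "\<iota> f = 0")
      case True
      then show thesis using x that[of "\<zero>\<^bsub>R\<^esub>" 0] by (simp add: Loc_def frac_val_def)
    next
      case False
      then show thesis using LocE[OF x False] that by (metis frac_val_def)
    qed
    then show "x \<in> loc_val f ` carrier (loc R f)"
      using assms by (intro image_eqI[of _ _ "loc_frac R f r n"]) (auto simp: loc_val_loc_frac loc_carrier)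
  qed
qed

lemma frac_val_add:
  assumes "f \<in> carrier R" "r \<in> carrier R" "s \<in> carrier R"
  shows "frac_val f (f [^]\<^bsub>R\<^esub> n \<otimes>\<^bsub>R\<^esub> r \<oplus>\<^bsub>R\<^esub> f [^]\<^bsub>R\<^esub> m \<otimes>\<^bsub>R\<^esub> s) (m + n) = frac_val f r m + frac_val f s n"
  using assms by (simp add: frac_val_def \<iota>_simps add_frac_eq power_add ac_simps)

lemma loc_add:
  assumes "f \<in> carrier R" "U \<in> carrier (loc R f)" "W \<in> carrier (loc R f)"
  shows "U \<oplus>\<^bsub>loc R f\<^esub> W \<in> carrier (loc R f)" "loc_val f (U \<oplus>\<^bsub>loc R f\<^esub> W) = loc_val f U + loc_val f W"
proof -
  obtain r m where U: "r \<in> carrier R" "U = loc_frac R f r m" using assms by (auto simp: loc_carrier)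
  obtain s n where W: "s \<in> carrier R" "W = loc_frac R f s n" using assms by (auto simp: loc_carrier)
  let ?t = "\<lambda>r m s n. f [^]\<^bsub>R\<^esub> n \<otimes>\<^bsub>R\<^esub> r \<oplus>\<^bsub>R\<^esub> f [^]\<^bsub>R\<^esub> m \<otimes>\<^bsub>R\<^esub> s"
  have t: "?t r m s n \<in> carrier R" using U W assms by simp
  have "(case p of (r', m') \<Rightarrow> \<Union>(s', n')\<in>W. loc_frac R f (?t r' m' s' n') (m' + n')) = loc_frac R f (?t r m s n) (m + n)"
    if p: "p \<in> U" for p
  proof -
    obtain r' m' where p': "p = (r', m')" "r' \<in> carrier R" "frac_val f r' m' = frac_val f r m"
      using p U assms by (auto simp: loc_frac_eq)
    have "(case q of (s', n') \<Rightarrow> loc_frac R f (?t r' m' s' n') (m' + n')) = loc_frac R f (?t r m s n) (m + n)"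
      if q: "q \<in> W" for q
    proof -
      obtain s' n' where q': "q = (s', n')" "s' \<in> carrier R" "frac_val f s' n' = frac_val f s n"
        using q W assms by (auto simp: loc_frac_eq)
      have "loc_frac R f (?t r' m' s' n') (m' + n') = loc_frac R f (?t r m s n) (m + n)"
        using p' q' U(1) W(1) assms(1) by (subst loc_frac_eq_iff) (simp_all add: frac_val_add)
      then show ?thesis using q' by simp
    qed
    moreover have "W \<noteq> {}" using W assms by (auto simp: loc_frac_eq)
    ultimately show ?thesis unfolding p' prod.case by (intro SUP_eq_const)
  qed
  moreover have "U \<noteq> {}" using U assms by (auto simp: loc_frac_eq)
  ultimately have "(\<Union>p\<in>U. case p of (r', m') \<Rightarrow> \<Union>(s', n')\<in>W. loc_frac R f (?t r' m' s' n') (m' + n')) =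
      loc_frac R f (?t r m s n) (m + n)"
    by (intro SUP_eq_const)
  then have eq: "U \<oplus>\<^bsub>loc R f\<^esub> W = loc_frac R f (?t r m s n) (m + n)"
    by (simp add: loc_def)
  show "U \<oplus>\<^bsub>loc R f\<^esub> W \<in> carrier (loc R f)" unfolding eq loc_carrier[OF assms(1)] using t by blast
  show "loc_val f (U \<oplus>\<^bsub>loc R f\<^esub> W) = loc_val f U + loc_val f W"
    unfolding eq using U W t assms(1) by (simp add: loc_val_loc_frac frac_val_add)
qed

lemma loc_zero:
  assumes "f \<in> carrier R"
  shows "\<zero>\<^bsub>loc R f\<^esub> \<in> carrier (loc R f)" "loc_val f \<zero>\<^bsub>loc R f\<^esub> = 0"
proof -
  have z: "\<zero>\<^bsub>loc R f\<^esub> = loc_frac R f \<zero>\<^bsub>R\<^esub> 0" by (simp add: loc_def)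
  show "\<zero>\<^bsub>loc R f\<^esub> \<in> carrier (loc R f)" unfolding z loc_carrier[OF assms] by blast
  show "loc_val f \<zero>\<^bsub>loc R f\<^esub> = 0" unfolding z using assms by (simp add: loc_val_loc_frac frac_val_def \<iota>_zero)
qed

lemma loc_val_Loc: "f \<in> carrier R \<Longrightarrow> U \<in> carrier (loc R f) \<Longrightarrow> loc_val f U \<in> Loc (\<iota> f)"
  using loc_val_image[of f] by auto

lemma loc_val_neg_image:
  "f \<in> carrier R \<Longrightarrow> U \<in> carrier (loc R f) \<Longrightarrow> - loc_val f U \<in> loc_val f ` carrier (loc R f)"
  by (simp add: loc_val_image Loc_neg loc_val_Loc)

lemma loc_abelian_group: "f \<in> carrier R \<Longrightarrow> abelian_group (loc R f)"
  by (rule abelian_group_transport[OF loc_val_inj loc_add(1) loc_zero loc_add(2) loc_val_neg_image])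

lemma loc_val_a_inv:
  assumes "f \<in> carrier R" "U \<in> carrier (loc R f)"
  shows "loc_val f (\<ominus>\<^bsub>loc R f\<^esub> U) = - loc_val f U"
proof -
  interpret L: abelian_group "loc R f" by (rule loc_abelian_group[OF assms(1)])
  have "loc_val f (\<ominus>\<^bsub>loc R f\<^esub> U) + loc_val f U = loc_val f (\<ominus>\<^bsub>loc R f\<^esub> U \<oplus>\<^bsub>loc R f\<^esub> U)"
    by (rule loc_add(2)[symmetric]) (use assms in simp_all)
  also have "\<dots> = 0" using assms by (simp add: L.l_neg loc_zero)
  finally show ?thesis by (simp add: eq_neg_iff_add_eq_0)
qed

lemma loc_val_finsum:
  assumes "f \<in> carrier R" "finite J" "\<And>j. j \<in> J \<Longrightarrow> x j \<in> carrier (loc R f)"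
  shows "loc_val f (finsum (loc R f) x J) = (\<Sum>j\<in>J. loc_val f (x j))"
proof -
  interpret L: abelian_group "loc R f" by (rule loc_abelian_group[OF assms(1)])
  show ?thesis using assms(2,3)
  proof (induction J rule: finite_induct)
    case (insert j J)
    have "finsum (loc R f) x (insert j J) = x j \<oplus>\<^bsub>loc R f\<^esub> finsum (loc R f) x J"
      using insert.hyps insert.prems by (intro L.finsum_insert) auto
    then show ?case using insert assms(1) by (simp add: loc_add(2))
  qed (simp add: loc_zero assms(1))
qed

lemma loc_map:
  assumes "f \<in> carrier R" "g \<in> carrier R" "t \<in> carrier R" "\<iota> t = \<iota> f * \<iota> g" "U \<in> carrier (loc R f)"
  shows "loc_map R g t U \<in> carrier (loc R t)" "loc_val t (loc_map R g t U) = (if \<iota> t = 0 then 0 else loc_val f U)"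
proof -
  obtain r n where U: "r \<in> carrier R" "U = loc_frac R f r n" using assms by (auto simp: loc_carrier)
  have frt: "frac_val t (r \<otimes>\<^bsub>R\<^esub> g [^]\<^bsub>R\<^esub> n) n = (if \<iota> t = 0 then 0 else frac_val f r n)" if "r \<in> carrier R" for r n
    using that assms(1-4) by (auto simp: frac_val_def \<iota>_simps power_mult_distrib)
  have "(case p of (r', n') \<Rightarrow> loc_frac R t (r' \<otimes>\<^bsub>R\<^esub> g [^]\<^bsub>R\<^esub> n') n') = loc_frac R t (r \<otimes>\<^bsub>R\<^esub> g [^]\<^bsub>R\<^esub> n) n"
    if p: "p \<in> U" for p
  proof -
    obtain r' n' where p': "p = (r', n')" "r' \<in> carrier R" "frac_val f r' n' = frac_val f r n"
      using p U assms by (auto simp: loc_frac_eq)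
    have "loc_frac R t (r' \<otimes>\<^bsub>R\<^esub> g [^]\<^bsub>R\<^esub> n') n' = loc_frac R t (r \<otimes>\<^bsub>R\<^esub> g [^]\<^bsub>R\<^esub> n) n"
      using p' U(1) assms(2,3) by (subst loc_frac_eq_iff) (simp_all add: frt)
    then show ?thesis using p' by simp
  qed
  moreover have "U \<noteq> {}" using U assms by (auto simp: loc_frac_eq)
  ultimately have eq: "loc_map R g t U = loc_frac R t (r \<otimes>\<^bsub>R\<^esub> g [^]\<^bsub>R\<^esub> n) n"
    unfolding loc_map_def by (intro SUP_eq_const)
  show "loc_map R g t U \<in> carrier (loc R t)" unfolding eq loc_carrier[OF assms(3)]
    using U(1) assms(2) by blast
  show "loc_val t (loc_map R g t U) = (if \<iota> t = 0 then 0 else loc_val f U)"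
    unfolding eq using U assms(1-3) by (simp add: loc_val_loc_frac frt)
qed

definition loc_act :: "'a \<Rightarrow> ('a \<Rightarrow> 'a) \<Rightarrow> ('a \<times> nat) set \<Rightarrow> ('a \<times> nat) set" where
  "loc_act f = (\<lambda>P\<in>Dop. \<lambda>U\<in>carrier (loc R f). inv_into (carrier (loc R f)) (loc_val f) (ext P (loc_val f U)))"

lemma loc_val_Frac: "f \<in> carrier R \<Longrightarrow> U \<in> carrier (loc R f) \<Longrightarrow> loc_val f U \<in> Frac"
  using loc_val_Loc Loc_Frac by blast

lemma loc_act:
  assumes "f \<in> carrier R" "P \<in> Dop" "U \<in> carrier (loc R f)"
  shows "loc_act f P U \<in> carrier (loc R f)" "loc_val f (loc_act f P U) = ext P (loc_val f U)"
proof -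
  have "ext P (loc_val f U) \<in> loc_val f ` carrier (loc R f)"
    unfolding loc_val_image[OF assms(1)] by (rule ext_Loc[OF assms(2) _ loc_val_Loc[OF assms(1,3)]]) (use assms(1) in simp)
  from inv_into_into[OF this] f_inv_into_f[OF this]
  show "loc_act f P U \<in> carrier (loc R f)" "loc_val f (loc_act f P U) = ext P (loc_val f U)"
    using assms by (simp_all add: loc_act_def)
qed

lemma with_action_simps [simp]:
  "carrier (with_action M a) = carrier M" "\<zero>\<^bsub>with_action M a\<^esub> = \<zero>\<^bsub>M\<^esub>"
  "add (with_action M a) = add M" "module.smult (with_action M a) = a"
  by (simp_all add: with_action_def)

lemma loc_frac_carrier: "f \<in> carrier R \<Longrightarrow> r \<in> carrier R \<Longrightarrow> loc_frac R f r n \<in> carrier (loc R f)"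
  by (auto simp: loc_carrier)

lemma is_loc_action_loc_act:
  assumes f: "f \<in> carrier R" shows "is_loc_action K R f (loc_act f)"
proof -
  have 1: "left_module (diff_ring K R) (with_action (loc R f) (loc_act f))"
    by (rule left_module_transport[where \<phi> = "loc_val f" and T = ext])
      (simp_all add: ring_diff_ring loc_val_inj loc_add loc_zero loc_val_neg_image loc_act ext_add loc_val_Frac f
        diff_ring_simps ext_op_add ext_compose ext_mult_op \<iota>_one)
  have 2: "loc_act f (mult_op R r) (loc_frac R f s n) = loc_frac R f (r \<otimes>\<^bsub>R\<^esub> s) n"
    if "r \<in> carrier R" "s \<in> carrier R" for r s n
  proof (rule inj_onD[OF loc_val_inj[OF f]])
    have "frac_val f s n \<in> Frac" using frac_val_Loc[OF f that(2)] Loc_Frac f by blast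
    then show "loc_val f (loc_act f (mult_op R r) (loc_frac R f s n)) = loc_val f (loc_frac R f (r \<otimes>\<^bsub>R\<^esub> s) n)"
      using that f by (simp add: loc_act mult_op_diff_ring loc_frac_carrier loc_val_loc_frac ext_mult_op frac_val_def \<iota>_simps)
  qed (use that f in \<open>simp_all add: loc_act mult_op_diff_ring loc_frac_carrier\<close>)
  have 3: "loc_act f P (loc_frac R f r 0) = loc_frac R f (P r) 0"
    if "P \<in> Dop" "r \<in> carrier R" for P r
  proof (rule inj_onD[OF loc_val_inj[OF f]])
    show "loc_val f (loc_act f P (loc_frac R f r 0)) = loc_val f (loc_frac R f (P r) 0)"
      using that f by (simp add: loc_act loc_frac_carrier loc_val_loc_frac frac_val_def ext_\<iota> ext_zero diff_ringD)
  qed (use that f in \<open>simp_all add: loc_act loc_frac_carrier diff_ringD\<close>)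
  have 4: "loc_act f \<in> Dop \<rightarrow>\<^sub>E (carrier (loc R f) \<rightarrow>\<^sub>E carrier (loc R f))"
    using loc_act(1)[OF f] by (auto simp: loc_act_def PiE_def extensional_def)
  show ?thesis unfolding is_loc_action_def using 1 2 3 4 by blast
qed

text \<open>Compute \<open>P (s U)\<close> for \<open>U = r / s\<close>, \<open>s =
  f\<^sup>n\<close> in two ways, as the image of \<open>P r\<close> and as \<open>s (P U) + [P, s]
  U\<close>. This is the recursion that defines the extension to fractions, so induction on the
  order applies.\<close>

lemma is_loc_action_unique_aux:
  assumes f: "f \<in> carrier R" and act: "is_loc_action K R f a"
  shows "P \<in> D p \<Longrightarrow> U \<in> carrier (loc R f) \<Longrightarrow> loc_val f (a P U) = ext P (loc_val f U)"
proof (induction p arbitrary: P U)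
  case 0
  obtain b where b: "b \<in> carrier R" "P = mult_op R b" using 0 by auto
  obtain r n where U: "r \<in> carrier R" "U = loc_frac R f r n" using 0(2) f by (auto simp: loc_carrier)
  have "a P U = loc_frac R f (b \<otimes>\<^bsub>R\<^esub> r) n" using act b U by (simp add: is_loc_action_def)
  then show ?case using b U f loc_val_Frac[OF f 0(2)]
    by (simp add: loc_val_loc_frac ext_mult_op) (simp add: frac_val_def \<iota>_simps)
next
  case (Suc p)
  have P: "P \<in> Dop" unfolding diff_ring_carrier using Suc.prems(1) by (intro UN_I[of "Suc p"]) simp_all
  show ?case
  proof (cases "\<iota> f = 0")
    case True
    have z: "loc_val f W = 0" if "W \<in> carrier (loc R f)" for W
      using loc_val_Loc[OF f that] True by (simp add: Loc_def)
    have "a P U \<in> carrier (loc R f)" using act P Suc.prems(2) by (auto simp: is_loc_action_def PiE_iff)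
    then show ?thesis using z Suc.prems(2) ext_zero[OF P] by simp
  next
    case False
    interpret LM: left_module "diff_ring K R" "with_action (loc R f) a" using act by (simp add: is_loc_action_def)
    have acl: "a Q W \<in> carrier (loc R f)" if "Q \<in> Dop" "W \<in> carrier (loc R f)" for Q W
      using LM.smult_closed[of Q W] that by simp
    have amult: "loc_val f (a (mult_op R b) W) = \<iota> b * loc_val f W" if b: "b \<in> carrier R" and W: "W \<in> carrier (loc R f)" for b W
    proof -
      obtain r n where "r \<in> carrier R" "W = loc_frac R f r n" using W f by (auto simp: loc_carrier)
      then show ?thesis using act b f by (simp add: is_loc_action_def loc_val_loc_frac) (simp add: frac_val_def \<iota>_simps)
    qed
    obtain r n where U: "r \<in> carrier R" "U = loc_frac R f r n" using Suc.prems(2) f by (auto simp: loc_carrier)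
    let ?s = "f [^]\<^bsub>R\<^esub> n"
    have s: "?s \<in> carrier R" "\<iota> ?s = \<iota> f ^ n" "\<iota> ?s \<noteq> 0" using f False by (simp_all add: \<iota>_pow)
    let ?C = "commutator_op R P ?s"
    have C: "?C \<in> D p" using Suc.prems(1) s(1) by simp
    have C': "?C \<in> Dop" by (rule diff_ring_closed(4)[OF P s(1)])
    have M: "mult_op R ?s \<in> Dop" by (rule mult_op_diff_ring[OF s(1)])
    have eq: "compose (carrier R) P (mult_op R ?s) = op_add (compose (carrier R) (mult_op R ?s) P) ?C"
      by (rule operator_eqI)
        (use s(1) diff_ringD[OF P] in \<open>auto simp: compose_def mult_op_def op_add_def commutator_op_def \<iota>_simps\<close>)
    have "loc_frac R f (?s \<otimes>\<^bsub>R\<^esub> r) n = loc_frac R f r 0"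
      using f U(1) s False by (subst loc_frac_eq_iff) (simp_all add: frac_val_def \<iota>_mult)
    then have "a (mult_op R ?s) U = loc_frac R f r 0"
      using act s(1) U by (simp add: is_loc_action_def)
    then have "a P (a (mult_op R ?s) U) = loc_frac R f (P r) 0"
      using act P U(1) by (simp add: is_loc_action_def)
    moreover have "a P (a (mult_op R ?s) U) = a (mult_op R ?s) (a P U) \<oplus>\<^bsub>loc R f\<^esub> a ?C U"
      using LM.smult_assoc1[of P "mult_op R ?s" U] LM.smult_assoc1[of "mult_op R ?s" P U]
        LM.smult_l_distr[of "compose (carrier R) (mult_op R ?s) P" ?C U] P M C' Suc.prems(2) eq
      by (simp add: diff_ring_simps diff_ring_closed)
    ultimately have e: "loc_frac R f (P r) 0 = a (mult_op R ?s) (a P U) \<oplus>\<^bsub>loc R f\<^esub> a ?C U" by (rule trans[OF sym])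
    have "loc_val f (loc_frac R f (P r) 0) = \<iota> ?s * loc_val f (a P U) + loc_val f (a ?C U)"
      unfolding e loc_add(2)[OF f acl[OF M acl[OF P Suc.prems(2)]] acl[OF C' Suc.prems(2)]]
        amult[OF s(1) acl[OF P Suc.prems(2)]] ..
    moreover have "loc_val f (loc_frac R f (P r) 0) = \<iota> (P r)"
      using f False diff_ringD(1)[OF P U(1)] by (simp add: loc_val_loc_frac frac_val_def)
    ultimately have 1: "\<iota> (P r) = \<iota> ?s * loc_val f (a P U) + ext ?C (loc_val f U)"
      unfolding Suc.IH[OF C Suc.prems(2)] by simp
    have 2: "loc_val f U = \<iota> r / \<iota> ?s" using U f False s(2) by (simp add: loc_val_loc_frac frac_val_def)
    have "loc_val f (a P U) = (\<iota> (P r) - ext ?C (loc_val f U)) / \<iota> ?s" unfolding 1 using s(3) by simp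
    also have "\<dots> = ext P (loc_val f U)" unfolding 2 by (rule ext_divide[OF P U(1) s(1,3), symmetric])
    finally show ?thesis .
  qed
qed

lemma loc_action_eq:
  assumes f: "f \<in> carrier R" shows "loc_action K R f = loc_act f"
  unfolding loc_action_def
proof (rule the_equality)
  show "is_loc_action K R f (loc_act f)" by (rule is_loc_action_loc_act[OF f])
  fix a assume a: "is_loc_action K R f a"
  have a1: "a \<in> Dop \<rightarrow>\<^sub>E (carrier (loc R f) \<rightarrow>\<^sub>E carrier (loc R f))" using a by (simp add: is_loc_action_def)
  have b1: "loc_act f \<in> Dop \<rightarrow>\<^sub>E (carrier (loc R f) \<rightarrow>\<^sub>E carrier (loc R f))"
    using is_loc_action_loc_act[OF f] by (simp add: is_loc_action_def)
  show "a = loc_act f"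
  proof (rule PiE_ext[OF a1 b1])
    fix P assume P: "P \<in> Dop"
    show "a P = loc_act f P"
    proof (rule PiE_ext[OF PiE_mem[OF a1 P] PiE_mem[OF b1 P]])
      fix U assume U: "U \<in> carrier (loc R f)"
      obtain p where "P \<in> D p" using P unfolding diff_ring_carrier by (rule UN_E)
      then have "loc_val f (a P U) = loc_val f (loc_act f P U)"
        using is_loc_action_unique_aux[OF f a _ U] loc_act(2)[OF f P U] by simp
      then show "a P U = loc_act f P U"
        by (rule inj_onD[OF loc_val_inj[OF f]]) (use PiE_mem[OF PiE_mem[OF a1 P] U] loc_act(1)[OF f P U] in simp_all)
    qed
  qed
qed

lemma loc_action:
  assumes "f \<in> carrier R" "P \<in> Dop" "U \<in> carrier (loc R f)"
  shows "loc_action K R f P U \<in> carrier (loc R f)" "loc_val f (loc_action K R f P U) = ext P (loc_val f U)"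
  using loc_act[OF assms] by (simp_all add: loc_action_eq assms(1))

end


section \<open>Local cohomology modules\<close>

context cech_complex begin

context
  fixes fs :: "'a list" and V :: "nat set"
  assumes fs: "set fs \<subseteq> carrier R"
    and V: "V = {j. j < length fs \<and> fs ! j \<noteq> \<zero>\<^bsub>R\<^esub>}"
    and h: "\<And>j. j \<in> V \<Longrightarrow> h j = \<iota> (fs ! j)"
begin

lemma finite_V: "finite V" using V by simp

lemma nth_R: "j < length fs \<Longrightarrow> fs ! j \<in> carrier R" using fs by auto

lemma cech_prod_R: "J \<subseteq> {..<length fs} \<Longrightarrow> cech_prod R fs J \<in> carrier R"
  unfolding cech_prod_def by (rule R.finprod_closed) (auto simp: nth_R)

lemma \<iota>_cech_prod_aux:
  assumes "finite J" "J \<subseteq> {..<length fs}"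
  shows "\<iota> (cech_prod R fs J) = (\<Prod>j\<in>J. \<iota> (fs ! j))"
  using assms
proof (induction J rule: finite_induct)
  case (insert j J)
  have "cech_prod R fs (insert j J) = fs ! j \<otimes>\<^bsub>R\<^esub> cech_prod R fs J"
    unfolding cech_prod_def using insert.hyps insert.prems by (intro R.finprod_insert) (auto simp: nth_R)
  then show ?case using insert by (simp add: \<iota>_mult nth_R cech_prod_R)
qed (simp add: cech_prod_def \<iota>_one)

lemma \<iota>_cech_prod:
  assumes "J \<subseteq> {..<length fs}"
  shows "\<iota> (cech_prod R fs J) = (if J \<subseteq> V then hprod J else 0)"
proof -
  have fin: "finite J" using assms finite_subset by blast
  show ?thesis
  proof (cases "J \<subseteq> V")
    case True
    then show ?thesis unfolding \<iota>_cech_prod_aux[OF fin assms] hprod_def using h by (auto intro!: prod.cong)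
  next
    case False
    then obtain j where "j \<in> J" "j \<notin> V" by auto
    then have "\<iota> (fs ! j) = 0" using assms V by (auto simp: \<iota>_zero)
    then show ?thesis unfolding \<iota>_cech_prod_aux[OF fin assms] using False fin \<open>j \<in> J\<close> by auto
  qed
qed

lemma cech_prod_remove:
  assumes "J \<subseteq> {..<length fs}" "j \<in> J"
  shows "\<iota> (cech_prod R fs J) = \<iota> (cech_prod R fs (J - {j})) * \<iota> (fs ! j)"
proof -
  have fin: "finite J" using assms finite_subset by blast
  have "J - {j} \<subseteq> {..<length fs}" using assms by auto
  from \<iota>_cech_prod_aux[OF fin assms(1)] \<iota>_cech_prod_aux[OF _ this] show ?thesis
    using fin assms(2) by (simp add: prod.remove mult.commute)
qed

abbreviation ix :: "nat \<Rightarrow> nat set set" where "ix k \<equiv> cech_index fs k"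
abbreviation cp :: "nat set \<Rightarrow> 'a" where "cp J \<equiv> cech_prod R fs J"

lemma ixD: "J \<in> ix k \<Longrightarrow> J \<subseteq> {..<length fs}" by (simp add: cech_index_def)

lemma cp_R: "J \<in> ix k \<Longrightarrow> cp J \<in> carrier R" by (rule cech_prod_R[OF ixD])

text \<open>Cochains of the given complex as functions into the field. Index sets that contain a
  vanishing generator index zero rings, so nothing is lost by restricting to subsets of
  \<open>V\<close>.\<close>

definition cochain_val :: "nat \<Rightarrow> (nat set \<Rightarrow> ('a \<times> nat) set) \<Rightarrow> nat set \<Rightarrow> 'f" where
  "cochain_val k c J = (if J \<in> ix k then loc_val (cp J) (c J) else 0)"

abbreviation CM where "CM k \<equiv> cech_module K R fs k"

lemma CM_carrier: "carrier (CM k) = (\<Pi>\<^sub>E J\<in>ix k. carrier (loc R (cp J)))"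
  by (simp add: cech_module_def)

lemma CM_mem: "c \<in> carrier (CM k) \<Longrightarrow> J \<in> ix k \<Longrightarrow> c J \<in> carrier (loc R (cp J))"
  by (auto simp: CM_carrier)

lemma cochain_val_inj: "inj_on (cochain_val k) (carrier (CM k))"
proof (rule inj_onI)
  fix c c' assume c: "c \<in> carrier (CM k)" and c': "c' \<in> carrier (CM k)" and eq: "cochain_val k c = cochain_val k c'"
  show "c = c'"
  proof (rule PiE_ext[OF c[unfolded CM_carrier] c'[unfolded CM_carrier]])
    fix J assume J: "J \<in> ix k"
    have "loc_val (cp J) (c J) = loc_val (cp J) (c' J)" using fun_cong[OF eq, of J] J by (simp add: cochain_val_def)
    then show "c J = c' J" by (rule inj_onD[OF loc_val_inj[OF cp_R[OF J]]]) (use c c' J CM_mem in auto)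
  qed
qed

lemma Loc_cp: "J \<in> ix k \<Longrightarrow> Loc (\<iota> (cp J)) = (if J \<subseteq> V then Loc (hprod J) else {0})"
  using \<iota>_cech_prod[OF ixD] by (simp add: Loc_def)

lemma V_ix: "J \<subseteq> V \<Longrightarrow> J \<in> ix k \<longleftrightarrow> card J = k"
  using V by (auto simp: cech_index_def)

lemma cochain_val_Cech: "c \<in> carrier (CM k) \<Longrightarrow> cochain_val k c \<in> Cech V k"
proof (rule CechI)
  fix J assume c: "c \<in> carrier (CM k)" and J: "J \<subseteq> V" "card J = k"
  then have ix: "J \<in> ix k" by (simp add: V_ix)
  then show "cochain_val k c J \<in> Loc (hprod J)"
    using loc_val_Loc[OF cp_R[OF ix] CM_mem[OF c ix]] J Loc_cp[OF ix] by (simp add: cochain_val_def)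
next
  fix J assume c: "c \<in> carrier (CM k)" and J: "\<not> J \<subseteq> V \<or> card J \<noteq> k"
  show "cochain_val k c J = 0"
  proof (cases "J \<in> ix k")
    case True
    then have "\<not> J \<subseteq> V" using J V_ix by blast
    then show ?thesis using loc_val_Loc[OF cp_R[OF True] CM_mem[OF c True]] Loc_cp[OF True] True by (simp add: cochain_val_def)
  qed (simp add: cochain_val_def)
qed

lemma cochain_val_image: "cochain_val k ` carrier (CM k) = Cech V k"
proof
  show "cochain_val k ` carrier (CM k) \<subseteq> Cech V k" using cochain_val_Cech by auto
  show "Cech V k \<subseteq> cochain_val k ` carrier (CM k)"
  proof
    fix d assume d: "d \<in> Cech V k"
    have "\<exists>U. U \<in> carrier (loc R (cp J)) \<and> d J = loc_val (cp J) U" if "J \<in> ix k" for J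
    proof -
      have "d J \<in> Loc (\<iota> (cp J))"
        unfolding Loc_cp[OF that] using CechD(2)[OF d, of J] Cech_Loc[OF d, of J] by simp
      then show ?thesis unfolding loc_val_image[OF cp_R[OF that], symmetric] by (auto simp: image_iff)
    qed
    then have "\<forall>J\<in>ix k. \<exists>U. U \<in> carrier (loc R (cp J)) \<and> d J = loc_val (cp J) U" by (intro ballI)
    from bchoice[OF this] obtain c
      where c': "\<forall>J\<in>ix k. c J \<in> carrier (loc R (cp J)) \<and> d J = loc_val (cp J) (c J)" ..
    then have c: "J \<in> ix k \<Longrightarrow> c J \<in> carrier (loc R (cp J)) \<and> d J = loc_val (cp J) (c J)" for J by (rule bspec)
    have "d = cochain_val k (restrict c (ix k))"
    proof
      fix J show "d J = cochain_val k (restrict c (ix k)) J"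
      proof (cases "J \<in> ix k")
        case True
        then show ?thesis using c[OF True] by (simp add: cochain_val_def)
      next
        case False
        then have "d J = 0" using V_ix[of J k] by (intro CechD(2)[OF d]) blast
        then show ?thesis using False by (simp add: cochain_val_def)
      qed
    qed
    moreover have "restrict c (ix k) \<in> carrier (CM k)" using c by (auto simp: CM_carrier)
    ultimately show "d \<in> cochain_val k ` carrier (CM k)" by (rule image_eqI)
  qed
qed

lemma CM_add:
  assumes "c \<in> carrier (CM k)" "c' \<in> carrier (CM k)"
  shows "c \<oplus>\<^bsub>CM k\<^esub> c' \<in> carrier (CM k)" "cochain_val k (c \<oplus>\<^bsub>CM k\<^esub> c') = cochain_val k c + cochain_val k c'"
proof -
  have eq: "c \<oplus>\<^bsub>CM k\<^esub> c' = (\<lambda>J\<in>ix k. c J \<oplus>\<^bsub>loc R (cp J)\<^esub> c' J)" by (simp add: cech_module_def)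
  show "c \<oplus>\<^bsub>CM k\<^esub> c' \<in> carrier (CM k)"
    unfolding eq CM_carrier by (rule restrict_PiE_iff[THEN iffD2]) (use loc_add(1) cp_R CM_mem assms in blast)
  show "cochain_val k (c \<oplus>\<^bsub>CM k\<^esub> c') = cochain_val k c + cochain_val k c'"
  proof
    fix J show "cochain_val k (c \<oplus>\<^bsub>CM k\<^esub> c') J = (cochain_val k c + cochain_val k c') J"
      unfolding eq using loc_add(2)[OF cp_R CM_mem[OF assms(1)] CM_mem[OF assms(2)]] by (simp add: cochain_val_def)
  qed
qed

lemma CM_zero: "\<zero>\<^bsub>CM k\<^esub> \<in> carrier (CM k)" "cochain_val k \<zero>\<^bsub>CM k\<^esub> = 0"
  by (auto simp: cech_module_def loc_zero cp_R cochain_val_def fun_eq_iff)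

lemma CM_smult:
  assumes "P \<in> Dop" "c \<in> carrier (CM k)"
  shows "P \<odot>\<^bsub>CM k\<^esub> c \<in> carrier (CM k)" "cochain_val k (P \<odot>\<^bsub>CM k\<^esub> c) = act P (cochain_val k c)"
proof -
  have eq: "P \<odot>\<^bsub>CM k\<^esub> c = (\<lambda>J\<in>ix k. loc_action K R (cp J) P (c J))" by (simp add: cech_module_def)
  show "P \<odot>\<^bsub>CM k\<^esub> c \<in> carrier (CM k)"
    unfolding eq CM_carrier
    by (rule restrict_PiE_iff[THEN iffD2]) (use loc_action(1) cp_R CM_mem assms in blast)
  show "cochain_val k (P \<odot>\<^bsub>CM k\<^esub> c) = act P (cochain_val k c)"
  proof
    fix J show "cochain_val k (P \<odot>\<^bsub>CM k\<^esub> c) J = act P (cochain_val k c) J"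
      unfolding eq using loc_action(2)[OF cp_R assms(1) CM_mem[OF assms(2)]] ext_zero[OF assms(1)]
      by (simp add: cochain_val_def act_def)
  qed
qed

lemma cech_diff:
  assumes c: "c \<in> carrier (CM k)"
  shows "cech_diff R fs k c \<in> carrier (CM (Suc k))" "cochain_val (Suc k) (cech_diff R fs k c) = delta V (cochain_val k c)"
proof -
  define t where "t J j = (let x = loc_map R (fs ! j) (cp J) (c (J - {j}))
        in if even (card {i\<in>J. i < j}) then x else \<ominus>\<^bsub>loc R (cp J)\<^esub> x)" for J j
  have eq: "cech_diff R fs k c = (\<lambda>J\<in>ix (Suc k). \<Oplus>\<^bsub>loc R (cp J)\<^esub>j\<in>J. t J j)"
    by (simp add: cech_diff_def t_def)
  have t: "t J j \<in> carrier (loc R (cp J)) \<and>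
      loc_val (cp J) (t J j) = (if \<iota> (cp J) = 0 then 0 else csign j J * cochain_val k c (J - {j}))"
    if J: "J \<in> ix (Suc k)" and j: "j \<in> J" for J j
  proof -
    have Jk: "J - {j} \<in> ix k" and jl: "j < length fs" using J j by (auto simp: cech_index_def)
    interpret L: abelian_group "loc R (cp J)" by (rule loc_abelian_group[OF cp_R[OF J]])
    let ?x = "loc_map R (fs ! j) (cp J) (c (J - {j}))"
    have x: "?x \<in> carrier (loc R (cp J))" "loc_val (cp J) ?x = (if \<iota> (cp J) = 0 then 0 else loc_val (cp (J - {j})) (c (J - {j})))"
      using loc_map[OF cp_R[OF Jk] nth_R[OF jl] cp_R[OF J] cech_prod_remove[OF ixD[OF J] j] CM_mem[OF c Jk]] by simp_all
    have "loc_val (cp (J - {j})) (c (J - {j})) = cochain_val k c (J - {j})" using Jk by (simp add: cochain_val_def)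
    then show ?thesis using x cp_R[OF J]
      by (cases "even (card {i\<in>J. i < j})") (simp_all add: t_def Let_def csign_def loc_val_a_inv)
  qed
  show "cech_diff R fs k c \<in> carrier (CM (Suc k))"
    unfolding eq CM_carrier
  proof (rule restrict_PiE_iff[THEN iffD2], rule ballI)
    fix J assume J: "J \<in> ix (Suc k)"
    interpret L: abelian_group "loc R (cp J)" by (rule loc_abelian_group[OF cp_R[OF J]])
    show "(\<Oplus>\<^bsub>loc R (cp J)\<^esub>j\<in>J. t J j) \<in> carrier (loc R (cp J))"
      by (rule L.finsum_closed) (use t[OF J] in auto)
  qed
  show "cochain_val (Suc k) (cech_diff R fs k c) = delta V (cochain_val k c)"
  proof
    fix J
    show "cochain_val (Suc k) (cech_diff R fs k c) J = delta V (cochain_val k c) J"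
    proof (cases "J \<in> ix (Suc k)")
      case J: True
      have fin: "finite J" using ixD[OF J] finite_subset by blast
      have "cochain_val (Suc k) (cech_diff R fs k c) J = (\<Sum>j\<in>J. loc_val (cp J) (t J j))"
        unfolding eq using J t[OF J] fin cp_R[OF J] by (simp add: cochain_val_def loc_val_finsum)
      also have "\<dots> = (\<Sum>j\<in>J. if \<iota> (cp J) = 0 then 0 else csign j J * cochain_val k c (J - {j}))"
        by (rule sum.cong) (use t[OF J] in simp_all)
      also have "\<dots> = delta V (cochain_val k c) J"
        using \<iota>_cech_prod[OF ixD[OF J]] hprod_nz[of J] by (cases "J \<subseteq> V") (simp_all add: delta_def)
      finally show ?thesis .
    next
      case False
      have "delta V (cochain_val k c) J = 0"
        by (rule CechD(2)[OF delta_Cech[OF finite_V cochain_val_Cech[OF c]]]) (use False V_ix in blast)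
      then show ?thesis using False by (simp add: cochain_val_def)
    qed
  qed
qed

lemma cech_cocycles_iff: "cech_cocycles K R fs k = {c \<in> carrier (CM k). cochain_val k c \<in> cocycles V k}"
proof -
  have "cech_diff R fs k c = \<zero>\<^bsub>CM (Suc k)\<^esub> \<longleftrightarrow> delta V (cochain_val k c) = 0" if c: "c \<in> carrier (CM k)" for c
    using inj_on_eq_iff[OF cochain_val_inj cech_diff(1)[OF c] CM_zero(1)] cech_diff(2)[OF c] CM_zero(2)[of "Suc k"]
    by simp
  then show ?thesis unfolding cech_cocycles_def cocycles_def using cochain_val_Cech by blast
qed

lemma cochain_val_coboundaries: "cochain_val k ` cech_coboundaries K R fs k = coboundaries V k"
proof (cases k)
  case 0
  then show ?thesis using CM_zero(2)[of 0] by (simp add: cech_coboundaries_def coboundaries_def)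
next
  case (Suc m)
  have "cochain_val k ` cech_diff R fs m ` carrier (CM m) = (\<lambda>c. delta V (cochain_val m c)) ` carrier (CM m)"
    unfolding image_image Suc by (rule image_cong) (simp_all add: cech_diff(2))
  also have "\<dots> = delta V ` Cech V m" unfolding cochain_val_image[symmetric] image_image ..
  finally show ?thesis by (simp add: cech_coboundaries_def coboundaries_def Suc)
qed

lemma cech_coboundaries_subset: "cech_coboundaries K R fs k \<subseteq> cech_cocycles K R fs k"
proof
  fix c assume c: "c \<in> cech_coboundaries K R fs k"
  then have "cochain_val k c \<in> coboundaries V k" using cochain_val_coboundaries by blast
  then have "cochain_val k c \<in> cocycles V k" using coboundaries_cocycles[OF finite_V] by blast
  moreover have "c \<in> carrier (CM k)"
    using c CM_zero(1)[of 0] cech_diff(1) by (auto simp: cech_coboundaries_def split: nat.splits)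
  ultimately show "c \<in> cech_cocycles K R fs k" by (simp add: cech_cocycles_iff)
qed

text \<open>Taking values identifies the cocycles and coboundaries with those inside the field,
  compatibly with the operators. A submodule of the cocycles is carried to a stable
  subgroup.\<close>

lemma finite_length_local_cohomology:
  assumes "bounded_cohomology V k"
  shows "finite_length_module (diff_ring K R) (local_cohomology K R fs k)"
proof -
  let ?Z = "cech_cocycles K R fs k" and ?B = "cech_coboundaries K R fs k"
  let ?M = "(CM k)\<lparr>carrier := ?Z\<rparr>"
  have Zsub: "c \<in> ?Z \<Longrightarrow> c \<in> carrier (CM k)" for c by (simp add: cech_cocycles_iff)
  have Zphi: "cochain_val k ` ?Z = cocycles V k"
  proof
    show "cochain_val k ` ?Z \<subseteq> cocycles V k" by (auto simp: cech_cocycles_iff)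
    show "cocycles V k \<subseteq> cochain_val k ` ?Z"
    proof
      fix d assume d: "d \<in> cocycles V k"
      then have "d \<in> cochain_val k ` carrier (CM k)" unfolding cochain_val_image by (rule cocycles_Cech)
      then show "d \<in> cochain_val k ` ?Z" using d by (auto simp: cech_cocycles_iff)
    qed
  qed
  note Z = stable_funD[OF stable_cocycles[of V k]] and B = stable_funD[OF stable_coboundaries[of V k]]
  have phiZ: "cochain_val k c \<in> cocycles V k" if "c \<in> ?Z" for c using that by (simp add: cech_cocycles_iff)
  have Frac: "cochain_val k c J \<in> Frac" if "c \<in> ?Z" for c J
    using Cech_Frac[OF cochain_val_Cech[OF Zsub[OF that]]] .
  have neg: "- d \<in> S" if "stable_fun S" "d \<in> S" for S d
    using stable_funD(2)[OF that(1) stable_funD(1)[OF that(1)] that(2)] by simp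
  have inj: "inj_on (cochain_val k) ?Z" by (rule inj_on_subset[OF cochain_val_inj]) (use Zsub in blast)
  have M: "left_module (diff_ring K R) ?M"
  proof (rule left_module_transport[where \<phi> = "cochain_val k" and T = act])
    show "ring (diff_ring K R)" by (rule ring_diff_ring)
    show "inj_on (cochain_val k) (carrier ?M)" using inj by simp
    show "x \<oplus>\<^bsub>?M\<^esub> y \<in> carrier ?M" if "x \<in> carrier ?M" "y \<in> carrier ?M" for x y
      using that Z(4)[OF phiZ phiZ, of x y] by (simp add: cech_cocycles_iff CM_add)
    show "\<zero>\<^bsub>?M\<^esub> \<in> carrier ?M" using Z(1) by (simp add: cech_cocycles_iff CM_zero)
    show "cochain_val k \<zero>\<^bsub>?M\<^esub> = 0" by (simp add: CM_zero)
    show "cochain_val k (x \<oplus>\<^bsub>?M\<^esub> y) = cochain_val k x + cochain_val k y" if "x \<in> carrier ?M" "y \<in> carrier ?M" for x y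
      using that by (simp add: CM_add Zsub)
    show "- cochain_val k x \<in> cochain_val k ` carrier ?M" if "x \<in> carrier ?M" for x
      using neg[OF stable_cocycles phiZ] that Zphi by simp
    show "P \<odot>\<^bsub>?M\<^esub> x \<in> carrier ?M" if "P \<in> Dop" "x \<in> carrier ?M" for P x
      using that Z(3)[OF that(1) phiZ, of x] by (simp add: cech_cocycles_iff CM_smult)
    show "cochain_val k (P \<odot>\<^bsub>?M\<^esub> x) = act P (cochain_val k x)" if "P \<in> Dop" "x \<in> carrier ?M" for P x
      using that by (simp add: CM_smult Zsub)
    fix P Q x y assume P: "P \<in> Dop" and x: "x \<in> carrier ?M"
    show "act P (cochain_val k x + cochain_val k y) = act P (cochain_val k x) + act P (cochain_val k y)" if "y \<in> carrier ?M"
      by (rule act_add[OF P cochain_val_Cech[OF Zsub] cochain_val_Cech[OF Zsub]]) (use x that in simp_all)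
    show "act (P \<oplus>\<^bsub>diff_ring K R\<^esub> Q) (cochain_val k x) = act P (cochain_val k x) + act Q (cochain_val k x)" if "Q \<in> Dop"
      using P x that Frac[of x] by (simp add: diff_ring_simps act_def ext_op_add fun_eq_iff)
    show "act (P \<otimes>\<^bsub>diff_ring K R\<^esub> Q) (cochain_val k x) = act P (act Q (cochain_val k x))" if "Q \<in> Dop"
      using P x that Frac[of x] by (simp add: diff_ring_simps act_def ext_compose fun_eq_iff)
  next
    fix x assume x: "x \<in> carrier ?M"
    show "act \<one>\<^bsub>diff_ring K R\<^esub> (cochain_val k x) = cochain_val k x"
      using x Frac[of x] by (simp add: diff_ring_simps act_def ext_mult_op \<iota>_one fun_eq_iff)
  qed
  interpret M: left_module "diff_ring K R" ?M by (rule M)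
  have minv: "cochain_val k (inv\<^bsub>add_monoid ?M\<^esub> x) = - cochain_val k x" if x: "x \<in> ?Z" for x
  proof -
    have i: "\<ominus>\<^bsub>?M\<^esub> x \<in> ?Z" using M.M.a_inv_closed[of x] x by simp
    have "cochain_val k (\<ominus>\<^bsub>?M\<^esub> x) + cochain_val k x = cochain_val k (\<ominus>\<^bsub>?M\<^esub> x \<oplus>\<^bsub>?M\<^esub> x)"
      using CM_add(2)[OF Zsub[OF i] Zsub[OF x]] by simp
    also have "\<dots> = 0" using M.M.l_neg[of x] x by (simp add: CM_zero)
    finally show ?thesis by (simp add: a_inv_def eq_neg_iff_add_eq_0)
  qed
  have sub: "submodule L (diff_ring K R) ?M" if L: "L \<subseteq> ?Z" "stable_fun (cochain_val k ` L)" for L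
  proof -
    have mem: "x \<in> L" if "x \<in> ?Z" "cochain_val k x \<in> cochain_val k ` L" for x
      using that L(1) inj by (auto dest: inj_onD)
    note S = stable_funD[OF L(2)]
    show ?thesis
    proof (intro submodule.intro subgroup.intro submodule_axioms.intro)
      show "L \<subseteq> carrier (add_monoid ?M)" using L by simp
      show "x \<otimes>\<^bsub>add_monoid ?M\<^esub> y \<in> L" if "x \<in> L" "y \<in> L" for x y
      proof -
        have xy: "x \<in> ?Z" "y \<in> ?Z" using that L by auto
        have "x \<oplus>\<^bsub>?M\<^esub> y \<in> L"
          by (rule mem) (use M.M.a_closed[of x y] xy S(4)[of "cochain_val k x" "cochain_val k y"] that in \<open>simp_all add: CM_add Zsub\<close>)
        then show ?thesis by simp
      qed
      show "\<one>\<^bsub>add_monoid ?M\<^esub> \<in> L"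
        using mem[of "\<zero>\<^bsub>CM k\<^esub>"] M.M.zero_closed S(1) by (simp add: CM_zero)
      show "inv\<^bsub>add_monoid ?M\<^esub> x \<in> L" if "x \<in> L" for x
      proof (rule mem)
        have x: "x \<in> ?Z" using that L by auto
        show "inv\<^bsub>add_monoid ?M\<^esub> x \<in> ?Z" using M.M.a_inv_closed[of x] x by (simp add: a_inv_def)
        show "cochain_val k (inv\<^bsub>add_monoid ?M\<^esub> x) \<in> cochain_val k ` L" unfolding minv[OF x] using neg[OF L(2)] that by simp
      qed
      show "P \<odot>\<^bsub>?M\<^esub> x \<in> L" if "P \<in> Dop" "x \<in> L" for P x
      proof (rule mem)
        have x: "x \<in> ?Z" using that L by auto
        show "P \<odot>\<^bsub>?M\<^esub> x \<in> ?Z" using M.smult_closed[of P x] x that by simp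
        show "cochain_val k (P \<odot>\<^bsub>?M\<^esub> x) \<in> cochain_val k ` L" using S(3)[of P "cochain_val k x"] that x by (simp add: CM_smult Zsub)
      qed
    qed
  qed
  have "submodule ?B (diff_ring K R) ?M"
    by (rule sub[OF cech_coboundaries_subset]) (simp add: cochain_val_coboundaries stable_coboundaries)
  moreover have "bounded_rank {L. submodule L (diff_ring K R) ?M \<and> ?B \<subseteq> L}"
  proof (rule bounded_rank_pullback[OF assms[unfolded bounded_cohomology_def], where \<Phi> = "\<lambda>L. cochain_val k ` L"])
    fix L assume "L \<in> {L. submodule L (diff_ring K R) ?M \<and> ?B \<subseteq> L}"
    then have L: "submodule L (diff_ring K R) ?M" "?B \<subseteq> L" by simp_all
    interpret L: submodule L "diff_ring K R" ?M by (rule L(1))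
    have LZ: "L \<subseteq> ?Z" using L.subset by simp
    have "stable_fun (cochain_val k ` L)"
      unfolding stable_fun_def
    proof (intro conjI ballI)
      show "0 \<in> cochain_val k ` L" using L.one_closed by (intro image_eqI[of _ _ "\<zero>\<^bsub>CM k\<^esub>"]) (simp_all add: CM_zero)
    next
      fix u v assume "u \<in> cochain_val k ` L" "v \<in> cochain_val k ` L"
      then obtain x y where xy: "x \<in> L" "y \<in> L" "u = cochain_val k x" "v = cochain_val k y" by blast
      let ?y = "inv\<^bsub>add_monoid ?M\<^esub> y"
      have y: "?y \<in> L" by (rule L.m_inv_closed[OF xy(2)])
      have "u - v = cochain_val k (x \<oplus>\<^bsub>CM k\<^esub> ?y)"
        using xy y LZ minv[of y] CM_add(2)[of x k ?y] Zsub by (simp add: subset_eq)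
      moreover have "x \<oplus>\<^bsub>CM k\<^esub> ?y \<in> L" using L.m_closed[OF xy(1) y] by simp
      ultimately show "u - v \<in> cochain_val k ` L" by (rule image_eqI)
    next
      fix P u assume P: "P \<in> Dop" and "u \<in> cochain_val k ` L"
      then obtain x where x: "x \<in> L" "u = cochain_val k x" by blast
      have "act P u = cochain_val k (P \<odot>\<^bsub>CM k\<^esub> x)" using CM_smult(2)[OF P Zsub] x LZ by auto
      moreover have "P \<odot>\<^bsub>CM k\<^esub> x \<in> L" using L.smult_closed[OF P x(1)] by simp
      ultimately show "act P u \<in> cochain_val k ` L" by (rule image_eqI)
    qed
    moreover have "coboundaries V k \<subseteq> cochain_val k ` L" unfolding cochain_val_coboundaries[symmetric] using L(2) by blast
    moreover have "cochain_val k ` L \<subseteq> cocycles V k" unfolding Zphi[symmetric] using LZ by blast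
    ultimately show "cochain_val k ` L \<in> {L. stable_fun L \<and> coboundaries V k \<subseteq> L \<and> L \<subseteq> cocycles V k}" by simp
  next
    fix U L assume *: "U \<in> {L. submodule L (diff_ring K R) ?M \<and> ?B \<subseteq> L}"
      "L \<in> {L. submodule L (diff_ring K R) ?M \<and> ?B \<subseteq> L}" "U \<subset> L"
    have "U \<subseteq> ?Z" "L \<subseteq> ?Z" using * by (auto dest!: submodule.axioms(1) subgroup.subset)
    then show "cochain_val k ` U \<subset> cochain_val k ` L"
      using *(3) inj_on_image_eq_iff[OF inj, of U L] by blast
  qed
  ultimately show ?thesis unfolding local_cohomology_def by (rule finite_length_quot_module[OF M])
qed

end

end


section \<open>Down-closed sets of exponent vectors\<close>

text \<open>The translate of a coordinate orthant: coordinates in \<open>\<tau>\<close> are free,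
  the others are prescribed by \<open>c\<close>.\<close>

definition slab :: "('n \<Rightarrow> nat) \<Rightarrow> 'n set \<Rightarrow> ('n \<Rightarrow> nat) set" where
  "slab c \<tau> = {x. \<forall>j. j \<notin> \<tau> \<longrightarrow> x j = c j}"

text \<open>If the slab is not contained in \<open>\<Delta>\<close>, pick a point \<open>m\<close>
  of it outside \<open>\<Delta>\<close>. No point of \<open>\<Delta>\<close> dominates
  \<open>m\<close>, so \<open>\<Delta>\<close> meets the slab in finitely many slabs with one free
  coordinate less.\<close>

lemma down_closed_slabs:
  fixes \<Delta> :: "('n \<Rightarrow> nat) set"
  assumes down: "\<And>x y. x \<in> \<Delta> \<Longrightarrow> (\<And>j. y j \<le> x j) \<Longrightarrow> y \<in> \<Delta>"
    and "finite \<tau>"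
  shows "\<exists>F. finite F \<and> \<Delta> \<inter> slab c \<tau> = (\<Union>(c', \<tau>')\<in>F. slab c' \<tau>')"
  using assms(2)
proof (induction "card \<tau>" arbitrary: \<tau> c)
  case 0
  then have \<tau>: "\<tau> = {}" by simp
  then have "slab c \<tau> = {c}" by (auto simp: slab_def)
  then show ?case
    by (intro exI[of _ "if c \<in> \<Delta> then {(c, {})} else {}"]) (auto simp: \<tau>)
next
  case (Suc k)
  show ?case
  proof (cases "slab c \<tau> \<subseteq> \<Delta>")
    case True
    then have "\<Delta> \<inter> slab c \<tau> = (\<Union>(c', \<tau>')\<in>{(c, \<tau>)}. slab c' \<tau>')" by auto
    then show ?thesis by (intro exI[of _ "{(c, \<tau>)}"]) simp
  next
    case False
    then obtain m where m: "m \<in> slab c \<tau>" "m \<notin> \<Delta>" by auto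
    define I where "I = (SIGMA j:\<tau>. {..<m j})"
    have fin: "finite I" using Suc.prems by (simp add: I_def)
    have "\<exists>F. finite F \<and> \<Delta> \<inter> slab (c(j := i)) (\<tau> - {j}) = (\<Union>(c', \<tau>')\<in>F. slab c' \<tau>')"
      if "(j, i) \<in> I" for j i
      using that Suc.hyps(2) Suc.prems by (intro Suc.hyps(1)) (auto simp: I_def)
    then obtain F where F: "\<And>j i. (j, i) \<in> I \<Longrightarrow> finite (F j i)"
      "\<And>j i. (j, i) \<in> I \<Longrightarrow> \<Delta> \<inter> slab (c(j := i)) (\<tau> - {j}) = (\<Union>(c', \<tau>')\<in>F j i. slab c' \<tau>')"
      by metis
    have "\<Delta> \<inter> slab c \<tau> = (\<Union>(j, i)\<in>I. \<Delta> \<inter> slab (c(j := i)) (\<tau> - {j}))"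
    proof
      show "\<Delta> \<inter> slab c \<tau> \<subseteq> (\<Union>(j, i)\<in>I. \<Delta> \<inter> slab (c(j := i)) (\<tau> - {j}))"
      proof
        fix x assume x: "x \<in> \<Delta> \<inter> slab c \<tau>"
        \<comment> \<open>\<open>x\<close> cannot dominate \<open>m\<close>, so some free coordinate takes one of finitely many values\<close>
        have "\<not> (\<forall>j. m j \<le> x j)" using down[of x m] x m by blast
        then obtain j where j: "x j < m j" by (auto simp: not_le)
        have "j \<in> \<tau>"
        proof (rule ccontr)
          assume "j \<notin> \<tau>"
          then have "x j = c j" "m j = c j" using x m by (simp_all add: slab_def)
          then show False using j by simp
        qed
        then have "(j, x j) \<in> I" using j by (simp add: I_def)
        moreover have "x \<in> slab (c(j := x j)) (\<tau> - {j})" using x by (auto simp: slab_def)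
        ultimately show "x \<in> (\<Union>(j, i)\<in>I. \<Delta> \<inter> slab (c(j := i)) (\<tau> - {j}))" using x by blast
      qed
      have "slab (c(j := i)) (\<tau> - {j}) \<subseteq> slab c \<tau>" if "(j, i) \<in> I" for j i
        using that by (force simp: slab_def I_def)
      then show "(\<Union>(j, i)\<in>I. \<Delta> \<inter> slab (c(j := i)) (\<tau> - {j})) \<subseteq> \<Delta> \<inter> slab c \<tau>" by blast
    qed
    also have "\<dots> = (\<Union>(j, i)\<in>I. \<Union>(c', \<tau>')\<in>F j i. slab c' \<tau>')"
      by (rule SUP_cong) (use F(2) in \<open>simp_all add: case_prod_beta\<close>)
    also have "\<dots> = (\<Union>(c', \<tau>')\<in>(\<Union>(j, i)\<in>I. F j i). slab c' \<tau>')"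
      by (simp add: case_prod_beta)
    finally show ?thesis
      by (intro exI[of _ "\<Union>(j, i)\<in>I. F j i"] conjI) (use F(1) fin in auto)
  qed
qed


section \<open>Polynomial functions on the lattice\<close>

text \<open>Polynomial functions of degree at most \<open>n\<close>, described by vanishing
  iterated differences: this matches the recursive definition of the order of an operator, a
  commutator with \<open>t\<^sup>a\<close> being a difference in direction
  \<open>a\<close>.\<close>

primrec polyfun :: "nat \<Rightarrow> (int ^ 'd \<Rightarrow> 'k::field) set" where
  "polyfun 0 = {p. \<exists>c. \<forall>v. p v = c}"
| "polyfun (Suc n) = {p. \<forall>a. (\<lambda>v. p (v + a) - p v) \<in> polyfun n}"

lemma polyfun_SucI: "(\<And>a. (\<lambda>v. p (v + a) - p v) \<in> polyfun n) \<Longrightarrow> p \<in> polyfun (Suc n)"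
  by simp

lemma polyfun_const: "(\<lambda>_. c) \<in> polyfun n"
  by (induction n arbitrary: c) auto

lemma polyfun_Suc: "p \<in> polyfun n \<Longrightarrow> p \<in> polyfun (Suc n)"
proof (induction n arbitrary: p)
  case 0
  then obtain c where "\<forall>v. p v = c" by auto
  then show ?case by simp
next
  case (Suc n)
  have "(\<lambda>v. p (v + a) - p v) \<in> polyfun (Suc n)" for a
    by (rule Suc.IH) (use Suc.prems in simp)
  then show ?case by (rule polyfun_SucI)
qed

lemma polyfun_lincomb: "p \<in> polyfun n \<Longrightarrow> q \<in> polyfun n \<Longrightarrow> (\<lambda>v. b * p v + c * q v) \<in> polyfun n"
proof (induction n arbitrary: p q)
  case 0
  then obtain x y where "\<forall>v. p v = x" "\<forall>v. q v = y" by auto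
  then show ?case by simp
next
  case (Suc n)
  have "(\<lambda>v. b * (p (v + a) - p v) + c * (q (v + a) - q v)) \<in> polyfun n" for a
    using Suc by simp
  then show ?case by (simp add: algebra_simps)
qed

lemma polyfun_mult_affine:
  assumes l: "\<And>v a. l (v + a) = l v + k a"
  shows "p \<in> polyfun n \<Longrightarrow> (\<lambda>v. p v * l v) \<in> polyfun (Suc n)"
proof (induction n arbitrary: p)
  case 0
  then obtain c where "\<forall>v. p v = c" by auto
  then show ?case by (simp add: l distrib_left)
next
  case (Suc n)
  have "(\<lambda>v. p (v + a) * l (v + a) - p v * l v) \<in> polyfun (Suc n)" for a
  proof -
    let ?d = "\<lambda>v. p (v + a) - p v"
    have d: "?d \<in> polyfun n" using Suc.prems by simp
    have "(\<lambda>v. 1 * (?d v * l v) + 1 * (k a * p v + k a * ?d v)) \<in> polyfun (Suc n)"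
      by (intro polyfun_lincomb Suc.IH d Suc.prems polyfun_Suc[OF d])
    moreover have "(\<lambda>v. 1 * (?d v * l v) + 1 * (k a * p v + k a * ?d v)) = (\<lambda>v. p (v + a) * l (v + a) - p v * l v)"
      unfolding l by (simp add: fun_eq_iff algebra_simps)
    ultimately show ?thesis by (simp only:)
  qed
  then show ?case by (rule polyfun_SucI)
qed

lemma polyfun_prod_affine:
  assumes "finite F" "\<And>f v a. f \<in> F \<Longrightarrow> l f (v + a) = l f v + k f a"
  shows "(\<lambda>v. \<Prod>f\<in>F. l f v) \<in> polyfun (card F)"
  using assms
proof (induction F rule: finite_induct)
  case (insert f F)
  have "(\<lambda>v. (\<Prod>f\<in>F. l f v) * l f v) \<in> polyfun (Suc (card F))"
    by (rule polyfun_mult_affine[where k = "k f"]) (use insert in auto)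
  then show ?case using insert.hyps by (simp add: mult.commute del: polyfun.simps)
qed simp


section \<open>Signatures of lattice points\<close>

context
  fixes A :: "int ^ 'n ^ 'd"
begin

text \<open>The degree in the lattice of a monomial in the generators of the semigroup.\<close>

definition weight :: "('n \<Rightarrow> nat) \<Rightarrow> int ^ 'd" where
  "weight c = (\<Sum>j\<in>UNIV. int (c j) *s column j A)"

lemma weight_add: "weight (\<lambda>j. c j + c' j) = weight c + weight c'"
  by (simp add: weight_def vector_sadd_rdistrib sum.distrib)

lemma monoid_of_weight: "monoid_of A = range weight"
  by (auto simp: monoid_of_def weight_def)

lemma monoid_of_add: "a \<in> monoid_of A \<Longrightarrow> b \<in> monoid_of A \<Longrightarrow> a + b \<in> monoid_of A"
  by (auto simp: monoid_of_weight weight_add[symmetric])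

lemma monoid_of_zero: "0 \<in> monoid_of A"
  unfolding monoid_of_weight by (rule range_eqI[of _ _ "\<lambda>_. 0"]) (simp add: weight_def)

definition pairing :: "rat ^ 'd \<Rightarrow> int ^ 'd \<Rightarrow> rat" where
  "pairing \<xi> v = (\<Sum>i\<in>UNIV. \<xi> $ i * of_int (v $ i))"

lemma pairing_add: "pairing \<xi> (v + w) = pairing \<xi> v + pairing \<xi> w"
  by (simp add: pairing_def algebra_simps sum.distrib)

lemma pairing_diff: "pairing \<xi> (v - w) = pairing \<xi> v - pairing \<xi> w"
  by (simp add: pairing_def algebra_simps sum_subtractf)

lemma pairing_scale: "pairing \<xi> (z *s v) = of_int z * pairing \<xi> v"
  by (simp add: pairing_def sum_distrib_left algebra_simps)

lemma pairing_sum: "pairing \<xi> (\<Sum>j\<in>J. v j) = (\<Sum>j\<in>J. pairing \<xi> (v j))"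
  by (induction J rule: infinite_finite_induct) (simp_all add: pairing_add, simp_all add: pairing_def)

definition annihilator :: "'n set \<Rightarrow> (rat ^ 'd) set" where
  "annihilator \<tau> = {\<xi>. \<forall>j\<in>\<tau>. pairing \<xi> (column j A) = 0}"

text \<open>The lattice points of the rational span of the columns in \<open>\<tau>\<close>,
  described by the linear forms that vanish on them, since a linear form is what is needed to
  separate a point from the span.\<close>

definition saturation :: "'n set \<Rightarrow> (int ^ 'd) set" where
  "saturation \<tau> = {v. \<forall>\<xi>\<in>annihilator \<tau>. pairing \<xi> v = 0}"

definition rvec :: "int ^ 'd \<Rightarrow> rat ^ 'd" where
  "rvec v = (\<chi> i. of_int (v $ i))"

text \<open>A vector outside the span of the columns is separated from it by a linear form,
  because a basis of the span together with the vector is independent and a linear form may be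
  prescribed on it.\<close>

lemma saturation_rational_combination:
  assumes "v \<in> saturation \<tau>"
  shows "\<exists>q. rvec v = (\<Sum>j\<in>\<tau>. q j *s rvec (column j A))"
proof -
  let ?T = "rvec ` (\<lambda>j. column j A) ` \<tau>"
  let ?C = "{\<Sum>j\<in>\<tau>. q j *s rvec (column j A) | q. True}"
  interpret P: vector_space_pair "(*s) :: rat \<Rightarrow> rat ^ 'd \<Rightarrow> rat ^ 'd" "(*) :: rat \<Rightarrow> rat \<Rightarrow> rat" ..
  obtain B where B: "B \<subseteq> ?T" "vec.independent B" "?T \<subseteq> vec.span B"
    by (rule vec.maximal_independent_subset)
  have "rvec v \<in> vec.span B"
  proof (rule ccontr)
    assume nv: "rvec v \<notin> vec.span B"
    then have "vec.independent (insert (rvec v) B)" using B(2) by (rule vec.independent_insertI)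
    from P.linear_independent_extend[OF this, of "\<lambda>x. if x = rvec v then 1 else 0"]
    obtain g where g: "Vector_Spaces.linear (*s) (*) g"
      "\<forall>x\<in>insert (rvec v) B. g x = (if x = rvec v then 1 else 0)" by blast
    interpret g: Vector_Spaces.linear "(*s) :: rat \<Rightarrow> rat ^ 'd \<Rightarrow> rat ^ 'd" "(*) :: rat \<Rightarrow> rat \<Rightarrow> rat" g
      by (rule g(1))
    have gB: "g x = 0" if "x \<in> B" for x using g(2) that nv vec.span_base[of x B] by auto
    have g0: "g x = 0" if "x \<in> vec.span B" for x
      using that by (induction rule: vec.span_induct_alt) (simp_all add: g.zero g.add g.scale gB)
    define \<xi> :: "rat ^ 'd" where "\<xi> = (\<chi> i. g (axis i 1))"
    have pair: "pairing \<xi> w = g (rvec w)" for w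
    proof -
      have "rvec w = (\<Sum>i\<in>UNIV. rvec w $ i *s axis i 1)"
        by (rule basis_expansion[symmetric])
      then have "g (rvec w) = g (\<Sum>i\<in>UNIV. rvec w $ i *s axis i 1)" by simp
      also have "\<dots> = (\<Sum>i\<in>UNIV. rvec w $ i * g (axis i 1))"
        by (simp add: g.sum g.scale)
      also have "\<dots> = pairing \<xi> w" by (simp add: pairing_def \<xi>_def rvec_def mult.commute)
      finally show ?thesis by simp
    qed
    have "\<xi> \<in> annihilator \<tau>" using B(3) g0 by (auto simp: annihilator_def pair)
    then have "pairing \<xi> v = 0" using assms by (simp add: saturation_def)
    then show False using g(2) by (simp add: pair)
  qed
  moreover have "vec.span B \<subseteq> ?C"
  proof (rule vec.span_minimal)
    show "B \<subseteq> ?C"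
    proof
      fix x assume "x \<in> B"
      then obtain j where j: "j \<in> \<tau>" "x = rvec (column j A)" using B(1) by auto
      have "x = (\<Sum>i\<in>\<tau>. (if i = j then 1 else 0) *s rvec (column i A))"
        using j by (simp add: if_distrib[of "\<lambda>c. c *s _"] sum.delta cong: if_cong)
      then show "x \<in> ?C" by (intro CollectI exI[of _ "\<lambda>i. if i = j then 1 else 0"] conjI TrueI)
    qed
    show "vec.subspace ?C"
    proof (rule vec.subspaceI)
      have "0 = (\<Sum>j\<in>\<tau>. 0 *s rvec (column j A))" by simp
      then show "0 \<in> ?C" by (intro CollectI exI[of _ "\<lambda>_. 0"] conjI TrueI)
    next
      fix x y assume "x \<in> ?C" "y \<in> ?C"
      then obtain q r where "x = (\<Sum>j\<in>\<tau>. q j *s rvec (column j A))" "y = (\<Sum>j\<in>\<tau>. r j *s rvec (column j A))" by blast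
      then have "x + y = (\<Sum>j\<in>\<tau>. (q j + r j) *s rvec (column j A))"
        by (simp add: vector_sadd_rdistrib sum.distrib)
      then show "x + y \<in> ?C" by (intro CollectI exI[of _ "\<lambda>j. q j + r j"]) simp
    next
      fix c x assume "x \<in> ?C"
      then obtain q where "x = (\<Sum>j\<in>\<tau>. q j *s rvec (column j A))" by blast
      then have "c *s x = (\<Sum>j\<in>\<tau>. (c * q j) *s rvec (column j A))"
        by (simp add: vec.scale_sum_right)
      then show "c *s x \<in> ?C" by (intro CollectI exI[of _ "\<lambda>j. c * q j"]) simp
    qed
  qed
  ultimately show ?thesis by blast
qed

definition entry_bound :: int where "entry_bound = (\<Sum>i\<in>UNIV. \<Sum>j\<in>UNIV. \<bar>A $ i $ j\<bar>)"

text \<open>Large enough to contain all combinations of columns with coefficients between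
  \<open>0\<close> and \<open>1\<close>.\<close>

definition entry_box :: "(int ^ 'd) set" where "entry_box = {v. \<forall>i. v $ i \<in> {- entry_bound..entry_bound}}"

lemma finite_entry_box: "finite entry_box"
proof -
  have "finite (UNIV \<rightarrow>\<^sub>E {- entry_bound..entry_bound} :: ('d \<Rightarrow> int) set)" by (intro finite_PiE) simp_all
  moreover have "entry_box \<subseteq> vec_lambda ` (UNIV \<rightarrow>\<^sub>E {- entry_bound..entry_bound})"
  proof
    fix v assume "v \<in> entry_box"
    then show "v \<in> vec_lambda ` (UNIV \<rightarrow>\<^sub>E {- entry_bound..entry_bound})"
      by (intro image_eqI[of _ _ "\<lambda>i. v $ i"]) (auto simp: entry_box_def)
  qed
  ultimately show ?thesis by (rule finite_surj)
qed

definition zspan :: "'n set \<Rightarrow> (int ^ 'd) set" where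
  "zspan \<tau> = {\<Sum>j\<in>\<tau>. z j *s column j A | z. True}"

lemma zspan_saturation: "zspan \<tau> \<subseteq> saturation \<tau>"
  by (auto simp: zspan_def saturation_def pairing_sum pairing_scale annihilator_def)

lemma saturation_diff: "v \<in> saturation \<tau> \<Longrightarrow> w \<in> saturation \<tau> \<Longrightarrow> v - w \<in> saturation \<tau>"
  by (auto simp: saturation_def pairing_diff)

lemma saturation_entry_box:
  assumes "v \<in> saturation \<tau>"
  shows "\<exists>z\<in>zspan \<tau>. v - z \<in> entry_box"
proof -
  obtain q where q: "rvec v = (\<Sum>j\<in>\<tau>. q j *s rvec (column j A))"
    using saturation_rational_combination[OF assms] by blast
  \<comment> \<open>subtracting the integral parts leaves coefficients between \<open>0\<close> and \<open>1\<close>\<close>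
  let ?z = "\<Sum>j\<in>\<tau>. \<lfloor>q j\<rfloor> *s column j A"
  have "(v - ?z) $ i \<in> {- entry_bound..entry_bound}" for i
  proof -
    have fin: "finite \<tau>" by simp
    have "of_int (v $ i) = (rvec v) $ i" by (simp add: rvec_def)
    also have "\<dots> = (\<Sum>j\<in>\<tau>. q j * of_int (A $ i $ j))"
      unfolding q by (simp add: rvec_def column_def)
    finally have "of_int ((v - ?z) $ i) = (\<Sum>j\<in>\<tau>. frac (q j) * of_int (A $ i $ j))"
      by (simp add: column_def frac_def sum_subtractf left_diff_distrib)
    then have "\<bar>of_int ((v - ?z) $ i) :: rat\<bar> \<le> (\<Sum>j\<in>\<tau>. \<bar>frac (q j) * of_int (A $ i $ j)\<bar>)"
      by (simp add: sum_abs)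
    also have "\<dots> \<le> (\<Sum>j\<in>\<tau>. \<bar>of_int (A $ i $ j)\<bar>)"
    proof (rule sum_mono)
      fix j
      have "0 \<le> frac (q j)" "frac (q j) \<le> 1" by (simp_all add: frac_lt_1 less_imp_le)
      then show "\<bar>frac (q j) * of_int (A $ i $ j)\<bar> \<le> \<bar>of_int (A $ i $ j) :: rat\<bar>"
        by (simp add: abs_mult mult_left_le_one_le)
    qed
    also have "\<dots> = of_int (\<Sum>j\<in>\<tau>. \<bar>A $ i $ j\<bar>)" by simp
    finally have "\<bar>(v - ?z) $ i\<bar> \<le> (\<Sum>j\<in>\<tau>. \<bar>A $ i $ j\<bar>)" by linarith
    also have "\<dots> \<le> (\<Sum>j\<in>UNIV. \<bar>A $ i $ j\<bar>)" by (rule sum_mono2) auto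
    also have "\<dots> \<le> entry_bound" unfolding entry_bound_def by (rule member_le_sum) (auto intro: sum_nonneg)
    finally show ?thesis by (simp add: abs_le_iff)
  qed
  then have "v - ?z \<in> entry_box" by (simp add: entry_box_def)
  moreover have "?z \<in> zspan \<tau>" by (auto simp: zspan_def)
  ultimately show ?thesis by blast
qed

definition nspan :: "'n set \<Rightarrow> (int ^ 'd) set" where
  "nspan \<tau> = {weight c | c. \<forall>j. j \<notin> \<tau> \<longrightarrow> c j = 0}"

lemma nspanI: "(\<And>j. j \<notin> \<tau> \<Longrightarrow> c j = 0) \<Longrightarrow> weight c \<in> nspan \<tau>"
  by (auto simp: nspan_def)

lemma weight_supported: "(\<forall>j. j \<notin> \<tau> \<longrightarrow> c j = 0) \<Longrightarrow> weight c = (\<Sum>j\<in>\<tau>. int (c j) *s column j A)"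
  unfolding weight_def by (rule sum.mono_neutral_right) auto

lemma nspan_add: "v \<in> nspan \<tau> \<Longrightarrow> w \<in> nspan \<tau> \<Longrightarrow> v + w \<in> nspan \<tau>"
  unfolding nspan_def using weight_add by (smt (verit) add_0 mem_Collect_eq)

lemma nspan_monoid: "nspan \<tau> \<subseteq> monoid_of A"
  by (auto simp: nspan_def monoid_of_weight)

lemma nspan_zero: "0 \<in> nspan \<tau>"
  unfolding nspan_def by (intro CollectI exI[of _ "\<lambda>_. 0"]) (simp add: weight_def)

lemma nspan_saturation: "v \<in> nspan \<tau> \<Longrightarrow> v \<in> saturation \<tau>"
proof -
  assume "v \<in> nspan \<tau>"
  then have "v \<in> zspan \<tau>" by (auto simp: nspan_def zspan_def weight_supported)
  then show "v \<in> saturation \<tau>" using zspan_saturation by blast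
qed

lemma zspan_nspan:
  assumes "z \<in> zspan \<tau>" obtains p q where "p \<in> nspan \<tau>" "q \<in> nspan \<tau>" "z = p - q"
proof -
  obtain y where y: "z = (\<Sum>j\<in>\<tau>. y j *s column j A)" using assms by (auto simp: zspan_def)
  let ?p = "\<lambda>j. if j \<in> \<tau> then nat (y j) else 0" and ?q = "\<lambda>j. if j \<in> \<tau> then nat (- y j) else 0"
  have "weight ?p - weight ?q = (\<Sum>j\<in>\<tau>. (int (?p j) - int (?q j)) *s column j A)"
    by (subst (1 2) weight_supported[where \<tau> = \<tau>]) (simp_all add: vec_eq_iff left_diff_distrib sum_subtractf)
  also have "\<dots> = z" unfolding y by (rule sum.cong) auto
  finally have "z = weight ?p - weight ?q" by simp
  moreover have "weight ?p \<in> nspan \<tau>" "weight ?q \<in> nspan \<tau>" by (rule nspanI, simp)+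
  ultimately show thesis using that by blast
qed

text \<open>The semigroup enlarged by the negatives of the columns in
  \<open>\<tau>\<close>.\<close>

definition monoid_loc :: "'n set \<Rightarrow> (int ^ 'd) set" where
  "monoid_loc \<tau> = {v. \<exists>m\<in>nspan \<tau>. v + m \<in> monoid_of A}"

lemma monoid_monoid_loc: "v \<in> monoid_of A \<Longrightarrow> v \<in> monoid_loc \<tau>"
  using nspan_zero by (auto simp: monoid_loc_def intro!: bexI[of _ 0])

lemma monoid_loc_add:
  assumes "v \<in> monoid_loc \<tau>" "z \<in> zspan \<tau>" shows "v + z \<in> monoid_loc \<tau>"
proof -
  obtain m where m: "m \<in> nspan \<tau>" "v + m \<in> monoid_of A" using assms(1) by (auto simp: monoid_loc_def)
  obtain p q where pq: "p \<in> nspan \<tau>" "q \<in> nspan \<tau>" "z = p - q" using assms(2) by (rule zspan_nspan)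
  have "v + z + (m + q) = (v + m) + p" by (simp add: pq)
  also have "\<dots> \<in> monoid_of A" by (rule monoid_of_add[OF m(2) subsetD[OF nspan_monoid pq(1)]])
  finally show ?thesis unfolding monoid_loc_def
    by (intro CollectI bexI[of _ "m + q"] nspan_add[OF m(1) pq(2)])
qed

lemma zspan_neg: "z \<in> zspan \<tau> \<Longrightarrow> - z \<in> zspan \<tau>"
proof -
  assume "z \<in> zspan \<tau>"
  then obtain y where "z = (\<Sum>j\<in>\<tau>. y j *s column j A)" by (auto simp: zspan_def)
  then have "- z = (\<Sum>j\<in>\<tau>. (- y j) *s column j A)" by (simp add: vec_eq_iff sum_negf)
  then show "- z \<in> zspan \<tau>" unfolding zspan_def by (intro CollectI exI[of _ "\<lambda>j. - y j"]) simp
qed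

text \<open>The subset of the saturation of \<open>\<int>\<tau>\<close> that is translated by
  \<open>u\<close> into the enlarged semigroup is invariant under \<open>\<int>\<tau>\<close>, and
  the box meets every class modulo \<open>\<int>\<tau>\<close>. So the finite part in the box
  determines it.\<close>

definition signature :: "int ^ 'd \<Rightarrow> 'n set \<Rightarrow> (int ^ 'd) set" where
  "signature u \<tau> = {v \<in> entry_box. v \<in> saturation \<tau> \<and> u + v \<in> monoid_loc \<tau>}"

lemma finite_range_signature: "finite (range signature)"
proof (rule finite_subset)
  show "range signature \<subseteq> UNIV \<rightarrow>\<^sub>E Pow entry_box" by (auto simp: signature_def)
  show "finite (UNIV \<rightarrow>\<^sub>E Pow entry_box :: ('n set \<Rightarrow> (int ^ 'd) set) set)"
    by (intro finite_PiE) (simp_all add: finite_entry_box)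
qed

text \<open>If \<open>u\<close> lay on \<open>b + \<rat>\<tau>\<close>, then \<open>b - u\<close>,
  moved into the box by an element of \<open>\<int>\<tau>\<close>, would be a point of the signature of
  \<open>u\<close>, hence of the one of \<open>v\<close>. This puts \<open>b + (v - u)\<close> into
  the enlarged semigroup, so some translate of it by \<open>\<nat>\<tau>\<close> would lie in the
  semigroup.\<close>

lemma signature_eq_separated:
  assumes signature: "signature u = signature v"
    and piece: "\<And>y. y \<in> nspan \<tau> \<Longrightarrow> b + y + (v - u) \<notin> monoid_of A" and b: "b \<in> monoid_of A"
  shows "\<exists>\<xi>\<in>annihilator \<tau>. pairing \<xi> (u - b) \<noteq> 0"
proof (rule ccontr)
  assume "\<not> ?thesis"
  then have "b - u \<in> saturation \<tau>" by (auto simp: saturation_def pairing_diff)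
  then obtain z where z: "z \<in> zspan \<tau>" "b - u - z \<in> entry_box" using saturation_entry_box by blast
  have s: "b - u - z \<in> saturation \<tau>" by (rule saturation_diff[OF \<open>b - u \<in> saturation \<tau>\<close> subsetD[OF zspan_saturation z(1)]])
  have "u + (b - u - z) = b + (- z)" by simp
  also have "\<dots> \<in> monoid_loc \<tau>" by (rule monoid_loc_add[OF monoid_monoid_loc[OF b] zspan_neg[OF z(1)]])
  finally have "b - u - z \<in> signature u \<tau>" using z s by (simp add: signature_def)
  then have "v + (b - u - z) \<in> monoid_loc \<tau>" unfolding signature by (simp add: signature_def)
  from monoid_loc_add[OF this z(1)] have "b + (v - u) \<in> monoid_loc \<tau>" by (simp add: algebra_simps)
  then obtain y where "y \<in> nspan \<tau>" "b + (v - u) + y \<in> monoid_of A" by (auto simp: monoid_loc_def)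
  then show False using piece[of y] by (simp add: algebra_simps)
qed

text \<open>Decompose the points of the semigroup that \<open>v - u\<close> moves out of it into
  finitely many slabs, separate \<open>u\<close> from the affine hull of each of them, and
  multiply the separating affine functions.\<close>

lemma signature_eq_polyfun:
  assumes signature: "signature u = signature v"
  shows "\<exists>n (p :: int ^ 'd \<Rightarrow> 'k::field_char_0). p \<in> polyfun n \<and> p u \<noteq> 0 \<and>
    (\<forall>a\<in>monoid_of A. a + (v - u) \<notin> monoid_of A \<longrightarrow> p a = 0)"
proof -
  \<comment> \<open>the set \<open>\<Omega>(v - u)\<close>, pulled back to exponent vectors\<close>
  define \<Delta> where "\<Delta> = {x. weight x + (v - u) \<notin> monoid_of A}"
  have down: "y \<in> \<Delta>" if "x \<in> \<Delta>" and le: "\<And>j. y j \<le> x j" for x y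
  proof -
    have "x = (\<lambda>j. y j + (x j - y j))" using le by (simp add: fun_eq_iff)
    from arg_cong[OF this, of weight]
    have "weight x = weight y + weight (\<lambda>j. x j - y j)" by (simp only: weight_add)
    then have eq: "weight x + (v - u) = (weight y + (v - u)) + weight (\<lambda>j. x j - y j)" by simp
    show ?thesis unfolding \<Delta>_def mem_Collect_eq
    proof
      assume "weight y + (v - u) \<in> monoid_of A"
      then have "weight x + (v - u) \<in> monoid_of A"
        unfolding eq by (rule monoid_of_add) (simp add: monoid_of_weight)
      then show False using \<open>x \<in> \<Delta>\<close> by (simp add: \<Delta>_def)
    qed
  qed
  have "\<exists>F. finite F \<and> \<Delta> \<inter> slab (\<lambda>_. 0) UNIV = (\<Union>(c, \<tau>)\<in>F. slab c \<tau>)"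
  proof (rule down_closed_slabs)
    show "y \<in> \<Delta>" if "x \<in> \<Delta>" "\<And>j. y j \<le> x j" for x y using that by (rule down)
  qed simp
  then obtain F where F: "finite F" "\<Delta> \<inter> slab (\<lambda>_. 0) UNIV = (\<Union>(c, \<tau>)\<in>F. slab c \<tau>)"
    by (elim exE conjE)
  then have \<Delta>F: "\<Delta> = (\<Union>(c, \<tau>)\<in>F. slab c \<tau>)" by (simp add: slab_def)
  define base where "base c \<tau> = weight (\<lambda>j. if j \<in> \<tau> then 0 else c j)" for c and \<tau> :: "'n set"
  have sep: "\<exists>\<xi>\<in>annihilator \<tau>. pairing \<xi> (u - base c \<tau>) \<noteq> 0" if cF: "(c, \<tau>) \<in> F" for c \<tau>
  proof (rule signature_eq_separated[OF signature])
    show "base c \<tau> \<in> monoid_of A" by (simp add: base_def monoid_of_weight)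
    fix y assume "y \<in> nspan \<tau>"
    then obtain e where e: "y = weight e" "\<forall>j. j \<notin> \<tau> \<longrightarrow> e j = 0" by (auto simp: nspan_def)
    have "(\<lambda>j. (if j \<in> \<tau> then 0 else c j) + e j) \<in> slab c \<tau>" using e by (simp add: slab_def)
    then have "(\<lambda>j. (if j \<in> \<tau> then 0 else c j) + e j) \<in> \<Delta>" unfolding \<Delta>F using cF by blast
    then show "base c \<tau> + y + (v - u) \<notin> monoid_of A" by (simp add: \<Delta>_def weight_add base_def e)
  qed
  have "\<forall>f\<in>F. \<exists>\<xi>. \<xi> \<in> annihilator (snd f) \<and> pairing \<xi> (u - base (fst f) (snd f)) \<noteq> 0"
  proof
    fix f assume "f \<in> F"
    then have "(fst f, snd f) \<in> F" by simp
    from sep[OF this] show "\<exists>\<xi>. \<xi> \<in> annihilator (snd f) \<and> pairing \<xi> (u - base (fst f) (snd f)) \<noteq> 0" by blast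
  qed
  from bchoice[OF this] obtain L
    where L: "\<forall>f\<in>F. L f \<in> annihilator (snd f) \<and> pairing (L f) (u - base (fst f) (snd f)) \<noteq> 0" ..
  define p :: "int ^ 'd \<Rightarrow> 'k" where "p a = (\<Prod>f\<in>F. of_rat (pairing (L f) (a - base (fst f) (snd f))))" for a
  have "p \<in> polyfun (card F)"
    unfolding p_def
    by (rule polyfun_prod_affine[where k = "\<lambda>f a. of_rat (pairing (L f) a)", OF F(1)])
      (simp add: pairing_add pairing_diff of_rat_add[symmetric] algebra_simps del: of_rat_add)
  moreover have "p u \<noteq> 0" unfolding p_def using F(1) L by simp
  moreover have "p a = 0" if a: "a \<in> monoid_of A" "a + (v - u) \<notin> monoid_of A" for a
  proof -
    obtain x where x: "a = weight x" using a by (auto simp: monoid_of_weight)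
    then have "x \<in> \<Delta>" using a by (simp add: \<Delta>_def)
    then obtain c \<tau> where c: "(c, \<tau>) \<in> F" "x \<in> slab c \<tau>" unfolding \<Delta>F by blast
    let ?y = "\<lambda>j. if j \<in> \<tau> then x j else 0"
    have "x = (\<lambda>j. (if j \<in> \<tau> then 0 else c j) + ?y j)" using c(2) by (auto simp: slab_def)
    from arg_cong[OF this, of weight] have "weight x = base c \<tau> + weight ?y" by (simp only: weight_add base_def)
    moreover have "weight ?y \<in> nspan \<tau>" by (rule nspanI) simp
    ultimately have "a - base c \<tau> \<in> saturation \<tau>" using nspan_saturation x by simp
    moreover have "L (c, \<tau>) \<in> annihilator \<tau>" using bspec[OF L c(1)] by simp
    ultimately have "pairing (L (c, \<tau>)) (a - base c \<tau>) = 0" by (simp add: saturation_def)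
    then show ?thesis unfolding p_def using c(1) F(1) by (intro prod_zero) (auto intro!: bexI[of _ "(c, \<tau>)"])
  qed
  ultimately show ?thesis by blast
qed

end


section \<open>Laurent polynomials embed into a field\<close>

abbreviation "single \<equiv> Poly_Mapping.single"
abbreviation "lookup \<equiv> Poly_Mapping.lookup"
abbreviation "keys \<equiv> Poly_Mapping.keys"

lemma sum_single_keys: "(\<Sum>v\<in>keys f. single v (lookup f v)) = f"
proof (rule poly_mapping_eqI)
  fix u
  have "lookup (\<Sum>v\<in>keys f. single v (lookup f v)) u = (\<Sum>v\<in>keys f. if v = u then lookup f v else 0)"
    by (auto simp: lookup_sum lookup_single when_def intro!: sum.cong)
  then show "lookup (\<Sum>v\<in>keys f. single v (lookup f v)) u = lookup f u"
    by (simp add: in_keys_iff)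
qed

text \<open>An additive embedding of the lattice into an ordered group. It is what makes the
  Laurent polynomials a domain, because the product of leading terms does not cancel.\<close>

definition exponent :: "int ^ 'd \<Rightarrow> int poly" where
  "exponent v = (\<Sum>i\<in>UNIV. monom (v $ i) (to_nat_on UNIV i))"

lemma exponent_add: "exponent (v + w) = exponent v + exponent w"
  by (simp add: exponent_def add_monom[symmetric] sum.distrib)

lemma exponent_zero: "exponent 0 = 0"
  by (simp add: exponent_def)

lemma exponent_inject: "exponent v = exponent w \<longleftrightarrow> v = w"
proof
  have c: "coeff (exponent u) (to_nat_on UNIV i) = u $ i" for u :: "int ^ 'd" and i
  proof -
    have "inj (to_nat_on (UNIV :: 'd set))" by (simp add: countable_finite inj_on_to_nat_on)
    then have "coeff (exponent u) (to_nat_on UNIV i) = (\<Sum>j\<in>UNIV. if j = i then u $ j else 0)"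
      unfolding exponent_def coeff_sum by (intro sum.cong) (auto dest: injD)
    then show ?thesis by simp
  qed
  assume "exponent v = exponent w"
  then show "v = w" using c[of v] c[of w] by (simp add: vec_eq_iff)
qed simp

definition push :: "(int ^ 'd \<Rightarrow>\<^sub>0 'k::field) \<Rightarrow> (int poly \<Rightarrow>\<^sub>0 'k)" where
  "push f = (\<Sum>v\<in>keys f. single (exponent v) (lookup f v))"

lemma push_superset:
  "finite W \<Longrightarrow> keys f \<subseteq> W \<Longrightarrow> push f = (\<Sum>v\<in>W. single (exponent v) (lookup f v))"
  unfolding push_def by (rule sum.mono_neutral_left) (auto simp: in_keys_iff)

lemma push_single: "push (single v c) = single (exponent v) c"
  using push_superset[of "{v}" "single v c"] by simp

lemma push_add: "push (f + g) = push f + push g"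
proof -
  let ?W = "keys f \<union> keys g"
  have "finite ?W" "keys (f + g) \<subseteq> ?W" using keys_add[of f g] by auto
  from push_superset[OF this] push_superset[of ?W f] push_superset[of ?W g] show ?thesis
    by (simp add: lookup_add single_add sum.distrib)
qed

lemma push_sum: "push (\<Sum>j\<in>J. f j) = (\<Sum>j\<in>J. push (f j))"
  by (induction J rule: infinite_finite_induct) (simp_all add: push_add, simp_all add: push_def)

lemma push_mult: "push (f * g) = push f * push g"
proof -
  have "f * g = (\<Sum>v\<in>keys f. single v (lookup f v)) * (\<Sum>w\<in>keys g. single w (lookup g w))"
    by (simp only: sum_single_keys)
  also have "\<dots> = (\<Sum>v\<in>keys f. \<Sum>w\<in>keys g. single (v + w) (lookup f v * lookup g w))"
    by (simp add: sum_product mult_single)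
  finally have "push (f * g) = (\<Sum>v\<in>keys f. \<Sum>w\<in>keys g. single (exponent v + exponent w) (lookup f v * lookup g w))"
    by (simp add: push_sum push_single exponent_add)
  also have "\<dots> = push f * push g" by (simp add: push_def sum_product mult_single)
  finally show ?thesis .
qed

lemma lookup_push: "lookup (push f) (exponent v) = lookup f v"
proof -
  have "lookup (push f) (exponent v) = (\<Sum>u\<in>keys f. if u = v then lookup f u else 0)"
    unfolding push_def by (auto simp: lookup_sum lookup_single when_def exponent_inject intro!: sum.cong)
  then show ?thesis by (simp add: in_keys_iff)
qed

definition emb :: "(int ^ 'd \<Rightarrow>\<^sub>0 'k::field) \<Rightarrow> (int poly \<Rightarrow>\<^sub>0 'k) fract" where
  "emb f = to_fract (push f)"

lemma emb_add: "emb (f + g) = emb f + emb g" by (simp add: emb_def push_add)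

lemma emb_mult: "emb (f * g) = emb f * emb g" by (simp add: emb_def push_mult)

lemma emb_one: "emb (1 :: int ^ 'd \<Rightarrow>\<^sub>0 'k::field) = 1"
  using push_single[of "0 :: int ^ 'd" "1 :: 'k"] by (simp add: emb_def exponent_zero)

lemma emb_inject: "emb f = emb g \<longleftrightarrow> f = g"
proof
  assume "emb f = emb g"
  then have "push f = push g" by (simp add: emb_def)
  then show "f = g" by (intro poly_mapping_eqI) (metis lookup_push)
qed simp

lemma emb_zero: "emb 0 = 0" by (simp add: emb_def push_def)

lemma emb_sum: "emb (\<Sum>j\<in>J. f j) = (\<Sum>j\<in>J. emb (f j))"
  by (induction J rule: infinite_finite_induct) (simp_all add: emb_add emb_zero)

lemma emb_eq_0_iff: "emb f = 0 \<longleftrightarrow> f = 0"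
  using emb_inject[of f 0] by (simp add: emb_zero)

lemma emb_single_nz: "c \<noteq> 0 \<Longrightarrow> emb (single v c) \<noteq> 0"
  by (metis emb_eq_0_iff lookup_single_eq lookup_zero)


section \<open>Weighted shifts of Laurent polynomials\<close>

text \<open>The operator \<open>t\<^sup>v \<mapsto> p(v) t\<^sup>v\<^sup>+\<^sup>w\<close>, that
  is, \<open>t\<^sup>w p(\<theta>)\<close> with the Euler operators
  \<open>\<theta>\<close>.\<close>

definition shift :: "int ^ 'd \<Rightarrow> (int ^ 'd \<Rightarrow> 'k) \<Rightarrow> (int ^ 'd \<Rightarrow>\<^sub>0 'k::field) \<Rightarrow> (int ^ 'd \<Rightarrow>\<^sub>0 'k)" where
  "shift w p f = (\<Sum>v\<in>keys f. single (v + w) (p v * lookup f v))"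

lemma lookup_shift: "lookup (shift w p f) u = p (u - w) * lookup f (u - w)"
proof -
  have "lookup (shift w p f) u = (\<Sum>v\<in>keys f. if v = u - w then p v * lookup f v else 0)"
    unfolding shift_def by (simp add: lookup_sum lookup_single when_def eq_diff_eq)
  then show ?thesis by (simp add: in_keys_iff)
qed

lemma single_mult: "single a c * f = shift a (\<lambda>_. c) f"
proof -
  have "single a c * f = single a c * (\<Sum>v\<in>keys f. single v (lookup f v))" by (simp only: sum_single_keys)
  also have "\<dots> = shift a (\<lambda>_. c) f" by (simp add: shift_def sum_distrib_left mult_single add.commute)
  finally show ?thesis .
qed

lemma shift_add: "shift w p (f + g) = shift w p f + shift w p g"
  by (rule poly_mapping_eqI) (simp add: lookup_shift lookup_add distrib_left)

lemma shift_scale: "shift w p (single 0 c * f) = single 0 c * shift w p f"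
  by (rule poly_mapping_eqI) (simp add: single_mult lookup_shift)

lemma shift_commutator:
  "shift w p (single a c * f) - single a c * shift w p f = shift (w + a) (\<lambda>v. c * (p (v + a) - p v)) f"
proof (rule poly_mapping_eqI)
  fix u
  have e: "u - (w + a) + a = u - w" "u - w - a = u - (w + a)" "u - a - w = u - (w + a)"
    by (simp_all add: algebra_simps)
  show "lookup (shift w p (single a c * f) - single a c * shift w p f) u =
      lookup (shift (w + a) (\<lambda>v. c * (p (v + a) - p v)) f) u"
    unfolding single_mult lookup_minus lookup_shift e by (simp add: algebra_simps)
qed

lemma shift_single: "shift w p (single v c) = single (v + w) (p v * c)"
  by (rule poly_mapping_eqI) (auto simp: lookup_shift lookup_single when_def)

lemma keys_shift: "u \<in> keys (shift w p f) \<Longrightarrow> u - w \<in> keys f \<and> p (u - w) \<noteq> 0"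
  by (auto simp: in_keys_iff lookup_shift)


section \<open>Toric algebras\<close>

text \<open>The second parameter only fixes the type of the coefficients.\<close>

locale toric =
  fixes A :: "int ^ 'n ^ 'd" and type_k :: "'k::field_char_0 itself"
begin

abbreviation S :: "(int ^ 'd) set" where "S \<equiv> monoid_of A"
abbreviation TA :: "('k, int ^ 'd \<Rightarrow>\<^sub>0 'k) module" where "TA \<equiv> toric_algebra A"
abbreviation TK :: "'k ring" where "TK \<equiv> ring_of_type_algebra"

lemma TA_simps:
  "carrier TA = {f. keys f \<subseteq> S}" "add TA = (+)" "monoid.mult TA = (*)" "\<one>\<^bsub>TA\<^esub> = 1" "\<zero>\<^bsub>TA\<^esub> = 0"
  "module.smult TA = (\<lambda>c f. single 0 c * f)"
  by (simp_all add: toric_algebra_def)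

lemma TK_simps:
  "carrier TK = UNIV" "add TK = (+)" "monoid.mult TK = (*)" "\<one>\<^bsub>TK\<^esub> = 1" "\<zero>\<^bsub>TK\<^esub> = 0"
  by (simp_all add: ring_of_type_algebra_def)

lemma TA_closed:
  assumes "f \<in> carrier TA" "g \<in> carrier TA"
  shows "f + g \<in> carrier TA" "f * g \<in> carrier TA" "- f \<in> carrier TA"
proof -
  show "f + g \<in> carrier TA" using assms keys_add[of f g] by (auto simp: TA_simps)
  show "f * g \<in> carrier TA" using assms keys_mult[of f g] by (fastforce simp: TA_simps intro: monoid_of_add)
  show "- f \<in> carrier TA" using assms by (simp add: TA_simps)
qed

lemma single_TA: "v \<in> S \<Longrightarrow> single v c \<in> carrier TA"
  by (simp add: TA_simps)

lemma cring_TA: "cring TA"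
proof (rule cringI)
  show "abelian_group TA"
  proof (rule abelian_groupI, goal_cases)
    case (6 x)
    then show ?case using TA_closed(3)[of x] by (auto simp: TA_simps(2-) intro!: bexI[of _ "- x"])
  qed (auto simp: TA_closed TA_simps(2-) ac_simps, simp_all add: TA_simps)
  show "comm_monoid TA"
    by (rule comm_monoidI) (auto simp: TA_closed TA_simps(2-) ac_simps, simp_all add: TA_simps monoid_of_zero)
qed (simp add: TA_simps(2-) algebra_simps)

lemma algebra_TA: "algebra TK TA"
proof -
  interpret TA: cring TA by (rule cring_TA)
  have TK: "cring TK" by (rule cring_from_type_algebra)
  have closed: "single 0 c * f \<in> carrier TA" if "f \<in> carrier TA" for c f
    by (rule TA_closed(2)[OF single_TA[OF monoid_of_zero] that])
  show ?thesis
  proof (intro algebra.intro module.intro module_axioms.intro algebra_axioms.intro TK cring_TA TA.abelian_group_axioms)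
    show "a \<odot>\<^bsub>TA\<^esub> x \<in> carrier TA" if "x \<in> carrier TA" for a x
      using closed[OF that] by (simp add: TA_simps(6))
  qed (simp_all add: TA_simps(2-) TK_simps single_add distrib_left distrib_right mult_single mult.assoc[symmetric])
qed

sublocale T: embedded_algebra TK TA emb
  by (rule embedded_algebra.intro[OF algebra_TA])
    (simp_all add: TA_simps(2-) emb_add emb_mult emb_one inj_on_def emb_inject)

text \<open>The condition under which the shift by \<open>w\<close> with weights \<open>p\<close>
  preserves the toric algebra.\<close>

definition admissible :: "int ^ 'd \<Rightarrow> (int ^ 'd \<Rightarrow> 'k) \<Rightarrow> bool" where
  "admissible w p \<longleftrightarrow> (\<forall>a\<in>S. a + w \<notin> S \<longrightarrow> p a = 0)"

lemma admissible_difference: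
  assumes "admissible w p" "a \<in> S" shows "admissible (w + a) (\<lambda>v. c * (p (v + a) - p v))"
  unfolding admissible_def
proof (intro ballI impI)
  fix b assume b: "b \<in> S" "b + (w + a) \<notin> S"
  have "b + w \<notin> S" using monoid_of_add[of "b + w" A a] b(2) assms(2) by (auto simp: add.assoc)
  then have "p b = 0" using assms(1) b(1) by (simp add: admissible_def)
  moreover have "p (b + a) = 0"
    using assms(1) monoid_of_add[OF b(1) assms(2)] b(2) by (simp add: admissible_def ac_simps)
  ultimately show "c * (p (b + a) - p b) = 0" by simp
qed

definition shift_op :: "int ^ 'd \<Rightarrow> (int ^ 'd \<Rightarrow> 'k) \<Rightarrow> (int ^ 'd \<Rightarrow>\<^sub>0 'k) \<Rightarrow> (int ^ 'd \<Rightarrow>\<^sub>0 'k)" where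
  "shift_op w p = restrict (shift w p) (carrier TA)"

lemma shift_closed:
  assumes "admissible w p" "f \<in> carrier TA" shows "shift w p f \<in> carrier TA"
proof -
  have "u \<in> S" if u: "u \<in> keys (shift w p f)" for u
  proof (rule ccontr)
    assume "u \<notin> S"
    have "u - w \<in> S" "p (u - w) \<noteq> 0" using keys_shift[OF u] assms(2) by (auto simp: TA_simps)
    then show False using assms(1) \<open>u \<notin> S\<close> by (auto simp: admissible_def)
  qed
  then show ?thesis by (auto simp: TA_simps)
qed

lemma shift_op_linear: "admissible w p \<Longrightarrow> shift_op w p \<in> linear_endos TK TA"
  by (rule T.linear_endosI)
    (simp_all add: shift_op_def shift_closed TA_closed TA_simps(2-) TK_simps shift_add shift_scale single_TA monoid_of_zero)

lemma shift_op_const_mult_op: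
  assumes "admissible w (\<lambda>_. c)"
  shows "single w c \<in> carrier TA" "shift_op w (\<lambda>_. c) = mult_op TA (single w c)"
proof -
  show "single w c \<in> carrier TA"
    using assms monoid_of_zero[of A] by (cases "c = 0") (auto simp: admissible_def TA_simps)
  show "shift_op w (\<lambda>_. c) = mult_op TA (single w c)"
    by (simp add: shift_op_def mult_op_def TA_simps(3) single_mult)
qed

lemma shift_op_commutator:
  assumes "admissible w p" "a \<in> S"
  shows "commutator_op TA (shift_op w p) (single a c) = shift_op (w + a) (\<lambda>v. c * (p (v + a) - p v))"
proof
  fix f
  interpret TA: cring TA by (rule cring_TA)
  show "commutator_op TA (shift_op w p) (single a c) f = shift_op (w + a) (\<lambda>v. c * (p (v + a) - p v)) f"
  proof (cases "f \<in> carrier TA")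
    case True
    have m: "x \<ominus>\<^bsub>TA\<^esub> y = x - y" if "x \<in> carrier TA" "y \<in> carrier TA" for x y
    proof -
      have "emb (x \<ominus>\<^bsub>TA\<^esub> y) = emb (x - y)"
        using T.\<iota>_minus[OF that] emb_add[of "x - y" y] by simp
      then show ?thesis by (simp add: emb_inject)
    qed
    have s: "single a c \<in> carrier TA" using assms(2) by (rule single_TA)
    show ?thesis
      using True s TA_closed(2)[OF s] shift_closed[OF assms(1)]
      by (simp add: commutator_op_def shift_op_def TA_simps(3) m shift_commutator)
  qed (simp add: commutator_op_def shift_op_def)
qed

lemma commutator_add_right:
  assumes "P \<in> linear_endos TK TA" "r \<in> carrier TA" "s \<in> carrier TA"
  shows "commutator_op TA P (r + s) = T.op_add (commutator_op TA P r) (commutator_op TA P s)"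
proof (rule T.operator_eqI)
  fix x assume x: "x \<in> carrier TA"
  have "P ((r \<otimes>\<^bsub>TA\<^esub> x) \<oplus>\<^bsub>TA\<^esub> (s \<otimes>\<^bsub>TA\<^esub> x)) = P (r \<otimes>\<^bsub>TA\<^esub> x) \<oplus>\<^bsub>TA\<^esub> P (s \<otimes>\<^bsub>TA\<^esub> x)"
    by (rule T.linear_endosD(2)[OF assms(1)]) (use assms x TA_closed in \<open>simp_all add: TA_simps(3)\<close>)
  then have e: "P (r * x + s * x) = P (r * x) + P (s * x)" by (simp only: TA_simps(2,3))
  have c: "emb (commutator_op TA P t x) = emb (P (t * x)) - emb t * emb (P x)" if "t \<in> carrier TA" for t
    using T.commutator_closed(3)[OF assms(1) that x] by (simp only: TA_simps(3))
  show "emb (commutator_op TA P (r + s) x) = emb (T.op_add (commutator_op TA P r) (commutator_op TA P s) x)"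
    using x by (simp add: T.op_add_def TA_simps(2) emb_add c assms(2,3) TA_closed(1)[OF assms(2,3)] distrib_right e)
qed (use assms TA_closed T.commutator_closed in \<open>auto simp: T.op_add_def TA_simps(2)\<close>)

text \<open>A commutator with a monomial is a shift whose weights are differences of
  \<open>p\<close>, so the order of the operator is bounded by the degree of \<open>p\<close>.
  Additivity reduces commutators with arbitrary elements to monomials.\<close>

lemma shift_op_diff_op: "p \<in> polyfun n \<Longrightarrow> admissible w p \<Longrightarrow> shift_op w p \<in> T.D n"
proof (induction n arbitrary: w p)
  case 0
  then obtain c where "p = (\<lambda>_. c)" by auto
  then show ?case using shift_op_const_mult_op[of w c] 0(2) by simp
next
  case (Suc n)
  have lin: "shift_op w p \<in> linear_endos TK TA" using Suc.prems(2) by (rule shift_op_linear)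
  have mono: "commutator_op TA (shift_op w p) (single a c) \<in> T.D n" if "a \<in> S" for a c
  proof -
    have "(\<lambda>v. c * (p (v + a) - p v) + 0 * (p (v + a) - p v)) \<in> polyfun n"
      using Suc.prems(1) by (intro polyfun_lincomb) simp_all
    then show ?thesis unfolding shift_op_commutator[OF Suc.prems(2) that]
      by (intro Suc.IH admissible_difference[OF Suc.prems(2) that]) simp
  qed
  have "commutator_op TA (shift_op w p) (\<Sum>v\<in>W. single v (c v)) \<in> T.D n \<and> (\<Sum>v\<in>W. single v (c v)) \<in> carrier TA"
    if "finite W" "W \<subseteq> S" for W c
    using that
  proof (induction W rule: finite_induct)
    case empty
    have "single 0 (0::'k) = (0 :: int ^ 'd \<Rightarrow>\<^sub>0 'k)" by simp
    then show ?case using mono[OF monoid_of_zero, of 0] by (simp add: TA_simps)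
  next
    case (insert a W)
    then have a: "single a (c a) \<in> carrier TA" by (intro single_TA) simp
    have W: "commutator_op TA (shift_op w p) (\<Sum>v\<in>W. single v (c v)) \<in> T.D n" "(\<Sum>v\<in>W. single v (c v)) \<in> carrier TA"
      using insert by auto
    have "commutator_op TA (shift_op w p) (single a (c a) + (\<Sum>v\<in>W. single v (c v))) \<in> T.D n"
      unfolding commutator_add_right[OF lin a W(2)]
      by (rule T.diff_ops_add[OF mono W(1)]) (use insert in simp)
    then show ?case using insert.hyps TA_closed(1)[OF a W(2)] by simp
  qed
  note comm = this
  have "commutator_op TA (shift_op w p) r \<in> T.D n" if "r \<in> carrier TA" for r
    using comm[of "keys r" "lookup r"] that by (simp add: sum_single_keys TA_simps(1))
  then show ?case using lin by simp
qed

lemma shift_op_Dop: "p \<in> polyfun n \<Longrightarrow> admissible w p \<Longrightarrow> shift_op w p \<in> T.Dop"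
  unfolding T.diff_ring_carrier by (rule UN_I[of n]) (simp_all add: shift_op_diff_op)

lemma emb_single_divide: "emb (single (a - s) c) = emb (single a c) / emb (single s 1)"
proof -
  have "emb (single (a - s) c) * emb (single s 1) = emb (single a c)"
    by (simp add: emb_mult[symmetric] mult_single)
  then show ?thesis by (metis emb_single_nz nonzero_mult_div_cancel_right zero_neq_one)
qed

lemma emb_single_Frac: "a \<in> S \<Longrightarrow> s \<in> S \<Longrightarrow> emb (single (a - s) c) \<in> T.Frac"
  unfolding emb_single_divide by (rule T.FracI) (simp_all add: single_TA emb_single_nz)

text \<open>The extension to fractions is given on Laurent monomials by the same formula; the
  recursion over the order of the operator turns into the telescoping \<open>p(a) - (p(a) - p(a -
  s)) = p(a - s)\<close>.\<close>

lemma ext_shift_op_single: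
  "p \<in> polyfun n \<Longrightarrow> admissible w p \<Longrightarrow> a \<in> S \<Longrightarrow> s \<in> S \<Longrightarrow>
    T.ext (shift_op w p) (emb (single (a - s) c)) = emb (single (a - s + w) (p (a - s) * c))"
proof (induction n arbitrary: w p)
  case 0
  then obtain x where x: "p = (\<lambda>_. x)" by auto
  show ?case
    using shift_op_const_mult_op[of w x] 0 unfolding x
    by (simp add: T.ext_mult_op emb_single_Frac emb_mult[symmetric] mult_single add.commute)
next
  case (Suc n)
  have P: "shift_op w p \<in> T.Dop" using Suc.prems(1,2) by (rule shift_op_Dop)
  let ?q = "\<lambda>v. 1 * (p (v + s) - p v)"
  have q: "?q \<in> polyfun n" using Suc.prems(1) by simp
  have aq: "admissible (w + s) ?q" using Suc.prems(2,4) by (rule admissible_difference)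
  have c: "commutator_op TA (shift_op w p) (single s 1) = shift_op (w + s) ?q"
    by (rule shift_op_commutator[OF Suc.prems(2,4)])
  have "T.ext (shift_op w p) (emb (single a c) / emb (single s 1)) =
      (emb (shift_op w p (single a c)) - T.ext (shift_op (w + s) ?q) (emb (single a c) / emb (single s 1))) / emb (single s 1)"
    unfolding c[symmetric] using Suc.prems
    by (intro T.ext_divide P single_TA) (simp_all add: emb_single_nz)
  also have "shift_op w p (single a c) = single (a + w) (p a * c)"
    using Suc.prems by (simp add: shift_op_def single_TA shift_single)
  also have "T.ext (shift_op (w + s) ?q) (emb (single a c) / emb (single s 1)) = emb (single (a + w) ((p a - p (a - s)) * c))"
    using Suc.IH[OF q aq Suc.prems(3,4)] by (simp add: emb_single_divide[symmetric])
  also have "emb (single (a + w) (p a * c)) - emb (single (a + w) ((p a - p (a - s)) * c)) = emb (single (a + w) (p (a - s) * c))"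
    using emb_add[of "single (a + w) ((p a - p (a - s)) * c)" "single (a + w) (p (a - s) * c)"]
    by (simp add: single_add[symmetric] left_diff_distrib)
  also have "emb (single (a + w) (p (a - s) * c)) / emb (single s 1) = emb (single (a - s + w) (p (a - s) * c))"
    by (simp add: emb_single_divide[symmetric] algebra_simps)
  finally show ?case by (simp add: emb_single_divide)
qed

definition monoid_diffs :: "(int ^ 'd) set" where "monoid_diffs = {a - s | a s. a \<in> S \<and> s \<in> S}"

lemma ext_shift_op_emb:
  assumes "p \<in> polyfun n" "admissible w p" "keys g \<subseteq> monoid_diffs"
  shows "T.ext (shift_op w p) (emb g) = emb (shift w p g)"
proof -
  have F: "emb (single v (lookup g v)) \<in> T.Frac" if "v \<in> keys g" for v
    using that assms(3) emb_single_Frac by (auto simp: monoid_diffs_def)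
  have "T.ext (shift_op w p) (emb g) = T.ext (shift_op w p) (\<Sum>v\<in>keys g. emb (single v (lookup g v)))"
    by (simp only: emb_sum[symmetric] sum_single_keys)
  also have "\<dots> = (\<Sum>v\<in>keys g. T.ext (shift_op w p) (emb (single v (lookup g v))))"
    by (rule T.ext_sum[OF shift_op_Dop[OF assms(1,2)] F])
  also have "\<dots> = (\<Sum>v\<in>keys g. emb (single (v + w) (p v * lookup g v)))"
  proof (rule sum.cong[OF refl])
    fix v assume "v \<in> keys g"
    then obtain a s where "v = a - s" "a \<in> S" "s \<in> S" using assms(3) by (auto simp: monoid_diffs_def)
    then show "T.ext (shift_op w p) (emb (single v (lookup g v))) = emb (single (v + w) (p v * lookup g v))"
      using ext_shift_op_single[OF assms(1,2), of a s] by simp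
  qed
  also have "\<dots> = emb (shift w p g)" by (simp add: shift_def emb_sum)
  finally show ?thesis .
qed

lemma emb_single_power: "emb (single b 1) ^ n = emb (single (int n *s b) 1)"
proof (induction n)
  case 0
  then show ?case by (simp add: emb_one)
next
  case (Suc n)
  have "b + int n *s b = int (Suc n) *s b" by (simp add: vec_eq_iff algebra_simps)
  then show ?case using Suc by (simp add: emb_mult[symmetric] mult_single)
qed

lemma monoid_of_multiple: "b \<in> S \<Longrightarrow> int n *s b \<in> S"
proof (induction n)
  case 0
  then show ?case using monoid_of_zero by simp
next
  case (Suc n)
  have "b + int n *s b = int (Suc n) *s b" by (simp add: vec_eq_iff algebra_simps)
  then show ?case using monoid_of_add[of b A "int n *s b"] Suc by simp
qed

lemma Loc_monomial:
  assumes "b \<in> S" "x \<in> T.Loc (emb (single b 1))"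
  shows "\<exists>g. x = emb g \<and> keys g \<subseteq> monoid_diffs"
proof -
  obtain r n where r: "r \<in> carrier TA" "x = emb r / emb (single b 1) ^ n"
    using T.LocE[OF assms(2) emb_single_nz] by auto
  let ?s = "int n *s b"
  let ?g = "single (- ?s) 1 * r"
  have s: "?s \<in> S" using assms(1) by (rule monoid_of_multiple)
  have "emb ?g * emb (single ?s 1) = emb (single (- ?s) 1 * single ?s 1) * emb r"
    by (simp only: emb_mult) (simp only: ac_simps)
  also have "\<dots> = emb r" by (simp add: mult_single emb_one)
  finally have e: "emb r = emb ?g * emb (single ?s 1)" by (rule sym)
  have "emb (single ?s 1 :: int ^ 'd \<Rightarrow>\<^sub>0 'k) \<noteq> 0" by (rule emb_single_nz) simp
  then have "x = emb ?g"
    unfolding r(2) emb_single_power e by (rule nonzero_mult_div_cancel_right)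
  moreover have "keys ?g \<subseteq> monoid_diffs"
  proof
    fix v assume "v \<in> keys ?g"
    then have "v + ?s \<in> keys r" using keys_shift[of v "- ?s" "\<lambda>_. 1" r] by (simp add: single_mult)
    then have "v + ?s \<in> S" using r(1) by (auto simp: TA_simps)
    moreover have "v = (v + ?s) - ?s" by simp
    ultimately show "v \<in> monoid_diffs" unfolding monoid_diffs_def using s by blast
  qed
  ultimately show ?thesis by blast
qed

lemma stable_add:
  assumes "T.stable L" "x \<in> L" "y \<in> L" shows "x + y \<in> L"
proof -
  have d: "\<And>x y. x \<in> L \<Longrightarrow> y \<in> L \<Longrightarrow> x - y \<in> L" and z: "0 \<in> L" using assms(1) by (auto simp: T.stable_def)
  show ?thesis using d[OF assms(2) d[OF z assms(3)]] by simp
qed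

lemma stable_ext: "T.stable L \<Longrightarrow> P \<in> T.Dop \<Longrightarrow> x \<in> L \<Longrightarrow> T.ext P x \<in> L"
  by (simp add: T.stable_def)

lemma stable_sum: "T.stable L \<Longrightarrow> (\<And>j. j \<in> J \<Longrightarrow> x j \<in> L) \<Longrightarrow> (\<Sum>j\<in>J. x j) \<in> L"
  by (induction J rule: infinite_finite_induct) (auto simp: stable_add T.stable_def)

lemma admissible_zero: "admissible 0 p" by (simp add: admissible_def)

text \<open>If there is another exponent \<open>u'\<close> in \<open>g\<close>, an Euler operator
  shifted by a constant removes the term at \<open>u'\<close> and keeps the one at
  \<open>u\<close>; here characteristic zero enters. A single term can be rescaled.\<close>

lemma stable_graded:
  assumes L: "T.stable L"
  shows "emb g \<in> L \<Longrightarrow> keys g \<subseteq> monoid_diffs \<Longrightarrow> u \<in> keys g \<Longrightarrow> emb (single u c) \<in> L"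
proof (induction "card (keys g)" arbitrary: g rule: less_induct)
  case less
  show ?case
  proof (cases "keys g = {u}")
    case True
    have g: "g = single u (lookup g u)" using sum_single_keys[of g] True by simp
    have "lookup g u \<noteq> 0" using less.prems(3) by (simp add: in_keys_iff)
    let ?p = "\<lambda>_::int ^ 'd. c / lookup g u"
    have p: "?p \<in> polyfun 0" by (rule polyfun_const)
    have "T.ext (shift_op 0 ?p) (emb g) \<in> L"
      by (rule stable_ext[OF L shift_op_Dop[OF p admissible_zero] less.prems(1)])
    also have "T.ext (shift_op 0 ?p) (emb g) = emb (shift 0 ?p g)"
      by (rule ext_shift_op_emb[OF p admissible_zero less.prems(2)])
    also have "shift 0 ?p g = single u c"
      using \<open>lookup g u \<noteq> 0\<close> by (subst g) (simp add: shift_single)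
    finally show ?thesis .
  next
    case False
    then obtain u' where u': "u' \<in> keys g" "u' \<noteq> u" using less.prems(3) by auto
    then obtain i where i: "u $ i \<noteq> u' $ i" by (metis vec_eq_iff)
    \<comment> \<open>a shifted Euler operator, which kills the term at \<open>u'\<close> and keeps the one at \<open>u\<close>\<close>
    let ?p = "\<lambda>v. of_int (v $ i - u' $ i) :: 'k"
    have p: "?p \<in> polyfun 1" by (simp add: exI[of _ "of_int (_ $ i)"])
    let ?g = "shift 0 ?p g"
    have "T.ext (shift_op 0 ?p) (emb g) \<in> L"
      by (rule stable_ext[OF L shift_op_Dop[OF p admissible_zero] less.prems(1)])
    then have gL: "emb ?g \<in> L" by (simp only: ext_shift_op_emb[OF p admissible_zero less.prems(2)])
    have k: "keys ?g \<subseteq> keys g - {u'}" using keys_shift[of _ 0 ?p g] by auto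
    have uk: "u \<in> keys ?g" using less.prems(3) i by (simp add: in_keys_iff lookup_shift)
    have "card (keys ?g) < card (keys g)"
      using k u'(1) by (intro psubset_card_mono) auto
    from less.hyps[OF this gL _ uk] show ?thesis using k less.prems(2) by blast
  qed
qed

text \<open>The polynomial function for the pair \<open>u\<close>, \<open>v\<close> yields an
  operator from \<open>t\<^sup>u\<close> to a nonzero multiple of
  \<open>t\<^sup>v\<close>.\<close>

lemma stable_signature:
  assumes L: "T.stable L" and signature: "signature A u = signature A v" and u: "u \<in> monoid_diffs" and uL: "emb (single u 1) \<in> L"
    and v: "v \<in> monoid_diffs"
  shows "emb (single v 1) \<in> L"
proof -
  obtain n and p :: "int ^ 'd \<Rightarrow> 'k" where p: "p \<in> polyfun n" "p u \<noteq> 0"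
    "\<forall>a\<in>S. a + (v - u) \<notin> S \<longrightarrow> p a = 0"
    using signature_eq_polyfun[OF signature, where 'k = 'k] by (elim exE conjE)
  have admissible: "admissible (v - u) p" using p(3) by (simp add: admissible_def)
  have "T.ext (shift_op (v - u) p) (emb (single u 1)) \<in> L"
    by (rule stable_ext[OF L shift_op_Dop[OF p(1) admissible] uL])
  also have "T.ext (shift_op (v - u) p) (emb (single u 1)) = emb (single v (p u))"
    using u by (subst ext_shift_op_emb[OF p(1) admissible]) (simp_all add: shift_single)
  finally show ?thesis
    by (rule stable_graded[OF L]) (use p(2) v in simp_all)
qed

text \<open>The rank of a submodule is the number of signatures of the exponents that occur in it.
  By \<open>stable_graded\<close> a larger submodule contains a further monomial, and by
  \<open>stable_signature\<close> its signature is new.\<close>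

lemma bounded_rank_Loc_monomial:
  assumes b: "b \<in> S"
  shows "bounded_rank {L. T.stable L \<and> L \<subseteq> T.Loc (emb (single b 1))}"
proof -
  let ?\<L> = "{L. T.stable L \<and> L \<subseteq> T.Loc (emb (single b 1))}"
  define cls where "cls L = {signature A u | u. u \<in> monoid_diffs \<and> emb (single u 1) \<in> L}"
    for L :: "(int poly \<Rightarrow>\<^sub>0 'k) fract set"
  have fin: "finite (cls L)" "card (cls L) \<le> card (range (signature A))" for L
  proof -
    have "cls L \<subseteq> range (signature A)" by (auto simp: cls_def)
    then show "finite (cls L)" "card (cls L) \<le> card (range (signature A))"
      using finite_range_signature by (auto intro: finite_subset card_mono)
  qed
  have "card (cls U) < card (cls W)" if U: "U \<in> ?\<L>" and W: "W \<in> ?\<L>" and UW: "U \<subset> W" for U W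
  proof (rule psubset_card_mono[OF fin(1)])
    have clsI: "signature A u \<in> cls L" if "u \<in> monoid_diffs" "emb (single u 1) \<in> L" for u L
      unfolding cls_def by (intro CollectI exI[of _ u] conjI refl that)
    have sub: "cls U \<subseteq> cls W"
    proof
      fix \<sigma> assume "\<sigma> \<in> cls U"
      then obtain u where "\<sigma> = signature A u" "u \<in> monoid_diffs" "emb (single u 1) \<in> U"
        unfolding cls_def by (elim CollectE exE conjE)
      then show "\<sigma> \<in> cls W" using clsI[of u W] UW by auto
    qed
    from psubset_imp_ex_mem[OF UW] obtain x where "x \<in> W - U" ..
    then have x: "x \<in> W" "x \<notin> U" by simp_all
    have Uo: "T.stable U" and Wo: "T.stable W" and WL: "W \<subseteq> T.Loc (emb (single b 1))"
      using U W by simp_all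
    have "x \<in> T.Loc (emb (single b 1))" using WL x(1) by (rule subsetD)
    from Loc_monomial[OF b this] obtain g where g: "x = emb g" "keys g \<subseteq> monoid_diffs" by (elim exE conjE)
    have "\<exists>u\<in>keys g. emb (single u 1) \<notin> U"
    proof (rule ccontr)
      assume no: "\<not> (\<exists>u\<in>keys g. emb (single u 1) \<notin> U)"
      have "emb (single u (lookup g u)) \<in> U" if u: "u \<in> keys g" for u
      proof (rule stable_graded[OF Uo])
        show "emb (single u 1) \<in> U" using no u by simp
        show "keys (single u (1::'k)) \<subseteq> monoid_diffs" using u g(2) by simp (rule subsetD)
        show "u \<in> keys (single u (1::'k))" by simp
      qed
      then have "(\<Sum>u\<in>keys g. emb (single u (lookup g u))) \<in> U" by (rule stable_sum[OF Uo])
      then show False using x(2) by (simp add: emb_sum[symmetric] sum_single_keys g(1))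
    qed
    then obtain u where u: "u \<in> keys g" "emb (single u 1) \<notin> U" by (elim bexE)
    have uS: "u \<in> monoid_diffs" by (rule subsetD[OF g(2) u(1)])
    have "emb (single u 1) \<in> W" by (rule stable_graded[OF Wo x(1)[unfolded g(1)] g(2) u(1)])
    with uS have "signature A u \<in> cls W" by (rule clsI)
    moreover have "signature A u \<notin> cls U"
    proof
      assume "signature A u \<in> cls U"
      then obtain v where v: "signature A u = signature A v" "v \<in> monoid_diffs" "emb (single v 1) \<in> U"
        unfolding cls_def by (elim CollectE exE conjE)
      have "emb (single u 1) \<in> U" by (rule stable_signature[OF Uo v(1)[symmetric] v(2,3) uS])
      then show False using u(2) by simp
    qed
    ultimately show "cls U \<subset> cls W" using sub by (intro psubsetI) auto
  qed
  then show ?thesis unfolding bounded_rank_def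
    by (intro exI[of _ "\<lambda>L. card (cls L)"] exI[of _ "card (range (signature A))"] conjI ballI impI fin(2))
qed

end


section \<open>Change of generators\<close>

context cech_complex begin

text \<open>Elements of the ideal generated by the \<open>h j\<close>, \<open>j \<in> V\<close>,
  may be added to the generators or removed from them one by one.\<close>

lemma bounded_cohomology_generators:
  assumes "finite W" "finite V"
    and "\<And>x. x \<in> W \<Longrightarrow> \<exists>a. (\<forall>j\<in>V. a j \<in> \<iota> ` carrier R) \<and> h x = (\<Sum>j\<in>V. a j * h j)"
  shows "bounded_cohomology (V \<union> W) k \<longleftrightarrow> bounded_cohomology V k"
  using assms(1,3)
proof (induction W rule: finite_induct)
  case (insert x W)
  have IH: "bounded_cohomology (V \<union> W) k \<longleftrightarrow> bounded_cohomology V k" by (intro insert.IH insert.prems insertI2)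
  show ?case
  proof (cases "x \<in> V \<union> W")
    case True
    then have "V \<union> insert x W = V \<union> W" by auto
    then show ?thesis using IH by simp
  next
    case False
    obtain a where a: "\<forall>j\<in>V. a j \<in> \<iota> ` carrier R" "h x = (\<Sum>j\<in>V. a j * h j)"
      using insert.prems[OF insertI1] by (elim exE conjE)
    define a' where "a' j = (if j \<in> V then a j else 0)" for j
    have z: "0 \<in> \<iota> ` carrier R" using \<iota>_zero by (intro image_eqI[of _ _ "\<zero>\<^bsub>R\<^esub>"]) simp_all
    have a': "a' j \<in> \<iota> ` carrier R" for j using a(1) z by (simp add: a'_def)
    have "(\<Sum>j\<in>V \<union> W. a' j * h j) = (\<Sum>j\<in>V. a' j * h j)"
      using assms(2) insert.hyps by (intro sum.mono_neutral_right) (auto simp: a'_def)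
    also have "\<dots> = h x" unfolding a(2) by (rule sum.cong) (simp_all add: a'_def)
    finally have hx: "h x = (\<Sum>j\<in>V \<union> W. a' j * h j)" by (rule sym)
    have fin: "finite (V \<union> W)" using assms(2) insert.hyps by simp
    have eq: "V \<union> insert x W = insert x (V \<union> W)" by simp
    show ?thesis unfolding eq IH[symmetric]
      using bounded_cohomology_insert[OF fin False refl a' hx, of k] bounded_cohomology_remove[OF fin False refl a' hx, of k] by blast
  qed
qed simp

end

context embedded_algebra begin

lemma ideal_lists:
  assumes "set xs \<subseteq> carrier R" "y \<in> Idl\<^bsub>R\<^esub> (set xs)"
  shows "\<exists>a. (\<forall>j. a j \<in> \<iota> ` carrier R) \<and> \<iota> y = (\<Sum>j<length xs. a j * \<iota> (xs ! j))"
proof -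
  let ?I = "{y \<in> carrier R. \<exists>a. (\<forall>j. a j \<in> carrier R) \<and> \<iota> y = (\<Sum>j<length xs. \<iota> (a j) * \<iota> (xs ! j))}"
  have "ideal ?I R"
  proof (rule idealI)
    show "ring R" by (rule R.ring_axioms)
    show "subgroup ?I (add_monoid R)"
    proof (rule R.add.subgroupI)
      show "?I \<subseteq> carrier R" by auto
      have "\<iota> \<zero>\<^bsub>R\<^esub> = (\<Sum>j<length xs. \<iota> \<zero>\<^bsub>R\<^esub> * \<iota> (xs ! j))" by (simp add: \<iota>_zero)
      then have "\<zero>\<^bsub>R\<^esub> \<in> ?I" by (intro CollectI conjI exI[of _ "\<lambda>_. \<zero>\<^bsub>R\<^esub>"]) simp_all
      then show "?I \<noteq> {}" by blast
    next
      fix y assume "y \<in> ?I"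
      then obtain a where a: "y \<in> carrier R" "\<forall>j. a j \<in> carrier R" "\<iota> y = (\<Sum>j<length xs. \<iota> (a j) * \<iota> (xs ! j))" by blast
      then have "\<iota> (\<ominus>\<^bsub>R\<^esub> y) = (\<Sum>j<length xs. \<iota> (\<ominus>\<^bsub>R\<^esub> a j) * \<iota> (xs ! j))"
        by (simp add: \<iota>_neg sum_negf)
      then show "\<ominus>\<^bsub>R\<^esub> y \<in> ?I" using a by (intro CollectI conjI exI[of _ "\<lambda>j. \<ominus>\<^bsub>R\<^esub> a j"]) simp_all
    next
      fix y z assume "y \<in> ?I" "z \<in> ?I"
      then obtain a b where a: "y \<in> carrier R" "\<forall>j. a j \<in> carrier R" "\<iota> y = (\<Sum>j<length xs. \<iota> (a j) * \<iota> (xs ! j))"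
        and b: "z \<in> carrier R" "\<forall>j. b j \<in> carrier R" "\<iota> z = (\<Sum>j<length xs. \<iota> (b j) * \<iota> (xs ! j))" by blast
      then have "\<iota> (y \<oplus>\<^bsub>R\<^esub> z) = (\<Sum>j<length xs. \<iota> (a j \<oplus>\<^bsub>R\<^esub> b j) * \<iota> (xs ! j))"
        by (simp add: \<iota>_add distrib_right sum.distrib)
      then show "y \<oplus>\<^bsub>R\<^esub> z \<in> ?I" using a b by (intro CollectI conjI exI[of _ "\<lambda>j. a j \<oplus>\<^bsub>R\<^esub> b j"]) simp_all
    qed
  next
    fix y x assume "y \<in> ?I" and x: "x \<in> carrier R"
    then obtain a where a: "y \<in> carrier R" "\<forall>j. a j \<in> carrier R" "\<iota> y = (\<Sum>j<length xs. \<iota> (a j) * \<iota> (xs ! j))" by blast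
    then have "\<iota> (x \<otimes>\<^bsub>R\<^esub> y) = (\<Sum>j<length xs. \<iota> (x \<otimes>\<^bsub>R\<^esub> a j) * \<iota> (xs ! j))"
      using x by (simp add: \<iota>_mult sum_distrib_left mult.assoc)
    then show 1: "x \<otimes>\<^bsub>R\<^esub> y \<in> ?I" using a x by (intro CollectI conjI exI[of _ "\<lambda>j. x \<otimes>\<^bsub>R\<^esub> a j"]) simp_all
    then show "y \<otimes>\<^bsub>R\<^esub> x \<in> ?I" using a(1) x by (simp add: R.m_comm)
  qed
  moreover have "set xs \<subseteq> ?I"
  proof
    fix x assume "x \<in> set xs"
    then obtain i where i: "i < length xs" "x = xs ! i" by (auto simp: in_set_conv_nth)
    have "\<iota> x = (\<Sum>j<length xs. if j = i then \<iota> (xs ! j) else 0)" using i by simp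
    also have "\<dots> = (\<Sum>j<length xs. \<iota> (if j = i then \<one>\<^bsub>R\<^esub> else \<zero>\<^bsub>R\<^esub>) * \<iota> (xs ! j))"
      by (rule sum.cong) (simp_all add: \<iota>_one \<iota>_zero)
    finally show "x \<in> ?I" using i assms(1)
      by (intro CollectI conjI exI[of _ "\<lambda>j. if j = i then \<one>\<^bsub>R\<^esub> else \<zero>\<^bsub>R\<^esub>"]) auto
  qed
  ultimately have "Idl\<^bsub>R\<^esub> (set xs) \<subseteq> ?I" by (rule R.genideal_minimal)
  then have "y \<in> ?I" using assms(2) by (rule subsetD)
  then obtain a where "\<forall>j. a j \<in> carrier R" "\<iota> y = (\<Sum>j<length xs. \<iota> (a j) * \<iota> (xs ! j))" by blast
  then show ?thesis by (intro exI[of _ "\<lambda>j. \<iota> (a j)"]) simp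
qed

lemma Idl_mono: "Y \<subseteq> Z \<Longrightarrow> Z \<subseteq> carrier R \<Longrightarrow> Idl\<^bsub>R\<^esub> Y \<subseteq> Idl\<^bsub>R\<^esub> Z"
  using R.genideal_self[of Z] by (intro R.genideal_minimal R.genideal_ideal) auto

text \<open>The ideals generated by finite subsets of \<open>Y\<close> are directed, so their
  union is an ideal.\<close>

lemma ideal_finite_support:
  assumes Y: "Y \<subseteq> carrier R" and y: "y \<in> Idl\<^bsub>R\<^esub> Y"
  shows "\<exists>xs. set xs \<subseteq> Y \<and> y \<in> Idl\<^bsub>R\<^esub> (set xs)"
proof -
  let ?I = "{y. \<exists>xs. set xs \<subseteq> Y \<and> y \<in> Idl\<^bsub>R\<^esub> (set xs)}"
  have idl: "ideal (Idl\<^bsub>R\<^esub> (set xs)) R" if "set xs \<subseteq> Y" for xs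
    by (rule R.genideal_ideal) (use that Y in blast)
  have "ideal ?I R"
  proof (rule idealI)
    show "ring R" by (rule R.ring_axioms)
    show "subgroup ?I (add_monoid R)"
    proof (rule R.add.subgroupI)
      show "?I \<subseteq> carrier R"
        using additive_subgroup.a_subset[OF ideal.axioms(1)[OF idl]] by blast
      have "\<zero>\<^bsub>R\<^esub> \<in> Idl\<^bsub>R\<^esub> (set [])" by (rule additive_subgroup.zero_closed[OF ideal.axioms(1)[OF idl]]) simp
      then have "\<zero>\<^bsub>R\<^esub> \<in> ?I" by (intro CollectI exI[of _ "[]"]) simp
      then show "?I \<noteq> {}" by blast
    next
      fix y assume "y \<in> ?I"
      then obtain xs where xs: "set xs \<subseteq> Y" "y \<in> Idl\<^bsub>R\<^esub> (set xs)" by blast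
      have "\<ominus>\<^bsub>R\<^esub> y \<in> Idl\<^bsub>R\<^esub> (set xs)"
        by (rule additive_subgroup.a_inv_closed[OF ideal.axioms(1)[OF idl[OF xs(1)]] xs(2)])
      then show "\<ominus>\<^bsub>R\<^esub> y \<in> ?I" using xs(1) by blast
    next
      fix y z assume "y \<in> ?I" "z \<in> ?I"
      then obtain xs ys where xs: "set xs \<subseteq> Y" "y \<in> Idl\<^bsub>R\<^esub> (set xs)" and ys: "set ys \<subseteq> Y" "z \<in> Idl\<^bsub>R\<^esub> (set ys)" by blast
      have s: "set (xs @ ys) \<subseteq> Y" using xs ys by simp
      have "y \<in> Idl\<^bsub>R\<^esub> (set (xs @ ys))" by (rule subsetD[OF Idl_mono xs(2)]) (use s Y in auto)
      moreover have "z \<in> Idl\<^bsub>R\<^esub> (set (xs @ ys))" by (rule subsetD[OF Idl_mono ys(2)]) (use s Y in auto)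
      ultimately have "y \<oplus>\<^bsub>R\<^esub> z \<in> Idl\<^bsub>R\<^esub> (set (xs @ ys))"
        by (rule additive_subgroup.a_closed[OF ideal.axioms(1)[OF idl[OF s]]])
      then show "y \<oplus>\<^bsub>R\<^esub> z \<in> ?I" using s by blast
    qed
  next
    fix y x assume "y \<in> ?I" and x: "x \<in> carrier R"
    then obtain xs where xs: "set xs \<subseteq> Y" "y \<in> Idl\<^bsub>R\<^esub> (set xs)" by blast
    show "x \<otimes>\<^bsub>R\<^esub> y \<in> ?I" using ideal.I_l_closed[OF idl[OF xs(1)] xs(2) x] xs(1) by blast
    show "y \<otimes>\<^bsub>R\<^esub> x \<in> ?I" using ideal.I_r_closed[OF idl[OF xs(1)] xs(2) x] xs(1) by blast
  qed
  moreover have "Y \<subseteq> ?I"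
  proof
    fix x assume x: "x \<in> Y"
    have "x \<in> Idl\<^bsub>R\<^esub> (set [x])" using R.genideal_self[of "{x}"] x Y by auto
    then show "x \<in> ?I" using x by (intro CollectI exI[of _ "[x]"]) simp
  qed
  ultimately have "Idl\<^bsub>R\<^esub> Y \<subseteq> ?I" by (rule R.genideal_minimal)
  then show ?thesis using y by blast
qed

end

context toric begin

text \<open>Each of the given generators lies in an ideal generated by finitely many of the
  monomials. Put these monomials \<open>gs\<close> behind the given list \<open>fs\<close>: the
  cohomology of \<open>gs\<close> has finite length, adding \<open>fs\<close> and then removing
  \<open>gs\<close> does not change it.\<close>

lemma finite_length_local_cohomology_monomial_ideal:
  fixes fs :: "(int ^ 'd \<Rightarrow>\<^sub>0 'k) list"
  assumes mono: "monomial_ideal A I" and fs: "set fs \<subseteq> carrier TA" and I: "I = Idl\<^bsub>TA\<^esub> (set fs)"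
  shows "finite_length_module (diff_ring TK TA) (local_cohomology TK TA fs k)"
proof -
  obtain B where B: "B \<subseteq> S" "I = Idl\<^bsub>TA\<^esub> ((\<lambda>b. single b 1) ` B)"
    using mono by (auto simp: monomial_ideal_def)
  let ?Y = "(\<lambda>b. single b 1) ` B"
  have Y: "?Y \<subseteq> carrier TA" using B(1) single_TA by blast
  have "\<exists>gs. set gs \<subseteq> ?Y \<and> f \<in> Idl\<^bsub>TA\<^esub> (set gs)" if "f \<in> set fs" for f
  proof (rule T.ideal_finite_support[OF Y])
    have "f \<in> I" unfolding I using T.R.genideal_self[OF fs] that by (rule subsetD)
    then show "f \<in> Idl\<^bsub>TA\<^esub> ?Y" using B(2) by (simp only:)
  qed
  then have "\<forall>f\<in>set fs. \<exists>gs. set gs \<subseteq> ?Y \<and> f \<in> Idl\<^bsub>TA\<^esub> (set gs)" by (intro ballI)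
  from bchoice[OF this] obtain G where G: "\<forall>f\<in>set fs. set (G f) \<subseteq> ?Y \<and> f \<in> Idl\<^bsub>TA\<^esub> (set (G f))" ..
  define gs where "gs = concat (map G fs)"
  have gsY: "set gs \<subseteq> ?Y" using G unfolding gs_def set_concat set_map by (intro UN_least) auto
  then have gsR: "set gs \<subseteq> carrier TA" using Y by (rule subset_trans)
  have fs_gs: "f \<in> Idl\<^bsub>TA\<^esub> (set gs)" if "f \<in> set fs" for f
  proof (rule subsetD[OF T.Idl_mono])
    show "f \<in> Idl\<^bsub>TA\<^esub> (set (G f))" using bspec[OF G that] by (rule conjunct2)
    show "set (G f) \<subseteq> set gs" using that by (auto simp: gs_def)
  qed (rule gsR)
  have gs_fs: "g \<in> Idl\<^bsub>TA\<^esub> (set fs)" if "g \<in> set gs" for g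
  proof -
    have "g \<in> I" unfolding B(2) by (rule subsetD[OF T.R.genideal_self[OF Y] subsetD[OF gsY that]])
    then show ?thesis by (simp only: I)
  qed
  define m where "m = length fs"
  define n where "n = length gs"
  \<comment> \<open>the value \<open>1\<close> at vanishing generators only serves to keep all \<open>h j\<close> nonzero\<close>
  define h where "h j = (if j < m + n \<and> (fs @ gs) ! j \<noteq> 0 then emb ((fs @ gs) ! j) else 1)" for j
  have fg: "j < m + n \<Longrightarrow> (fs @ gs) ! j \<in> carrier TA" for j
    using fs gsR nth_mem[of j "fs @ gs"] by (auto simp: m_def n_def)
  interpret C: cech_complex TK TA emb h
  proof (intro cech_complex.intro cech_complex_axioms.intro T.embedded_algebra_axioms)
    fix j
    have "1 \<in> emb ` carrier TA" using emb_one T.R.one_closed by (metis TA_simps(4) image_eqI)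
    then show "h j \<in> emb ` carrier TA" using fg[of j] by (simp add: h_def)
    show "h j \<noteq> 0" by (simp add: h_def emb_eq_0_iff)
  qed
  define V where "V = {j. j < m \<and> fs ! j \<noteq> 0}"
  define W where "W = {m..<m + n}"
  have fin: "finite V" "finite W" by (simp_all add: V_def W_def)
  have hV: "h j = emb (fs ! j)" if "j \<in> V" for j
    using that by (auto simp: h_def V_def nth_append m_def)
  have gmono: "\<exists>b\<in>S. gs ! j = single b 1" if j: "j < n" for j
  proof -
    have "gs ! j \<in> ?Y" by (rule subsetD[OF gsY nth_mem]) (use j in \<open>simp add: n_def\<close>)
    then obtain b where b: "b \<in> B" "gs ! j = single b 1" by (elim imageE)
    show ?thesis by (intro bexI[of _ b] b(2) subsetD[OF B(1) b(1)])
  qed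
  have hW: "h (m + j) = emb (gs ! j)" if j: "j < n" for j
  proof -
    obtain b where b: "gs ! j = single b 1" using gmono[OF j] by (elim bexE)
    have "emb (gs ! j) \<noteq> 0" unfolding b by (rule emb_single_nz) simp
    then have "gs ! j \<noteq> 0" by (simp add: emb_eq_0_iff)
    then show ?thesis using j by (simp add: h_def nth_append m_def)
  qed
  have hmono: "\<exists>b\<in>S. C.hprod J = emb (single b 1)" if "J \<subseteq> W" for J
    using finite_subset[OF that fin(2)] that
  proof (induction J rule: finite_induct)
    case empty
    show ?case using monoid_of_zero emb_one by (intro bexI[of _ 0]) (simp_all add: C.hprod_def)
  next
    case (insert j J)
    obtain b where b: "b \<in> S" "C.hprod J = emb (single b 1)" using insert by auto
    have j: "j - m < n" "j = m + (j - m)" using insert.prems by (auto simp: W_def)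
    obtain c where c: "c \<in> S" "gs ! (j - m) = single c 1" using gmono[OF j(1)] by (elim bexE)
    have "h j = emb (single c 1)" using hW[OF j(1)] j(2) c(2) by simp
    then have "C.hprod (insert j J) = emb (single (c + b) 1)"
      using insert.hyps b(2) by (simp add: C.hprod_insert emb_mult[symmetric] mult_single)
    then show ?case using monoid_of_add[OF c(1) b(1)] by (rule bexI)
  qed
  have "C.bounded_cohomology W k"
  proof (rule C.bounded_cohomology_of_Loc[OF fin(2)])
    fix J assume "J \<subseteq> W"
    from hmono[OF this] obtain b where "b \<in> S" "C.hprod J = emb (single b 1)" by (elim bexE)
    then show "bounded_rank {L. T.stable L \<and> L \<subseteq> T.Loc (C.hprod J)}"
      using bounded_rank_Loc_monomial by simp
  qed
  moreover have "C.bounded_cohomology (W \<union> V) k \<longleftrightarrow> C.bounded_cohomology W k"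
  proof (rule C.bounded_cohomology_generators[OF fin])
    fix x assume x: "x \<in> V"
    then have "fs ! x \<in> set fs" by (simp add: V_def m_def)
    from T.ideal_lists[OF gsR fs_gs[OF this]] obtain a
      where a: "\<forall>j. a j \<in> emb ` carrier TA" "emb (fs ! x) = (\<Sum>j<n. a j * emb (gs ! j))"
      by (auto simp: n_def)
    have "h x = (\<Sum>j<n. a j * h (m + j))" unfolding hV[OF x] a(2) by (rule sum.cong) (simp_all add: hW)
    also have "\<dots> = (\<Sum>j\<in>W. a (j - m) * h j)"
      unfolding W_def by (rule sum.reindex_bij_witness[of _ "\<lambda>j. j - m" "\<lambda>j. m + j"]) auto
    finally show "\<exists>a. (\<forall>j\<in>W. a j \<in> emb ` carrier TA) \<and> h x = (\<Sum>j\<in>W. a j * h j)"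
      using a(1) by (intro exI[of _ "\<lambda>j. a (j - m)"]) simp
  qed
  moreover have "C.bounded_cohomology (V \<union> W) k \<longleftrightarrow> C.bounded_cohomology V k"
  proof (rule C.bounded_cohomology_generators[OF fin(2,1)])
    fix x assume x: "x \<in> W"
    then have xj: "x - m < n" "x = m + (x - m)" by (auto simp: W_def)
    then have "gs ! (x - m) \<in> set gs" by (simp add: n_def)
    from T.ideal_lists[OF fs gs_fs[OF this]] obtain a
      where a: "\<forall>j. a j \<in> emb ` carrier TA" "emb (gs ! (x - m)) = (\<Sum>j<m. a j * emb (fs ! j))"
      by (auto simp: m_def)
    have "h x = (\<Sum>j<m. a j * emb (fs ! j))" using hW[OF xj(1)] xj(2) a(2) by simp
    also have "\<dots> = (\<Sum>j\<in>V. a j * emb (fs ! j))"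
      by (rule sum.mono_neutral_right) (auto simp: V_def emb_zero)
    also have "\<dots> = (\<Sum>j\<in>V. a j * h j)" by (rule sum.cong) (simp_all add: hV)
    finally show "\<exists>a. (\<forall>j\<in>V. a j \<in> emb ` carrier TA) \<and> h x = (\<Sum>j\<in>V. a j * h j)"
      using a(1) by (intro exI[of _ a]) simp
  qed
  ultimately have "C.bounded_cohomology V k" by (simp add: Un_commute)
  then show ?thesis
    by (intro C.finite_length_local_cohomology[OF fs _ hV]) (simp_all add: V_def m_def TA_simps(5))
qed

end

theorem theorem3p3:
  fixes A :: "int ^ 'n ^ 'd"
    and I :: "((int ^ 'd) \<Rightarrow>\<^sub>0 'k::{alg_closed_field, field_char_0}) set"
    and fs :: "((int ^ 'd) \<Rightarrow>\<^sub>0 'k) list"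
    and i :: nat
  assumes "lattice_of A = UNIV"
    and "monomial_ideal A I"
    and "set fs \<subseteq> carrier (toric_algebra A)"
    and "I = Idl\<^bsub>toric_algebra A\<^esub> (set fs)"
  shows "finite_length_module
    (diff_ring (ring_of_type_algebra :: 'k ring) (toric_algebra A))
    (local_cohomology (ring_of_type_algebra :: 'k ring) (toric_algebra A) fs i)"
  by (rule toric.finite_length_local_cohomology_monomial_ideal[OF assms(2-4)])

end
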